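(* Let $K$ be a field of characteristic $0$ or a finite field, let $\mathcal{G}=\mathrm{GA}_2(K)$, and let $f\in\mathcal{G}$ be a CR element that is reversible with reversor $r\in\mathcal{G}$. Then $r$ is an element of finite even order. If $\mathrm{char}(K)=0$ and if, in addition, the group of roots of unity in $K$ is $U=\{\pm1\}\simeq C_2$, then $r$ is an involution or an element of order $4$.
   Context: $\mathcal{G}=\mathrm{GA}_2(K)$ is the group, under composition, of polynomial automorphisms of the affine plane over $K$: maps $x'=P(x,y),\ y'=Q(x,y)$ with $P,Q\in K[x,y]$ that have a polynomial inverse; elements are formal polynomial maps, i.e. distinguished by their polynomials. A reversor of $f$ is an element $r\in\mathcal{G}$ with $rfr^{-1}=f^{-1}$; $f$ is reversible if it has a reversor. An involution is an element $s$ with $s^2=1\neq s$. Let $\mathcal{A}\subset\mathcal{G}$ be the subgroup of affine maps $\boldsymbol{x}\mapsto M\boldsymbol{x}+\boldsymbol{a}$ ($M\in\mathrm{GL}(2,K)$, $\boldsymbol{a}\in K^2$), $\mathcal{E}\subset\mathcal{G}$ the subgroup of elementary maps $x'=\alpha x+P(y),\ y'=\beta y+v$ ($P\in K[y]$, $\alpha,\beta,v\in K$, $\alpha\beta\neq0$), and $\mathcal{B}=\mathcal{A}\cap\mathcal{E}$. Every $g\in\mathcal{G}\setminus\mathcal{B}$ can be written as $g=g_n\circ\cdots\circ g_1$ with $n\ge1$ and factors alternating between $\mathcal{A}\setminus\mathcal{B}$ and $\mathcal{E}\setminus\mathcal{B}$; $n$ depends only on $g$ and is called the length $\mathrm{len}(g)$;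 put $\mathrm{len}(g)=0$ for $g\in\mathcal{B}$. An element is cyclically reduced if its length is even and $>0$. A CR element is an element of $\mathcal{G}$ that is conjugate in $\mathcal{G}$ to a cyclically reduced element. *)

theory Defs
  imports "HOL-Algebra.Multiplicative_Group" "HOL-Computational_Algebra.Polynomial"
begin

hide_const (open) UnivPoly.coeff UnivPoly.monom UnivPoly.deg

text \<open>
  A polynomial in \<open>K[x, y]\<close> is represented by an element of \<open>K[x][y]\<close>: the coefficients of the
  outer polynomial are polynomials in \<open>x\<close>, the outer variable is \<open>y\<close>.  A formal polynomial map
  \<open>x' = P(x, y)\<close>, \<open>y' = Q(x, y)\<close> is the pair \<open>(P, Q)\<close>.
\<close>

type_synonym 'a plane_map = "'a poly poly \<times> 'a poly poly"

definition const2 :: "'a::field \<Rightarrow> 'a poly poly" where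
  "const2 c = [:[:c:]:]"

definition X2 :: "'a::field poly poly" where
  "X2 = [:[:0, 1:]:]"

definition Y2 :: "'a::field poly poly" where
  "Y2 = [:0, 1:]"

text \<open>\<open>poly_in_y P\<close> is the univariate polynomial \<open>P\<close> read as \<open>P(y)\<close> in \<open>K[x, y]\<close>.\<close>

definition poly_in_y :: "'a::field poly \<Rightarrow> 'a poly poly" where
  "poly_in_y P = map_poly (\<lambda>c. [:c:]) P"

text \<open>\<open>subst2 g P\<close> is \<open>P(A, B)\<close> for \<open>g = (A, B)\<close>; the inner \<open>poly\<close> substitutes \<open>A\<close> for \<open>x\<close>, the
  outer one \<open>B\<close> for \<open>y\<close>.\<close>

definition subst2 :: "'a::field plane_map \<Rightarrow> 'a poly poly \<Rightarrow> 'a poly poly" where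
  "subst2 g P = poly (map_poly (\<lambda>c. poly (map_poly const2 c) (fst g)) P) (snd g)"

text \<open>The monoid of all polynomial maps under composition, \<open>(f \<circ> g)(x, y) = f(g(x, y))\<close>.\<close>

definition poly_endo :: "'a::field plane_map monoid" where
  "poly_endo = \<lparr>carrier = UNIV,
     monoid.mult = (\<lambda>f g. (subst2 g (fst f), subst2 g (snd f))),
     one = (X2, Y2)\<rparr>"

definition GA2 :: "'a::field plane_map monoid" where
  "GA2 = units_of poly_endo"

definition affine_maps :: "'a::field plane_map set" where
  "affine_maps =
     {(const2 a * X2 + const2 b * Y2 + const2 u, const2 c * X2 + const2 d * Y2 + const2 v)
      | a b c d u v. a * d - b * c \<noteq> 0}"

definition elementary_maps :: "'a::field plane_map set" where
  "elementary_maps =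
     {(const2 \<alpha> * X2 + poly_in_y P, const2 \<beta> * Y2 + const2 v) | \<alpha> \<beta> v P. \<alpha> * \<beta> \<noteq> 0}"

definition basic_maps :: "'a::field plane_map set" where
  "basic_maps = affine_maps \<inter> elementary_maps"

definition alternating :: "'a::field plane_map list \<Rightarrow> bool" where
  "alternating gs \<longleftrightarrow>
     set gs \<subseteq> (affine_maps - basic_maps) \<union> (elementary_maps - basic_maps) \<and>
     successively (\<lambda>g h. (g \<in> affine_maps - basic_maps \<and> h \<in> elementary_maps - basic_maps) \<or>
                         (g \<in> elementary_maps - basic_maps \<and> h \<in> affine_maps - basic_maps)) gs"

text \<open>The length of an alternating factorisation of \<open>g\<close>.  A list \<open>[g\<^sub>n, \<dots>, g\<^sub>1]\<close> of factors
  stands for \<open>g\<^sub>n \<circ> \<dots> \<circ> g\<^sub>1\<close>.  The description is meaningful because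
  every element of \<open>GA2\<close> outside \<open>basic_maps\<close> has such a factorisation and all of
  them have the same number of factors.\<close>

definition ga2_length :: "'a::field plane_map \<Rightarrow> nat" where
  "ga2_length g = (if g \<in> basic_maps then 0
     else (THE n. \<exists>gs. length gs = n \<and> n \<ge> 1 \<and> alternating gs \<and>
                       foldr (monoid.mult GA2) gs (one GA2) = g))"

definition cyclically_reduced :: "'a::field plane_map \<Rightarrow> bool" where
  "cyclically_reduced g \<longleftrightarrow> g \<in> carrier GA2 \<and> even (ga2_length g) \<and> ga2_length g > 0"

definition CR_element :: "'a::field plane_map \<Rightarrow> bool" where
  "CR_element f \<longleftrightarrow> (\<exists>g h. cyclically_reduced g \<and> h \<in> carrier GA2 \<and>
     f = h \<otimes>\<^bsub>GA2\<^esub> g \<otimes>\<^bsub>GA2\<^esub> inv\<^bsub>GA2\<^esub> h)"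

definition reversor :: "('b, 'c) monoid_scheme \<Rightarrow> 'b \<Rightarrow> 'b \<Rightarrow> bool" where
  "reversor G f r \<longleftrightarrow> r \<in> carrier G \<and> r \<otimes>\<^bsub>G\<^esub> f \<otimes>\<^bsub>G\<^esub> inv\<^bsub>G\<^esub> r = inv\<^bsub>G\<^esub> f"

definition involution :: "('b, 'c) monoid_scheme \<Rightarrow> 'b \<Rightarrow> bool" where
  "involution G s \<longleftrightarrow> s \<in> carrier G \<and> s \<otimes>\<^bsub>G\<^esub> s = \<one>\<^bsub>G\<^esub> \<and> s \<noteq> \<one>\<^bsub>G\<^esub>"

text \<open>Composition is associative, so \<open>GA2\<close> is a group; affine and elementary maps belong to it.\<close>

lemma poly_map_poly_hom:
  fixes \<phi> :: "'b::comm_ring_1 \<Rightarrow> 'c::comm_ring_1"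
  assumes "\<phi> 0 = 0" "\<And>a b. \<phi> (a + b) = \<phi> a + \<phi> b" "\<And>a b. \<phi> (a * b) = \<phi> a * \<phi> b"
  shows "poly (map_poly \<phi> (p + q)) z = poly (map_poly \<phi> p) z + poly (map_poly \<phi> q) z"
    and "poly (map_poly \<phi> (p * q)) z = poly (map_poly \<phi> p) z * poly (map_poly \<phi> q) z"
proof -
  have add: "poly (map_poly \<phi> (p + q)) z = poly (map_poly \<phi> p) z + poly (map_poly \<phi> q) z" for p q
    by (induction p q rule: poly_induct2) (simp_all add: map_poly_pCons assms algebra_simps)
  have smult: "poly (map_poly \<phi> (smult a q)) z = \<phi> a * poly (map_poly \<phi> q) z" for a q
    by (induction q) (simp_all add: map_poly_pCons assms algebra_simps)
  show "poly (map_poly \<phi> (p + q)) z = poly (map_poly \<phi> p) z + poly (map_poly \<phi> q) z"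
    by (rule add)
  show "poly (map_poly \<phi> (p * q)) z = poly (map_poly \<phi> p) z * poly (map_poly \<phi> q) z"
    by (induction p) (simp_all add: map_poly_pCons assms add smult algebra_simps)
qed

lemma const2_hom: "const2 0 = 0" "const2 1 = 1"
  "const2 (a + b) = const2 a + const2 b" "const2 (a * b) = const2 a * const2 b"
  by (simp_all add: const2_def one_pCons)

lemma subst2_0 [simp]: "subst2 g 0 = 0"
  by (simp add: subst2_def)

lemma subst2_pCons:
  "subst2 g (pCons c P) = poly (map_poly const2 c) (fst g) + snd g * subst2 g P"
  by (simp add: subst2_def map_poly_pCons)

lemma subst2_add: "subst2 g (P + Q) = subst2 g P + subst2 g Q"
  and subst2_mult: "subst2 g (P * Q) = subst2 g P * subst2 g Q"
  unfolding subst2_def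
  by (rule poly_map_poly_hom; simp add: poly_map_poly_hom const2_hom)+

lemma subst2_const2 [simp]: "subst2 g (const2 c) = const2 c"
  by (simp add: subst2_def const2_def map_poly_pCons)

lemma subst2_X2 [simp]: "subst2 g X2 = fst g"
  by (simp add: subst2_def X2_def map_poly_pCons const2_hom)

lemma subst2_Y2 [simp]: "subst2 g Y2 = snd g"
  by (simp add: subst2_def Y2_def map_poly_pCons map_poly_1 const2_hom)

lemma pCons_eq_X2_Y2:
  "[:pCons a p:] = const2 a + X2 * [:p:]" "pCons c P = [:c:] + Y2 * P"
  by (simp_all add: const2_def X2_def Y2_def)

lemma poly2_induct [case_names const X Y add mult]:
  assumes "\<And>c. S (const2 c)" "S X2" "S Y2"
    "\<And>P Q. S P \<Longrightarrow> S Q \<Longrightarrow> S (P + Q)" "\<And>P Q. S P \<Longrightarrow> S Q \<Longrightarrow> S (P * Q)"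
  shows "S (P :: 'a::field poly poly)"
proof -
  have const: "S [:p:]" for p :: "'a poly"
  proof (induction p)
    case 0
    show ?case using assms(1)[of 0] by (simp add: const2_def)
  next
    case (pCons a p)
    show ?case unfolding pCons_eq_X2_Y2(1) using assms pCons by blast
  qed
  show ?thesis
  proof (induction P)
    case 0
    show ?case using const[of 0] by simp
  next
    case (pCons c P)
    show ?case unfolding pCons_eq_X2_Y2(2)[of c P] using assms pCons const by blast
  qed
qed

lemma subst2_subst2: "subst2 h (subst2 g P) = subst2 (subst2 h (fst g), subst2 h (snd g)) P"
  by (induction P rule: poly2_induct) (simp_all add: subst2_add subst2_mult)

lemma subst2_id: "subst2 (X2, Y2) P = P"
  by (induction P rule: poly2_induct) (simp_all add: subst2_add subst2_mult)

lemma monoid_poly_endo: "monoid poly_endo"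
  by (rule monoidI) (simp_all add: poly_endo_def subst2_subst2 subst2_id)

lemma group_GA2: "group GA2"
  unfolding GA2_def by (rule monoid.units_group[OF monoid_poly_endo])

lemma carrier_GA2I:
  assumes "g \<otimes>\<^bsub>poly_endo\<^esub> h = (X2, Y2)" "h \<otimes>\<^bsub>poly_endo\<^esub> g = (X2, Y2)"
  shows "g \<in> carrier GA2"
proof -
  have "g \<in> Units poly_endo"
    unfolding Units_def using assms
    by (intro CollectI conjI bexI[of _ h]) (simp_all add: poly_endo_def)
  then show ?thesis by (simp add: GA2_def units_of_carrier)
qed

lemma affine_maps_subset: "affine_maps \<subseteq> carrier GA2"
proof
  fix g :: "'a plane_map"
  assume "g \<in> affine_maps"
  then obtain a b c d u v where nz: "a * d - b * c \<noteq> 0" and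
    g: "g = (const2 a * X2 + const2 b * Y2 + const2 u, const2 c * X2 + const2 d * Y2 + const2 v)"
    by (auto simp: affine_maps_def)
  define e where "e = inverse (a * d - b * c)"
  have e: "a * d * e - b * c * e = 1"
    using nz unfolding e_def by (metis left_diff_distrib right_inverse)
  let ?h = "(const2 (d * e) * X2 + const2 (- b * e) * Y2 + const2 (e * (b * v - d * u)),
             const2 (- c * e) * X2 + const2 (a * e) * Y2 + const2 (e * (c * u - a * v)))"
  have e': "a * (d * e) = 1 + b * (c * e)" "a * (d * (e * z)) = z + b * (c * (e * z))" for z
  proof -
    show *: "a * (d * e) = 1 + b * (c * e)"
      using e by (simp add: algebra_simps)
    show "a * (d * (e * z)) = z + b * (c * (e * z))"
      using arg_cong[OF *, of "\<lambda>t. t * z"] by (simp add: distrib_right mult.assoc)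
  qed
  have "g \<otimes>\<^bsub>poly_endo\<^esub> ?h = (X2, Y2)" "?h \<otimes>\<^bsub>poly_endo\<^esub> g = (X2, Y2)"
    unfolding g
    by (simp_all add: poly_endo_def subst2_add subst2_mult)
       (simp_all add: const2_def X2_def Y2_def algebra_simps e')
  then show "g \<in> carrier GA2" by (rule carrier_GA2I)
qed

lemma poly_in_y_pCons: "poly_in_y (pCons a P) = const2 a + Y2 * poly_in_y P"
  by (simp add: poly_in_y_def map_poly_pCons const2_def Y2_def)

lemma poly_in_y_0 [simp]: "poly_in_y 0 = 0"
  by (simp add: poly_in_y_def)

lemma poly_in_y_add: "poly_in_y (P + Q) = poly_in_y P + poly_in_y Q"
  by (induction P Q rule: poly_induct2) (simp_all add: poly_in_y_pCons const2_hom algebra_simps)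

lemma poly_in_y_smult: "poly_in_y (smult a P) = const2 a * poly_in_y P"
  by (induction P) (simp_all add: poly_in_y_pCons const2_hom algebra_simps)

lemma poly_in_y_mult: "poly_in_y (P * Q) = poly_in_y P * poly_in_y Q"
  by (induction P)
     (simp_all add: poly_in_y_pCons const2_hom poly_in_y_add poly_in_y_smult algebra_simps)

lemma poly_in_y_pcompose: "poly_in_y (pcompose P Q) = subst2 (A, poly_in_y Q) (poly_in_y P)"
  by (induction P)
     (simp_all add: pcompose_pCons poly_in_y_pCons poly_in_y_add poly_in_y_mult subst2_add subst2_mult)

lemma subst2_poly_in_y: "subst2 (A, B) (poly_in_y P) = subst2 (A', B) (poly_in_y P)"
  by (induction P) (simp_all add: poly_in_y_pCons subst2_add subst2_mult)

lemma elementary_maps_subset: "elementary_maps \<subseteq> carrier GA2"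
proof
  fix g :: "'a plane_map"
  assume "g \<in> elementary_maps"
  then obtain \<alpha> \<beta> v P where nz: "\<alpha> \<noteq> 0" "\<beta> \<noteq> 0" and
    g: "g = (const2 \<alpha> * X2 + poly_in_y P, const2 \<beta> * Y2 + const2 v)"
    by (auto simp: elementary_maps_def)
  define \<alpha>' \<beta>' where "\<alpha>' = inverse \<alpha>" and "\<beta>' = inverse \<beta>"
  have inv: "const2 \<alpha> * const2 \<alpha>' = 1" "const2 \<beta> * const2 \<beta>' = 1"
    using nz by (simp_all add: \<alpha>'_def \<beta>'_def flip: const2_hom)
  have neg: "const2 (- c) = - const2 c" for c :: 'a
    by (simp add: const2_def)
  define L where "L = [:- (\<beta>' * v), \<beta>':]"
  have L: "poly_in_y L = const2 \<beta>' * Y2 - const2 \<beta>' * const2 v"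
    by (simp add: L_def poly_in_y_pCons const2_hom neg)
  define h where "h = (const2 \<alpha>' * X2 - const2 \<alpha>' * poly_in_y (pcompose P L), poly_in_y L)"
  have 1: "subst2 h (poly_in_y P) = poly_in_y (pcompose P L)"
    unfolding h_def by (rule poly_in_y_pcompose[symmetric])
  have sub: "subst2 k (p - q) = subst2 k p - subst2 k q" for k p q
    using subst2_add[of k "p - q" q] by (simp add: algebra_simps)
  have L': "subst2 g (poly_in_y L) = Y2"
  proof -
    have "subst2 g (poly_in_y L) = (const2 \<beta> * const2 \<beta>') * Y2"
      unfolding L sub subst2_mult by (simp add: g algebra_simps)
    then show ?thesis by (simp add: inv)
  qed
  have 2: "subst2 g (poly_in_y (pcompose P L)) = poly_in_y P"
  proof -
    have "subst2 g (poly_in_y (pcompose P L)) = subst2 (fst g, Y2) (poly_in_y P)"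
      by (simp add: poly_in_y_pcompose[of P L X2] subst2_subst2 L')
    also have "\<dots> = subst2 (X2, Y2) (poly_in_y P)"
      by (rule subst2_poly_in_y)
    finally show ?thesis by (simp add: subst2_id)
  qed
  have inv': "const2 \<alpha> * (const2 \<alpha>' * z) = z" "const2 \<beta> * (const2 \<beta>' * z) = z"
    "const2 \<alpha>' * (const2 \<alpha> * z) = z" for z
    using inv by (simp_all flip: mult.assoc) (simp add: mult.commute)
  have "subst2 h (fst g) = X2" "subst2 h (snd g) = Y2"
    unfolding g fst_conv snd_conv subst2_add subst2_mult 1
    by (simp_all add: h_def L right_diff_distrib inv')
  moreover have "subst2 g (fst h) = X2" "subst2 g (snd h) = Y2"
    unfolding h_def fst_conv snd_conv sub subst2_mult 2 L'
    by (simp_all add: g distrib_left inv')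
  ultimately show "g \<in> carrier GA2"
    by (intro carrier_GA2I[of g h]) (simp_all add: poly_endo_def)
qed

end

theory Submission
  imports Defs "HOL-Algebra.Generated_Groups"
begin

text \<open>
  Affine and elementary maps generate \<open>GA2\<close> (Jung, van der Kulk).  Given an automorphism
  \<open>(F, G)\<close> with inverse \<open>(p, q)\<close>, the additive group acts by
  \<open>(x, y) \<mapsto> (p(F, G + s), q(F, G + s))\<close>, which fixes \<open>F\<close>.  Passing to leading terms for a pair
  of weights gives a nontrivial flow that fixes the weighted leading form of \<open>F\<close>.  A form with a
  nontrivial flow is a power of a linear form, or of \<open>x - c y\<^sup>b\<close> when it comes from an edge of the
  Newton polygon, so an affine and an elementary substitution lower the degree of \<open>F\<close>.

  Degrees along the curve \<open>(t\<^sup>3, t\<^sup>2)\<close> show that \<open>GA2\<close> is the amalgam of the affine and the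
  elementary group.  A CR element \<open>f\<close> is hyperbolic on the Bass--Serre tree, and a reversor \<open>r\<close>
  reflects the axis of \<open>f\<close>, so \<open>r\<^sup>2\<close> fixes the axis pointwise.  Every edge stabilizer is conjugate
  to the group of basic maps, which is finite if \<open>K\<close> is finite.  In characteristic \<open>0\<close> the diagonal
  entries of an element fixing the axis satisfy \<open>\<alpha> = \<beta>\<^sup>d\<close> at elementary vertices and are
  interchanged at affine vertices; hence they are roots of unity, and an element with both entries
  equal to \<open>1\<close> is trivial.  The order of \<open>r\<close> is even because otherwise \<open>r\<close> would be a power of
  \<open>r\<^sup>2\<close>, which commutes with \<open>f\<close>, giving \<open>f\<^sup>2 = 1\<close>.
\<close>

section \<open>Evaluation of bivariate polynomials\<close>

text \<open>The part on polynomials must also cover finite fields, where derivatives lose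
  information and a nonzero polynomial can vanish on all of K^2. The flow is therefore a formal
  polynomial in its time s and not a derivation, and its starting point is taken over K[t], on a
  curve (t, t^M) along which the leading form does not vanish. The curve (t^3, t^2) is chosen
  because 3/2 lies strictly between 1 and 2: the effect of an affine letter on the degrees is
  determined once the first degree exceeds the second, that of an elementary letter once the first
  is less than twice the second, and basic maps leave the degrees 3 and 2 alone. No tree is built.
  An edge is a group element modulo the intersection of the two subgroups, and the distance between
  the edges of x and y is the length of x^-1 y as an alternating word. The roots of unity come from
  three consecutive steps of the axis: two elementary vertices with exponents d and d', separated by
  one interchange, give \<beta> = \<beta>^(d d') with d d' \<ge> 4.\<close>

locale coeff_hom =
  fixes \<kappa> :: "'a::field \<Rightarrow> 'b::comm_ring_1"
  assumes hom_0 [simp]: "\<kappa> 0 = 0" and hom_1 [simp]: "\<kappa> 1 = 1"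
    and hom_add: "\<kappa> (a + b) = \<kappa> a + \<kappa> b" and hom_mult: "\<kappa> (a * b) = \<kappa> a * \<kappa> b"

text \<open>The target is any commutative ring with structure map \<open>\<kappa>\<close>, because
  points in two rings are needed: \<open>const2\<close> gives ordinary substitution in K[x, y], and
  \<open>const3\<close> leads to the ring with the grading variable and the time of the
  flow.\<close>

definition ev2 :: "('a::field \<Rightarrow> 'b::comm_ring_1) \<Rightarrow> 'b \<Rightarrow> 'b \<Rightarrow> 'a poly poly \<Rightarrow> 'b" where
  "ev2 \<kappa> X Y P = poly (map_poly (\<lambda>c. poly (map_poly \<kappa> c) X) P) Y"

lemma subst2_eq_ev2: "subst2 (A, B) P = ev2 const2 A B P"
  by (simp add: subst2_def ev2_def)

context coeff_hom
begin

lemma ev2_0 [simp]: "ev2 \<kappa> X Y 0 = 0"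
  by (simp add: ev2_def)

lemma ev2_add: "ev2 \<kappa> X Y (P + Q) = ev2 \<kappa> X Y P + ev2 \<kappa> X Y Q"
  and ev2_mult: "ev2 \<kappa> X Y (P * Q) = ev2 \<kappa> X Y P * ev2 \<kappa> X Y Q"
  unfolding ev2_def
  by (rule poly_map_poly_hom; simp add: poly_map_poly_hom hom_add hom_mult)+

lemma ev2_const2 [simp]: "ev2 \<kappa> X Y (const2 c) = \<kappa> c"
  by (simp add: ev2_def const2_def map_poly_pCons)

lemma ev2_X2 [simp]: "ev2 \<kappa> X Y X2 = X"
  by (simp add: ev2_def X2_def map_poly_pCons)

lemma ev2_Y2 [simp]: "ev2 \<kappa> X Y Y2 = Y"
  by (simp add: ev2_def Y2_def map_poly_pCons map_poly_1)

lemma ev2_1 [simp]: "ev2 \<kappa> X Y 1 = 1"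
  using ev2_const2[of X Y 1] by (simp add: const2_hom)

lemma ev2_diff: "ev2 \<kappa> X Y (P - Q) = ev2 \<kappa> X Y P - ev2 \<kappa> X Y Q"
  using ev2_add[of X Y "P - Q" Q] by (simp add: algebra_simps)

lemma ev2_power: "ev2 \<kappa> X Y (P ^ n) = ev2 \<kappa> X Y P ^ n"
  by (induction n) (simp_all add: ev2_mult)

lemma ev2_sum: "ev2 \<kappa> X Y (sum f I) = (\<Sum>i\<in>I. ev2 \<kappa> X Y (f i))"
  by (induction I rule: infinite_finite_induct) (simp_all add: ev2_add)

lemma ev2_subst2:
  "ev2 \<kappa> X Y (subst2 g P) = ev2 \<kappa> (ev2 \<kappa> X Y (fst g)) (ev2 \<kappa> X Y (snd g)) P"
  by (induction P rule: poly2_induct) (simp_all add: subst2_add subst2_mult ev2_add ev2_mult)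

text \<open>Naturality of evaluation; it serves to specialise the flow at time 0 and at \<tau> =
  1.\<close>

lemma hom_ev2:
  fixes \<psi> :: "'b \<Rightarrow> 'c::comm_ring_1"
  assumes \<psi>: "\<And>x y. \<psi> (x + y) = \<psi> x + \<psi> y" "\<And>x y. \<psi> (x * y) = \<psi> x * \<psi> y"
    and \<psi>\<kappa>: "\<And>c. \<psi> (\<kappa> c) = \<kappa>' c" and "coeff_hom \<kappa>'"
  shows "\<psi> (ev2 \<kappa> X Y P) = ev2 \<kappa>' (\<psi> X) (\<psi> Y) P"
proof -
  interpret c: coeff_hom \<kappa>' by fact
  show ?thesis
    by (induction P rule: poly2_induct)
       (simp_all add: ev2_add ev2_mult c.ev2_add c.ev2_mult \<psi> \<psi>\<kappa>)
qed

end

interpretation const2: coeff_hom "const2 :: 'a::field \<Rightarrow> 'a poly poly"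
  by unfold_locales (simp_all add: const2_hom)

lemma subst2_power: "subst2 g (P ^ n) = subst2 g P ^ n"
  by (cases g) (simp add: subst2_eq_ev2 const2.ev2_power)

lemma subst2_diff: "subst2 g (P - Q) = subst2 g P - subst2 g Q"
  by (cases g) (simp add: subst2_eq_ev2 const2.ev2_diff)

lemma subst2_sum: "subst2 g (sum f I) = (\<Sum>i\<in>I. subst2 g (f i))"
  by (cases g) (simp add: subst2_eq_ev2 const2.ev2_sum)

lemma X2_power: "X2 ^ n = [:monom 1 n:]"
  by (induction n) (simp_all add: X2_def monom_Suc one_pCons)

lemma Y2_power: "Y2 ^ n = monom 1 n"
  by (induction n) (simp_all add: Y2_def monom_Suc)

lemma monomial2: "const2 c * X2 ^ i * Y2 ^ j = monom (monom c i) j"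
  by (simp add: const2_def X2_power Y2_power smult_monom flip: mult.assoc)

lemma poly2_as_sum:
  "P = (\<Sum>j\<le>degree P. \<Sum>i\<le>degree (coeff P j). const2 (coeff (coeff P j) i) * X2 ^ i * Y2 ^ j)"
proof -
  have "(\<Sum>i\<le>degree (coeff P j). const2 (coeff (coeff P j) i) * X2 ^ i * Y2 ^ j) =
      monom (coeff P j) j" for j
    by (simp add: monomial2 monom_sum[symmetric] poly_as_sum_of_monoms)
  then show ?thesis by (simp add: poly_as_sum_of_monoms)
qed

lemma (in coeff_hom) ev2_as_sum:
  "ev2 \<kappa> X Y P =
     (\<Sum>j\<le>degree P. \<Sum>i\<le>degree (coeff P j). \<kappa> (coeff (coeff P j) i) * X ^ i * Y ^ j)"
  by (subst (1) poly2_as_sum) (simp add: ev2_sum ev2_mult ev2_power)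

section \<open>Weights\<close>

text \<open>A set of admissible weights covers upper bounds (\<open>wle\<close>) and homogeneity
  (\<open>whom\<close>) by the same closure lemmas. Weights are integers since the weight of the
  time of the flow can be negative. The zero polynomial satisfies every such condition, so its
  weight counts as minus infinity.\<close>

definition supp_wt :: "int \<Rightarrow> int \<Rightarrow> int set \<Rightarrow> 'b::zero poly poly \<Rightarrow> bool" where
  "supp_wt \<alpha> \<beta> S P \<longleftrightarrow> (\<forall>i j. coeff (coeff P j) i \<noteq> 0 \<longrightarrow> \<alpha> * int i + \<beta> * int j \<in> S)"

lemma supp_wtD: "supp_wt \<alpha> \<beta> S P \<Longrightarrow> coeff (coeff P j) i \<noteq> 0 \<Longrightarrow> \<alpha> * int i + \<beta> * int j \<in> S"
  by (simp add: supp_wt_def)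

lemma supp_wt_mono: "supp_wt \<alpha> \<beta> S P \<Longrightarrow> S \<subseteq> T \<Longrightarrow> supp_wt \<alpha> \<beta> T P"
  by (auto simp: supp_wt_def)

lemma supp_wt_0 [simp]: "supp_wt \<alpha> \<beta> S 0"
  by (simp add: supp_wt_def)

lemma supp_wt_add:
  fixes P :: "'b::ab_group_add poly poly"
  shows "supp_wt \<alpha> \<beta> S P \<Longrightarrow> supp_wt \<alpha> \<beta> S Q \<Longrightarrow> supp_wt \<alpha> \<beta> S (P + Q)"
  unfolding supp_wt_def coeff_add by (metis add_0)

lemma supp_wt_diff:
  fixes P :: "'b::ab_group_add poly poly"
  shows "supp_wt \<alpha> \<beta> S P \<Longrightarrow> supp_wt \<alpha> \<beta> S Q \<Longrightarrow> supp_wt \<alpha> \<beta> S (P - Q)"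
  unfolding supp_wt_def coeff_diff by (metis diff_0_right)

lemma supp_wt_sum:
  fixes f :: "'i \<Rightarrow> 'b::ab_group_add poly poly"
  shows "(\<And>i. i \<in> I \<Longrightarrow> supp_wt \<alpha> \<beta> S (f i)) \<Longrightarrow> supp_wt \<alpha> \<beta> S (sum f I)"
  by (induction I rule: infinite_finite_induct) (simp_all add: supp_wt_add)

lemma supp_wt_mult:
  fixes P Q :: "'b::comm_ring_1 poly poly"
  assumes P: "supp_wt \<alpha> \<beta> S P" and Q: "supp_wt \<alpha> \<beta> T Q" and U: "\<And>a b. a \<in> S \<Longrightarrow> b \<in> T \<Longrightarrow> a + b \<in> U"
  shows "supp_wt \<alpha> \<beta> U (P * Q)"
  unfolding supp_wt_def
proof (intro allI impI)
  fix i j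
  assume "coeff (coeff (P * Q) j) i \<noteq> 0"
  then have "(\<Sum>j'\<le>j. \<Sum>i'\<le>i. coeff (coeff P j') i' * coeff (coeff Q (j - j')) (i - i')) \<noteq> 0"
    by (simp add: coeff_mult coeff_sum)
  then obtain j' i' where le: "j' \<le> j" "i' \<le> i"
    and nz: "coeff (coeff P j') i' * coeff (coeff Q (j - j')) (i - i') \<noteq> 0"
    by (metis (no_types, lifting) atMost_iff sum.not_neutral_contains_not_neutral)
  from nz have "\<alpha> * int i' + \<beta> * int j' \<in> S" "\<alpha> * int (i - i') + \<beta> * int (j - j') \<in> T"
    using P Q by (auto intro: supp_wtD)
  from U[OF this] show "\<alpha> * int i + \<beta> * int j \<in> U"
    using le by (simp add: of_nat_diff algebra_simps)
qed

abbreviation wle :: "int \<Rightarrow> int \<Rightarrow> int \<Rightarrow> 'b::zero poly poly \<Rightarrow> bool" where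
  "wle \<alpha> \<beta> e \<equiv> supp_wt \<alpha> \<beta> {..e}"

abbreviation whom :: "int \<Rightarrow> int \<Rightarrow> int \<Rightarrow> 'b::zero poly poly \<Rightarrow> bool" where
  "whom \<alpha> \<beta> e \<equiv> supp_wt \<alpha> \<beta> {e}"

lemma supp_wt_const: "0 \<in> S \<Longrightarrow> supp_wt \<alpha> \<beta> S [:[:c:]:]"
  by (auto simp: supp_wt_def coeff_pCons split: nat.splits)

lemma supp_wt_1: "0 \<in> S \<Longrightarrow> supp_wt \<alpha> \<beta> S (1 :: 'b::comm_ring_1 poly poly)"
  using supp_wt_const[of S \<alpha> \<beta> "1::'b"] by (simp add: one_pCons)

lemma wle_mult:
  fixes P Q :: "'b::comm_ring_1 poly poly"
  shows "wle \<alpha> \<beta> d P \<Longrightarrow> wle \<alpha> \<beta> e Q \<Longrightarrow> wle \<alpha> \<beta> (d + e) (P * Q)"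
  by (erule supp_wt_mult) auto

lemma whom_mult:
  fixes P Q :: "'b::comm_ring_1 poly poly"
  shows "whom \<alpha> \<beta> d P \<Longrightarrow> whom \<alpha> \<beta> e Q \<Longrightarrow> whom \<alpha> \<beta> (d + e) (P * Q)"
  by (erule supp_wt_mult) auto

lemma wle_power:
  fixes P :: "'b::comm_ring_1 poly poly"
  assumes "wle \<alpha> \<beta> d P"
  shows "wle \<alpha> \<beta> (int n * d) (P ^ n)"
proof (induction n)
  case (Suc n)
  show ?case using wle_mult[OF assms Suc] by (simp add: algebra_simps)
qed (simp add: supp_wt_1)

lemma whom_power:
  fixes P :: "'b::comm_ring_1 poly poly"
  assumes "whom \<alpha> \<beta> d P"
  shows "whom \<alpha> \<beta> (int n * d) (P ^ n)"
proof (induction n)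
  case (Suc n)
  show ?case using whom_mult[OF assms Suc] by (simp add: algebra_simps)
qed (simp add: supp_wt_1)

lemma whom_imp_wle: "whom \<alpha> \<beta> e P \<Longrightarrow> wle \<alpha> \<beta> e P"
  by (erule supp_wt_mono) auto

lemma whom_wle_less:
  assumes "whom \<alpha> \<beta> e P" "wle \<alpha> \<beta> (e - 1) P"
  shows "P = 0"
proof (intro poly_eqI)
  fix j i
  show "coeff (coeff P j) i = coeff (coeff 0 j) i"
    using supp_wtD[OF assms(1), of j i] supp_wtD[OF assms(2), of j i] by auto
qed

definition wcomp :: "int \<Rightarrow> int \<Rightarrow> int \<Rightarrow> 'b::zero poly poly \<Rightarrow> 'b poly poly" where
  "wcomp \<alpha> \<beta> e P = Abs_poly (\<lambda>j. if j \<le> degree P then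
     Abs_poly (\<lambda>i. if i \<le> degree (coeff P j) then
       (if \<alpha> * int i + \<beta> * int j = e then coeff (coeff P j) i else 0) else 0) else 0)"

lemma coeff_wcomp:
  "coeff (coeff (wcomp \<alpha> \<beta> e P) j) i = (if \<alpha> * int i + \<beta> * int j = e then coeff (coeff P j) i else 0)"
  by (simp add: wcomp_def coeff_Abs_poly_If_le coeff_eq_0)

lemma whom_wcomp: "whom \<alpha> \<beta> e (wcomp \<alpha> \<beta> e P)"
  by (auto simp: supp_wt_def coeff_wcomp)

lemma wle_diff_wcomp:
  fixes P :: "'b::ab_group_add poly poly"
  assumes "wle \<alpha> \<beta> e P"
  shows "wle \<alpha> \<beta> (e - 1) (P - wcomp \<alpha> \<beta> e P)"
  unfolding supp_wt_def
proof (intro allI impI)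
  fix i j
  assume "coeff (coeff (P - wcomp \<alpha> \<beta> e P) j) i \<noteq> 0"
  then have "\<alpha> * int i + \<beta> * int j \<noteq> e" "coeff (coeff P j) i \<noteq> 0"
    by (auto simp: coeff_wcomp split: if_splits)
  with supp_wtD[OF assms, of j i] show "\<alpha> * int i + \<beta> * int j \<in> {..e - 1}" by auto
qed

locale weighted_coeff_hom = coeff_hom \<kappa>
  for \<kappa> :: "'a::field \<Rightarrow> 'b::comm_ring_1 poly poly" +
  assumes \<kappa>_const: "\<exists>c'. \<kappa> c = [:[:c':]:]"
begin

lemma supp_wt_\<kappa>: "0 \<in> S \<Longrightarrow> supp_wt \<alpha> \<beta> S (\<kappa> c)"
  using \<kappa>_const[of c] by (auto intro: supp_wt_const)

lemma wle_ev2: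
  assumes P: "wle w1 w2 d P" and "N \<ge> 0"
    and XY: "wle \<alpha> \<beta> (N * w1) X" "wle \<alpha> \<beta> (N * w2) Y"
  shows "wle \<alpha> \<beta> (N * d) (ev2 \<kappa> X Y P)"
  unfolding ev2_as_sum
proof (intro supp_wt_sum)
  fix i j
  show "wle \<alpha> \<beta> (N * d) (\<kappa> (coeff (coeff P j) i) * X ^ i * Y ^ j)"
  proof (cases "coeff (coeff P j) i = 0")
    case False
    have *: "wle \<alpha> \<beta> (0 + int i * (N * w1) + int j * (N * w2)) (\<kappa> (coeff (coeff P j) i) * X ^ i * Y ^ j)"
      by (intro wle_mult wle_power XY supp_wt_\<kappa>) auto
    have "w1 * int i + w2 * int j \<le> d" using supp_wtD[OF P False] by simp
    then have "N * (w1 * int i + w2 * int j) \<le> N * d" using \<open>N \<ge> 0\<close> by (rule mult_left_mono)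
    then show ?thesis by (intro supp_wt_mono[OF *]) (auto simp: algebra_simps)
  qed simp
qed

lemma whom_ev2:
  assumes P: "whom w1 w2 d P"
    and XY: "whom \<alpha> \<beta> (N * w1) X" "whom \<alpha> \<beta> (N * w2) Y"
  shows "whom \<alpha> \<beta> (N * d) (ev2 \<kappa> X Y P)"
  unfolding ev2_as_sum
proof (intro supp_wt_sum)
  fix i j
  show "whom \<alpha> \<beta> (N * d) (\<kappa> (coeff (coeff P j) i) * X ^ i * Y ^ j)"
  proof (cases "coeff (coeff P j) i = 0")
    case False
    have *: "whom \<alpha> \<beta> (0 + int i * (N * w1) + int j * (N * w2)) (\<kappa> (coeff (coeff P j) i) * X ^ i * Y ^ j)"
      by (intro whom_mult whom_power XY supp_wt_\<kappa>) auto
    have "w1 * int i + w2 * int j = d" using supp_wtD[OF P False] by simp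
    then have "N * (w1 * int i + w2 * int j) = N * d" by simp
    then show ?thesis by (intro supp_wt_mono[OF *]) (auto simp: algebra_simps)
  qed simp
qed

lemma wle_mult_diff:
  fixes P Q :: "'b poly poly"
  assumes "wle \<alpha> \<beta> d P" "wle \<alpha> \<beta> e Q'" "wle \<alpha> \<beta> d P'" "wle \<alpha> \<beta> e Q"
    "wle \<alpha> \<beta> (d - 1) (P - P')" "wle \<alpha> \<beta> (e - 1) (Q - Q')"
  shows "wle \<alpha> \<beta> (d + e - 1) (P * Q - P' * Q')"
proof -
  have "wle \<alpha> \<beta> (d + e - 1) ((P - P') * Q)" using wle_mult[OF assms(5,4)] by (simp add: algebra_simps)
  moreover have "wle \<alpha> \<beta> (d + e - 1) (P' * (Q - Q'))" using wle_mult[OF assms(3,6)] by (simp add: algebra_simps)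
  ultimately have "wle \<alpha> \<beta> (d + e - 1) ((P - P') * Q + P' * (Q - Q'))" by (rule supp_wt_add)
  then show ?thesis by (simp add: algebra_simps)
qed

lemma wle_power_diff:
  fixes P :: "'b poly poly"
  assumes P: "wle \<alpha> \<beta> d P" "wle \<alpha> \<beta> d P'" "wle \<alpha> \<beta> (d - 1) (P - P')"
  shows "wle \<alpha> \<beta> (int n * d - 1) (P ^ n - P' ^ n)"
proof (induction n)
  case (Suc n)
  show ?case using wle_mult_diff[OF P(1) wle_power[OF P(2)] P(2) wle_power[OF P(1)] P(3) Suc]
    by (simp add: algebra_simps)
qed simp

lemma wle_ev2_diff:
  assumes P: "whom w1 w2 d P"
    and X: "wle \<alpha> \<beta> (N * w1) X" "wle \<alpha> \<beta> (N * w1) X'" "wle \<alpha> \<beta> (N * w1 - 1) (X - X')"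
    and Y: "wle \<alpha> \<beta> (N * w2) Y" "wle \<alpha> \<beta> (N * w2) Y'" "wle \<alpha> \<beta> (N * w2 - 1) (Y - Y')"
  shows "wle \<alpha> \<beta> (N * d - 1) (ev2 \<kappa> X Y P - ev2 \<kappa> X' Y' P)"
  unfolding ev2_as_sum sum_subtractf[symmetric]
proof (intro supp_wt_sum)
  fix i j
  let ?c = "\<kappa> (coeff (coeff P j) i)"
  show "wle \<alpha> \<beta> (N * d - 1) (?c * X ^ i * Y ^ j - ?c * X' ^ i * Y' ^ j)"
  proof (cases "coeff (coeff P j) i = 0")
    case False
    have "wle \<alpha> \<beta> (int i * (N * w1) + int j * (N * w2) - 1) (X ^ i * Y ^ j - X' ^ i * Y' ^ j)"
      by (intro wle_mult_diff wle_power wle_power_diff X Y)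
    from wle_mult[OF supp_wt_\<kappa>[of "{..0}" \<alpha> \<beta> "coeff (coeff P j) i"] this]
    have *: "wle \<alpha> \<beta> (int i * (N * w1) + int j * (N * w2) - 1) (?c * X ^ i * Y ^ j - ?c * X' ^ i * Y' ^ j)"
      by (simp add: algebra_simps)
    have "w1 * int i + w2 * int j = d" using supp_wtD[OF P False] by simp
    then have "N * (w1 * int i + w2 * int j) = N * d" by simp
    then show ?thesis by (intro supp_wt_mono[OF *]) (auto simp: algebra_simps)
  qed simp
qed

text \<open>The leading parts alone determine the part of weight \<open>N * d\<close> of the value.
  That part may vanish by cancellation, so a difference is bounded instead of a leading form being
  named.\<close>

lemma wle_ev2_wcomp:
  assumes P: "wle w1 w2 d P" and "N > 0"
    and XY: "wle \<alpha> \<beta> (N * w1) X" "wle \<alpha> \<beta> (N * w2) Y"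
  shows "wle \<alpha> \<beta> (N * d - 1) (ev2 \<kappa> X Y P -
    ev2 \<kappa> (wcomp \<alpha> \<beta> (N * w1) X) (wcomp \<alpha> \<beta> (N * w2) Y) (wcomp w1 w2 d P))"
proof -
  have "wle \<alpha> \<beta> (N * (d - 1)) (ev2 \<kappa> X Y (P - wcomp w1 w2 d P))"
    using \<open>N > 0\<close> by (intro wle_ev2[OF wle_diff_wcomp[OF P]] XY) auto
  then have 1: "wle \<alpha> \<beta> (N * d - 1) (ev2 \<kappa> X Y (P - wcomp w1 w2 d P))"
    by (rule supp_wt_mono) (use \<open>N > 0\<close> in \<open>auto simp: algebra_simps\<close>)
  have 2: "wle \<alpha> \<beta> (N * d - 1) (ev2 \<kappa> X Y (wcomp w1 w2 d P) -
    ev2 \<kappa> (wcomp \<alpha> \<beta> (N * w1) X) (wcomp \<alpha> \<beta> (N * w2) Y) (wcomp w1 w2 d P))"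
    by (intro wle_ev2_diff[OF whom_wcomp] XY wle_diff_wcomp whom_imp_wle[OF whom_wcomp])
  from supp_wt_add[OF 1 2] show ?thesis by (simp add: ev2_diff)
qed

end

section \<open>The graded flow\<close>

text \<open>In \<open>K[t][\<tau>][s]\<close>, the type \<open>'a poly poly poly\<close>, the variable \<open>\<tau>\<close> records the weight in
  \<open>x\<close> and \<open>y\<close> and \<open>s\<close> is the time of the flow.\<close>

definition const3 :: "'a::field \<Rightarrow> 'a poly poly poly" where
  "const3 c = [:[:[:c:]:]:]"

interpretation const3: weighted_coeff_hom "const3 :: 'a::field \<Rightarrow> 'a poly poly poly"
  by unfold_locales (auto simp: const3_def one_pCons)

text \<open>As an evaluation at the variable, \<open>map_poly\<close> inherits the homomorphism
  property of evaluations.\<close>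

lemma map_poly_eq_poly_pCons:
  assumes "\<phi> 0 = (0::'b::comm_ring_1)"
  shows "map_poly \<phi> P = poly (map_poly (\<lambda>c. [:\<phi> c:]) P) [:0, 1:]"
  by (induction P) (simp_all add: map_poly_pCons assms)

lemma map_poly_hom:
  fixes \<phi> :: "'b::comm_ring_1 \<Rightarrow> 'c::comm_ring_1"
  assumes "\<phi> 0 = 0" "\<And>a b. \<phi> (a + b) = \<phi> a + \<phi> b" "\<And>a b. \<phi> (a * b) = \<phi> a * \<phi> b"
  shows "map_poly \<phi> (P + Q) = map_poly \<phi> P + map_poly \<phi> Q"
    and "map_poly \<phi> (P * Q) = map_poly \<phi> P * map_poly \<phi> Q"
  unfolding map_poly_eq_poly_pCons[of \<phi>, OF assms(1)]
  by (rule poly_map_poly_hom; simp add: assms)+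

lemma GA2_inverse_maps:
  assumes "g \<in> carrier GA2"
  obtains h where "h \<in> carrier GA2"
    "subst2 g (fst h) = X2" "subst2 g (snd h) = Y2" "subst2 h (fst g) = X2" "subst2 h (snd g) = Y2"
proof -
  interpret group "GA2 :: 'a plane_map monoid" by (rule group_GA2)
  have "inv\<^bsub>GA2\<^esub> g \<otimes>\<^bsub>GA2\<^esub> g = \<one>\<^bsub>GA2\<^esub>" "g \<otimes>\<^bsub>GA2\<^esub> inv\<^bsub>GA2\<^esub> g = \<one>\<^bsub>GA2\<^esub>"
    using assms by auto
  then show ?thesis
    by (intro that[of "inv\<^bsub>GA2\<^esub> g"] inv_closed assms)
       (simp_all add: GA2_def units_of_def poly_endo_def)
qed

lemma wcomp_whom:
  assumes "whom \<alpha> \<beta> e P"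
  shows "wcomp \<alpha> \<beta> e P = P"
proof (intro poly_eqI)
  fix j i
  show "coeff (coeff (wcomp \<alpha> \<beta> e P) j) i = coeff (coeff P j) i"
    using supp_wtD[OF assms, of j i] by (auto simp: coeff_wcomp)
qed

text \<open>The minimum of the ratios z / k as a reduced fraction \<open>\<sigma> / N\<close>. It is
  the slope of an edge of a Newton polygon and is taken twice: for the weight of the time of the
  flow, and for the edge of the polygon of F that starts at a power of y.\<close>

lemma min_slope:
  fixes S :: "(int \<times> nat) set"
  assumes "finite S" "S \<noteq> {}" and pos: "\<And>z k. (z, k) \<in> S \<Longrightarrow> k > 0"
  obtains N \<sigma> :: int where "N > 0" "coprime \<sigma> N" "\<And>z k. (z, k) \<in> S \<Longrightarrow> \<sigma> * int k \<le> N * z"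
    "\<exists>z k. (z, k) \<in> S \<and> \<sigma> * int k = N * z"
proof -
  define s where "s = (\<lambda>(z, k). of_int z / of_nat k :: rat)"
  define \<rho> where "\<rho> = Min (s ` S)"
  have \<rho>: "\<rho> \<in> s ` S" "\<And>x. x \<in> S \<Longrightarrow> \<rho> \<le> s x"
    unfolding \<rho>_def using assms by (auto intro: Min_in)
  obtain \<sigma> N where q: "quotient_of \<rho> = (\<sigma>, N)" by (cases "quotient_of \<rho>")
  have \<rho>_eq: "\<rho> = of_int \<sigma> / of_int N" and N: "N > 0"
    using quotient_of_div[OF q] quotient_of_denom_pos[OF q] by auto
  show ?thesis
  proof
    show "coprime \<sigma> N" by (rule quotient_of_coprime[OF q])
    show "\<sigma> * int k \<le> N * z" if "(z, k) \<in> S" for z k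
    proof -
      have "(of_int (\<sigma> * int k) :: rat) \<le> of_int (N * z)"
        using \<rho>(2)[OF that] pos[OF that] N by (simp add: \<rho>_eq s_def field_simps)
      then show ?thesis by (simp only: of_int_le_iff)
    qed
    obtain z k where zk: "(z, k) \<in> S" "\<rho> = of_int z / of_nat k" using \<rho>(1) by (auto simp: s_def)
    have "(of_int (\<sigma> * int k) :: rat) = of_int (N * z)"
      using zk(2) pos[OF zk(1)] N by (simp add: \<rho>_eq field_simps)
    then show "\<exists>z k. (z, k) \<in> S \<and> \<sigma> * int k = N * z" using zk(1) by (metis of_int_eq_iff)
  qed fact
qed

text \<open>By homogeneity each coefficient in the outer variable is a single monomial in the inner
  one, so setting the inner variable to 1 cannot make it vanish.\<close>

lemma poly_1_whom_coeff_eq_0_iff: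
  fixes P :: "'b::comm_ring_1 poly poly"
  assumes P: "whom N \<sigma> e P" and "N > 0"
  shows "poly (coeff P k) 1 = 0 \<longleftrightarrow> coeff P k = 0"
proof (cases "\<exists>m. coeff (coeff P k) m \<noteq> 0")
  case True
  then obtain m where m: "coeff (coeff P k) m \<noteq> 0" by blast
  have "coeff P k = monom (coeff (coeff P k) m) m"
  proof (rule poly_eqI)
    fix m'
    have "m = m'" if "coeff (coeff P k) m' \<noteq> 0"
    proof -
      have "N * int m = N * int m'" using supp_wtD[OF P m] supp_wtD[OF P that] unfolding singleton_iff by linarith
      then show ?thesis using \<open>N > 0\<close> by simp
    qed
    then show "coeff (coeff P k) m' = coeff (monom (coeff (coeff P k) m) m) m'" by auto
  qed
  then show ?thesis by (metis mult.right_neutral poly_monom power_one monom_eq_0)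
next
  case False
  then have "coeff P k = 0" by (auto intro: poly_eqI)
  then show ?thesis by simp
qed

lemma finite_supp2: "finite {(i, j). coeff (coeff P j) i \<noteq> 0}"
proof -
  have "{(i, j). coeff (coeff P j) i \<noteq> 0} \<subseteq> (\<Union>j\<le>degree P. {..degree (coeff P j)} \<times> {j})"
    by (auto intro: le_degree simp: le_degree) (metis coeff_0 le_degree)
  then show ?thesis by (rule finite_subset) auto
qed

text \<open>A monomial \<tau>^m s^k of \<open>U\<close> with k > 0 has weight at most
  \<open>N * w1\<close> exactly if \<sigma> / N \<le> (w1 - m) / k, and likewise for
  \<open>V\<close>. The least of these ratios is thus the largest admissible weight of s; as it is
  attained, one of the leading parts depends on s.\<close>

lemma balancing_slope:
  fixes U V :: "'b::comm_ring_1 poly poly"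
  assumes nonconst: "degree U > 0 \<or> degree V > 0"
  obtains N \<sigma> :: int where "N > 0"
    "\<And>m k. k > 0 \<Longrightarrow> coeff (coeff U k) m \<noteq> 0 \<Longrightarrow> N * int m + \<sigma> * int k \<le> N * w1"
    "\<And>m k. k > 0 \<Longrightarrow> coeff (coeff V k) m \<noteq> 0 \<Longrightarrow> N * int m + \<sigma> * int k \<le> N * w2"
    "\<exists>m k. k > 0 \<and> (coeff (coeff U k) m \<noteq> 0 \<and> N * int m + \<sigma> * int k = N * w1 \<or>
                    coeff (coeff V k) m \<noteq> 0 \<and> N * int m + \<sigma> * int k = N * w2)"
proof -
  define S where "S w P = (\<lambda>(m, k). (w - int m, k)) ` {(m, k). coeff (coeff P k) m \<noteq> 0 \<and> k > 0}"
    for w and P :: "'b poly poly"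
  have S_iff: "(z, k) \<in> S w P \<longleftrightarrow> (\<exists>m. z = w - int m \<and> coeff (coeff P k) m \<noteq> 0 \<and> k > 0)" for z k w P
    by (auto simp: S_def)
  have fin: "finite (S w P)" for w P
    unfolding S_def by (intro finite_imageI finite_subset[OF _ finite_supp2[of P]]) auto
  have "S w P \<noteq> {}" if "degree P > 0" for w P
  proof -
    have "coeff P (degree P) \<noteq> 0" using that by auto
    then obtain m where "coeff (coeff P (degree P)) m \<noteq> 0" by (metis leading_coeff_0_iff)
    then show ?thesis using that by (auto simp: S_def)
  qed
  then have ne: "S w1 U \<union> S w2 V \<noteq> {}" using nonconst by auto
  obtain N \<sigma> :: int where N: "N > 0"
    and le: "\<And>z k. (z, k) \<in> S w1 U \<union> S w2 V \<Longrightarrow> \<sigma> * int k \<le> N * z"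
    and eq: "\<exists>z k. (z, k) \<in> S w1 U \<union> S w2 V \<and> \<sigma> * int k = N * z"
  proof (rule min_slope)
    show "finite (S w1 U \<union> S w2 V)" using fin by simp
    show "k > 0" if "(z, k) \<in> S w1 U \<union> S w2 V" for z k using that by (auto simp: S_iff)
  qed (use ne in auto)
  show ?thesis
  proof
    show "N * int m + \<sigma> * int k \<le> N * w1" if "k > 0" "coeff (coeff U k) m \<noteq> 0" for m k
      using le[of "w1 - int m" k] that by (auto simp: S_iff algebra_simps)
    show "N * int m + \<sigma> * int k \<le> N * w2" if "k > 0" "coeff (coeff V k) m \<noteq> 0" for m k
      using le[of "w2 - int m" k] that by (auto simp: S_iff algebra_simps)
    obtain z k where zk: "(z, k) \<in> S w1 U \<union> S w2 V" "\<sigma> * int k = N * z" using eq by blast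
    then show "\<exists>m k. k > 0 \<and> (coeff (coeff U k) m \<noteq> 0 \<and> N * int m + \<sigma> * int k = N * w1 \<or>
                    coeff (coeff V k) m \<noteq> 0 \<and> N * int m + \<sigma> * int k = N * w2)"
      unfolding Un_iff S_iff by (elim disjE exE) (rule exI, rule exI[of _ k], force simp: algebra_simps)+
  qed fact
qed

lemma whom_monom_const: "whom N \<sigma> (N * int w) [:monom c w:]"
  by (auto simp: supp_wt_def coeff_pCons split: nat.splits if_splits)

text \<open>At the point \<open>(\<xi> \<tau>\<^sup>w\<^sup>1, \<eta> \<tau>\<^sup>w\<^sup>2)\<close> the flow \<open>(U, V)\<close> satisfies \<open>F(U, V) = F\<close>.  The variable
  \<open>s\<close> gets the largest weight for which \<open>U\<close> and \<open>V\<close> still have weights \<open>w1\<close> and \<open>w2\<close>, so that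
  their top parts are not constant in \<open>s\<close>; then the top parts of both sides are compared at
  \<open>\<tau> = 1\<close>.\<close>

theorem graded_flow:
  fixes g :: "'a::field plane_map" and \<xi> \<eta> :: "'a poly" and w1 w2 :: nat
  assumes g: "g \<in> carrier GA2" and d: "wle (int w1) (int w2) d (fst g)"
  defines "Fbar \<equiv> wcomp (int w1) (int w2) d (fst g)"
  obtains u v :: "'a poly poly" where "coeff u 0 = \<xi>" "coeff v 0 = \<eta>" "degree u > 0 \<or> degree v > 0"
    "subst2 (u, v) Fbar = subst2 ([:\<xi>:], [:\<eta>:]) Fbar"
proof -
  obtain h where h: "subst2 g (fst h) = X2" "subst2 g (snd h) = Y2"
      "subst2 h (fst g) = X2" "subst2 h (snd g) = Y2"
    using GA2_inverse_maps[OF g] by metis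
  define x0 y0 :: "'a poly poly poly" where "x0 = [:monom \<xi> w1:]" and "y0 = [:monom \<eta> w2:]"
  define F0 G0 s where "F0 = ev2 const3 x0 y0 (fst g)" and "G0 = ev2 const3 x0 y0 (snd g)"
    and "s = [:0, 1 :: 'a poly poly:]"
  define U V where "U = ev2 const3 F0 (G0 + s) (fst h)" and "V = ev2 const3 F0 (G0 + s) (snd h)"
  have "ev2 const3 U V P = ev2 const3 F0 (G0 + s) (subst2 h P)" for P
    unfolding U_def V_def by (rule const3.ev2_subst2[symmetric])
  then have FUV: "ev2 const3 U V (fst g) = F0" and GUV: "ev2 const3 U V (snd g) = G0 + s"
    by (simp_all add: h)
  have F0G0: "ev2 const3 F0 G0 P = ev2 const3 x0 y0 (subst2 g P)" for P
    unfolding F0_def G0_def by (rule const3.ev2_subst2[symmetric])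
  define \<psi>0 :: "'a poly poly poly \<Rightarrow> 'a poly poly poly" where "\<psi>0 P = [:poly P 0:]" for P
  have \<psi>0: "\<psi>0 (ev2 const3 X Y P) = ev2 const3 (\<psi>0 X) (\<psi>0 Y) P" for X Y P
    by (rule const3.hom_ev2[OF _ _ _ const3.coeff_hom_axioms]) (auto simp: \<psi>0_def const3_def)
  have "\<psi>0 F0 = F0" "\<psi>0 (G0 + s) = G0"
  proof -
    have *: "\<psi>0 x0 = x0" "\<psi>0 y0 = y0" by (simp_all add: \<psi>0_def x0_def y0_def)
    show "\<psi>0 F0 = F0" unfolding F0_def \<psi>0 * ..
    have "\<psi>0 G0 = G0" unfolding G0_def \<psi>0 * ..
    then show "\<psi>0 (G0 + s) = G0" by (simp add: \<psi>0_def s_def)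
  qed
  then have UV0: "\<psi>0 U = x0" "\<psi>0 V = y0"
    unfolding U_def V_def \<psi>0 by (simp_all add: F0G0 h)
  then have coeff0: "coeff U 0 = monom \<xi> w1" "coeff V 0 = monom \<eta> w2"
    by (simp_all add: \<psi>0_def x0_def y0_def poly_0_coeff_0)
  \<comment> \<open>If \<open>U\<close> and \<open>V\<close> were free of s, so would be the value
    \<open>G0 + s\<close> of the second component at them.\<close>
  have nonconst: "degree U > 0 \<or> degree V > 0"
  proof (rule ccontr)
    assume "\<not> ?thesis"
    then have "U = [:coeff U 0:]" "V = [:coeff V 0:]"
      by (metis degree_0_id gr0I)+
    then have "U = x0" "V = y0" unfolding coeff0 x0_def y0_def .
    with GUV have "s = 0" by (simp add: G0_def)
    then show False by (simp add: s_def)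
  qed
  obtain N \<sigma> :: int where N: "N > 0" and
    leU: "\<And>m k. k > 0 \<Longrightarrow> coeff (coeff U k) m \<noteq> 0 \<Longrightarrow> N * int m + \<sigma> * int k \<le> N * int w1" and
    leV: "\<And>m k. k > 0 \<Longrightarrow> coeff (coeff V k) m \<noteq> 0 \<Longrightarrow> N * int m + \<sigma> * int k \<le> N * int w2" and
    eq: "\<exists>m k. k > 0 \<and> (coeff (coeff U k) m \<noteq> 0 \<and> N * int m + \<sigma> * int k = N * int w1 \<or>
                    coeff (coeff V k) m \<noteq> 0 \<and> N * int m + \<sigma> * int k = N * int w2)"
    using balancing_slope[OF nonconst] by metis
  have wleU: "wle N \<sigma> (N * int w1) U" and wleV: "wle N \<sigma> (N * int w2) V"
    unfolding supp_wt_def using leU leV coeff0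
    by (metis atMost_iff coeff_monom gr0I mult_zero_right add_0_right of_nat_0 order_refl)+
  define Ub Vb where "Ub = wcomp N \<sigma> (N * int w1) U" and "Vb = wcomp N \<sigma> (N * int w2) V"
  have hom0: "whom N \<sigma> (N * int w1) x0" "whom N \<sigma> (N * int w2) y0"
    unfolding x0_def y0_def by (rule whom_monom_const)+
  have wcomp0: "wcomp N \<sigma> (N * int w1) x0 = x0" "wcomp N \<sigma> (N * int w2) y0 = y0"
    using hom0 by (simp_all add: wcomp_whom)
  \<comment> \<open>Both sides agree with \<open>F0\<close> up to lower weight, and their difference
    is homogeneous of weight \<open>N * d\<close>; hence it is zero.\<close>
  have graded_eq: "ev2 const3 Ub Vb Fbar = ev2 const3 x0 y0 Fbar"
  proof -
    have "wle N \<sigma> (N * d - 1) (F0 - ev2 const3 Ub Vb Fbar)"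
      using const3.wle_ev2_wcomp[OF d N wleU wleV] by (simp add: Ub_def Vb_def Fbar_def FUV)
    moreover have "wle N \<sigma> (N * d - 1) (F0 - ev2 const3 x0 y0 Fbar)"
      using const3.wle_ev2_wcomp[OF d N whom_imp_wle[OF hom0(1)] whom_imp_wle[OF hom0(2)]]
      by (simp add: wcomp0 Fbar_def F0_def)
    ultimately have "wle N \<sigma> (N * d - 1) (ev2 const3 Ub Vb Fbar - ev2 const3 x0 y0 Fbar)"
      using supp_wt_diff by fastforce
    moreover have "whom N \<sigma> (N * d) (ev2 const3 Ub Vb Fbar - ev2 const3 x0 y0 Fbar)"
      unfolding Fbar_def Ub_def Vb_def
      by (intro supp_wt_diff const3.whom_ev2[OF whom_wcomp] whom_wcomp hom0)
    ultimately have "ev2 const3 Ub Vb Fbar - ev2 const3 x0 y0 Fbar = 0"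
      by (metis whom_wle_less)
    then show ?thesis by simp
  qed
  define \<psi> :: "'a poly poly poly \<Rightarrow> 'a poly poly" where "\<psi> = map_poly (\<lambda>c. poly c 1)"
  have \<psi>: "\<psi> (ev2 const3 X Y P) = ev2 const2 (\<psi> X) (\<psi> Y) P" for X Y P
    by (rule const3.hom_ev2[OF _ _ _ const2.coeff_hom_axioms])
       (simp_all add: \<psi>_def map_poly_hom map_poly_pCons const3_def const2_def)
  have coeff_\<psi>: "coeff (\<psi> P) k = poly (coeff P k) 1" for P k
    by (simp add: \<psi>_def coeff_map_poly)
  show ?thesis
  proof
    show "coeff (\<psi> Ub) 0 = \<xi>" "coeff (\<psi> Vb) 0 = \<eta>"
    proof -
      have "coeff Ub 0 = monom \<xi> w1" "coeff Vb 0 = monom \<eta> w2"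
        using N by (auto intro!: poly_eqI simp: Ub_def Vb_def coeff_wcomp coeff0)
      then show "coeff (\<psi> Ub) 0 = \<xi>" "coeff (\<psi> Vb) 0 = \<eta>"
        by (simp_all add: coeff_\<psi> poly_monom)
    qed
    show "degree (\<psi> Ub) > 0 \<or> degree (\<psi> Vb) > 0"
    proof -
      obtain m k where "k > 0" and "coeff (coeff Ub k) m \<noteq> 0 \<or> coeff (coeff Vb k) m \<noteq> 0"
        using eq unfolding Ub_def Vb_def coeff_wcomp by metis
      then have "coeff Ub k \<noteq> 0 \<or> coeff Vb k \<noteq> 0" by auto
      then have "coeff (\<psi> Ub) k \<noteq> 0 \<or> coeff (\<psi> Vb) k \<noteq> 0"
        unfolding coeff_\<psi> Ub_def Vb_def
        using poly_1_whom_coeff_eq_0_iff[OF whom_wcomp N] by metis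
      then show ?thesis using \<open>k > 0\<close> by (metis le_degree less_le_trans)
    qed
    have "\<psi> x0 = [:\<xi>:]" "\<psi> y0 = [:\<eta>:]"
      by (simp_all add: \<psi>_def x0_def y0_def map_poly_pCons poly_monom)
    then show "subst2 (\<psi> Ub, \<psi> Vb) Fbar = subst2 ([:\<xi>:], [:\<eta>:]) Fbar"
      using arg_cong[OF graded_eq, of \<psi>] by (simp add: \<psi> subst2_eq_ev2)
  qed
qed

section \<open>Binary forms with a constant value\<close>

lemma pcompose_power: "pcompose (p ^ n) q = pcompose p q ^ n"
  by (induction n) (simp_all add: pcompose_mult pcompose_1)

text \<open>The homogenisation of \<open>\<phi>\<close> to a binary form of degree \<open>k\<close>.
  Coefficients of \<open>\<phi>\<close> beyond \<open>k\<close> are dropped, which is why degree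
  bounds accompany it.\<close>

definition hform :: "('a::field \<Rightarrow> 'b::comm_ring_1) \<Rightarrow> nat \<Rightarrow> 'a poly \<Rightarrow> 'b \<Rightarrow> 'b \<Rightarrow> 'b" where
  "hform \<kappa> k \<phi> X Y = (\<Sum>l\<le>k. \<kappa> (coeff \<phi> l) * X ^ l * Y ^ (k - l))"

context coeff_hom
begin

lemma hform_0 [simp]: "hform \<kappa> k 0 X Y = 0"
  by (simp add: hform_def)

lemma hform_add: "hform \<kappa> k (\<phi> + \<psi>) X Y = hform \<kappa> k \<phi> X Y + hform \<kappa> k \<psi> X Y"
  by (simp add: hform_def hom_add algebra_simps sum.distrib)

lemma hform_smult: "hform \<kappa> k (smult a \<phi>) X Y = \<kappa> a * hform \<kappa> k \<phi> X Y"
  by (simp add: hform_def hom_mult algebra_simps sum_distrib_left)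

lemma hform_pCons: "hform \<kappa> (Suc k) (pCons a \<phi>) X Y = \<kappa> a * Y ^ Suc k + X * hform \<kappa> k \<phi> X Y"
  by (simp add: hform_def sum.atMost_Suc_shift sum_distrib_left algebra_simps del: sum.atMost_Suc)

lemma hform_Suc: "degree \<phi> \<le> k \<Longrightarrow> hform \<kappa> (Suc k) \<phi> X Y = Y * hform \<kappa> k \<phi> X Y"
  by (simp add: hform_def coeff_eq_0 sum_distrib_left algebra_simps Suc_diff_le)

lemma hform_const: "hform \<kappa> k [:c:] X Y = \<kappa> c * Y ^ k"
proof -
  have "hform \<kappa> k [:c:] X Y = (\<Sum>l\<in>{0}. \<kappa> c * X ^ l * Y ^ (k - l))"
    unfolding hform_def
    by (rule sum.mono_neutral_cong_right) (auto simp: coeff_pCons split: nat.splits)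
  then show ?thesis by simp
qed

lemma hform_linear_mult:
  assumes "degree \<psi> \<le> k"
  shows "hform \<kappa> (Suc k) ([:a, 1:] * \<psi>) X Y = (X + \<kappa> a * Y) * hform \<kappa> k \<psi> X Y"
proof -
  have "[:a, 1:] * \<psi> = smult a \<psi> + pCons 0 \<psi>" by simp
  then show ?thesis
    by (simp only: hform_add hform_smult hform_pCons hform_Suc[OF assms]) (simp add: algebra_simps)
qed

text \<open>Translating the dehomogenised variable by \<open>a\<close> is the shear X -> X + a Y of
  the form.\<close>

lemma hform_shift:
  assumes "degree \<phi> \<le> k"
  shows "hform \<kappa> k \<phi> (X + \<kappa> a * Y) Y = hform \<kappa> k (pcompose \<phi> [:a, 1:]) X Y"
  using assms
proof (induction \<phi> arbitrary: k)
  case 0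
  show ?case by (simp add: hform_def)
next
  case (pCons c \<phi>)
  show ?case
  proof (cases "\<phi> = 0")
    case True
    then show ?thesis by (simp add: hform_const)
  next
    case False
    with pCons.prems obtain k' where k: "k = Suc k'" "degree \<phi> \<le> k'"
      by (cases k) auto
    have "degree (pcompose \<phi> [:a, 1:]) \<le> k'"
      using degree_pcompose_le[of \<phi> "[:a, 1:]"] k by simp
    then show ?thesis
      unfolding k(1) hform_pCons pcompose_pCons hform_add pCons.IH[OF k(2)]
      by (subst hform_linear_mult) (simp_all add: hform_const)
  qed
qed

lemma hform_monom: "hform \<kappa> k (monom c k) X Y = \<kappa> c * X ^ k"
proof -
  have "hform \<kappa> k (monom c k) X Y = (\<Sum>l\<in>{k}. \<kappa> c * X ^ l * Y ^ (k - l))"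
    unfolding hform_def by (rule sum.mono_neutral_cong_right) auto
  then show ?thesis by simp
qed

lemma hform_linear_power: "hform \<kappa> k (smult c ([:- a, 1:] ^ k)) X Y = \<kappa> c * (X - \<kappa> a * Y) ^ k"
proof -
  let ?\<phi> = "smult c ([:- a, 1:] ^ k)"
  have deg: "degree ?\<phi> \<le> k" by (simp add: degree_power_eq)
  have "pcompose ?\<phi> [:a, 1:] = monom c k"
    by (simp add: pcompose_smult pcompose_power pcompose_pCons monom_altdef)
  then show ?thesis using hform_shift[OF deg, of "X - \<kappa> a * Y" a Y] by (simp add: hform_monom)
qed

end

text \<open>Only one summand attains the largest degree, so its leading coefficient cannot
  cancel.\<close>

lemma sum_distinct_degrees:
  fixes f :: "'i \<Rightarrow> 'b::comm_ring_1 poly"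
  assumes fin: "finite I" and ne: "\<And>i. i \<in> I \<Longrightarrow> f i \<noteq> 0" and inj: "inj_on (\<lambda>i. degree (f i)) I"
    and i: "i \<in> I"
  shows "sum f I \<noteq> 0" and "degree (f i) \<le> degree (sum f I)"
proof -
  let ?D = "Max ((\<lambda>i. degree (f i)) ` I)"
  have "?D \<in> (\<lambda>i. degree (f i)) ` I" using fin i by (intro Max_in) auto
  then obtain m where m: "m \<in> I" "degree (f m) = ?D" by auto
  have le: "degree (f j) \<le> ?D" if "j \<in> I" for j using that fin by (intro Max_ge) auto
  have "coeff (sum f I) ?D = (\<Sum>j\<in>{m}. coeff (f j) ?D)"
    unfolding coeff_sum
  proof (rule sum.mono_neutral_right)
    show "\<forall>j\<in>I - {m}. coeff (f j) ?D = 0"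
    proof
      fix j assume j: "j \<in> I - {m}"
      then have "degree (f j) \<noteq> ?D" using inj m by (metis DiffE inj_onD singletonI)
      then show "coeff (f j) ?D = 0" using le[of j] j by (intro coeff_eq_0) auto
    qed
  qed (use m fin in auto)
  also have "\<dots> \<noteq> 0" using ne[OF m(1)] by (simp flip: m(2))
  finally have *: "coeff (sum f I) ?D \<noteq> 0" .
  then show "sum f I \<noteq> 0" by auto
  show "degree (f i) \<le> degree (sum f I)" using le[OF i] le_degree[OF *] by simp
qed

text \<open>For different degrees of \<open>X\<close> and \<open>Y\<close> the map l -> l deg X + (k
  - l) deg Y is injective, so the terms of the form have distinct degrees.\<close>

lemma
  fixes X Y :: "'b::idom poly" and \<kappa> :: "'a::field \<Rightarrow> 'b poly"
  assumes \<kappa>: "coeff_hom \<kappa>" "\<And>c. c \<noteq> 0 \<Longrightarrow> \<kappa> c \<noteq> 0 \<and> degree (\<kappa> c) = 0"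
    and XY: "X \<noteq> 0" "Y \<noteq> 0" "degree X \<noteq> degree Y" and l: "l \<le> k" "coeff \<phi> l \<noteq> 0"
  shows hform_nonzero: "hform \<kappa> k \<phi> X Y \<noteq> 0"
    and degree_hform_ge: "l * degree X + (k - l) * degree Y \<le> degree (hform \<kappa> k \<phi> X Y)"
proof -
  interpret coeff_hom \<kappa> by fact
  define I where "I = {l. l \<le> k \<and> coeff \<phi> l \<noteq> 0}"
  define f where "f l = \<kappa> (coeff \<phi> l) * X ^ l * Y ^ (k - l)" for l
  have sum: "hform \<kappa> k \<phi> X Y = sum f I"
    unfolding hform_def f_def I_def by (rule sum.mono_neutral_right) auto
  have ne: "f l \<noteq> 0" if "l \<in> I" for l using that \<kappa>(2) XY by (auto simp: f_def I_def)
  have deg: "degree (f l) = l * degree X + (k - l) * degree Y" if "l \<in> I" for l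
    using that \<kappa>(2) XY by (auto simp: f_def I_def degree_mult_eq degree_power_eq)
  have "inj_on (\<lambda>l. degree (f l)) I"
  proof (rule inj_onI)
    fix l m assume lm: "l \<in> I" "m \<in> I" "degree (f l) = degree (f m)"
    then have "int l * degree X + (int k - int l) * degree Y = int m * degree X + (int k - int m) * degree Y"
      unfolding deg[OF lm(1)] deg[OF lm(2)]
      by (simp add: I_def flip: of_nat_diff of_nat_mult of_nat_add)
    then have "(int l - int m) * (int (degree X) - int (degree Y)) = 0" by (simp add: algebra_simps)
    with XY show "l = m" by simp
  qed
  moreover have "finite I" "l \<in> I" using l by (auto simp: I_def)
  ultimately show "hform \<kappa> k \<phi> X Y \<noteq> 0" "l * degree X + (k - l) * degree Y \<le> degree (hform \<kappa> k \<phi> X Y)"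
    using sum_distinct_degrees[of I f l] ne unfolding sum deg[OF \<open>l \<in> I\<close>] by auto
qed

interpretation const1: coeff_hom "\<lambda>c::'a::field. [:c:]"
  by unfold_locales (simp_all add: one_pCons)

lemma degree_diff_smult_lead_coeff:
  fixes \<alpha> \<beta> :: "'a::field poly"
  assumes "degree \<alpha> = degree \<beta>" "\<beta> \<noteq> 0"
  defines "a \<equiv> lead_coeff \<alpha> / lead_coeff \<beta>"
  shows "\<alpha> = smult a \<beta> \<or> degree (\<alpha> - smult a \<beta>) < degree \<beta>"
proof (cases "\<alpha> - smult a \<beta> = 0")
  case False
  have "coeff (\<alpha> - smult a \<beta>) (degree \<beta>) = 0" using assms by simp
  moreover have "degree (\<alpha> - smult a \<beta>) \<le> degree \<beta>"
    using assms by (intro degree_diff_le) auto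
  ultimately show ?thesis using False by (metis leading_coeff_0_iff le_neq_implies_less)
qed simp

text \<open>This holds because the field \<open>K\<close> is algebraically closed in \<open>K(t)\<close>.\<close>

lemma rational_root_of_form:
  fixes \<alpha> \<beta> :: "'a::field poly"
  assumes \<phi>: "degree \<phi> \<le> k" "\<phi> \<noteq> 0" and nz: "\<alpha> \<noteq> 0" "\<beta> \<noteq> 0"
    and 0: "hform (\<lambda>c. [:c:]) k \<phi> \<alpha> \<beta> = 0"
  obtains a where "\<alpha> = smult a \<beta>"
proof -
  have \<kappa>: "[:c:] \<noteq> 0 \<and> degree [:c:] = 0" if "c \<noteq> 0" for c :: 'a using that by simp
  have nonzero: "hform (\<lambda>c. [:c:]) k \<psi> X \<beta> \<noteq> 0"
    if "\<psi> \<noteq> 0" "degree \<psi> \<le> k" "X \<noteq> 0" "degree X \<noteq> degree \<beta>" for \<psi> X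
    using that nz by (intro hform_nonzero[OF const1.coeff_hom_axioms \<kappa>, where l = "degree \<psi>"]) auto
  have deg: "degree \<alpha> = degree \<beta>" using nonzero[of \<phi> \<alpha>] 0 \<phi> nz by blast
  \<comment> \<open>The only candidate: if \<alpha> - a \<beta> were nonzero, its degree would be
    less than that of \<beta>, and the form shifted by \<open>a\<close> could not vanish at
    arguments of different degrees.\<close>
  define a where "a = lead_coeff \<alpha> / lead_coeff \<beta>"
  have "\<alpha> = smult a \<beta>"
  proof (rule ccontr)
    assume *: "\<alpha> \<noteq> smult a \<beta>"
    let ?\<psi> = "pcompose \<phi> [:a, 1:]"
    have "?\<psi> \<noteq> 0" using \<phi> by (simp add: pcompose_eq_0_iff)
    moreover have "degree ?\<psi> \<le> k" using \<phi> by (simp add: degree_pcompose)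
    moreover have "degree (\<alpha> - smult a \<beta>) < degree \<beta>"
      using degree_diff_smult_lead_coeff[OF deg nz(2)] * unfolding a_def by blast
    ultimately have "hform (\<lambda>c. [:c:]) k ?\<psi> (\<alpha> - smult a \<beta>) \<beta> \<noteq> 0"
      using * by (intro nonzero) auto
    then show False using const1.hform_shift[OF \<phi>(1), of "\<alpha> - smult a \<beta>" a \<beta>] 0 by simp
  qed
  then show ?thesis by (rule that)
qed

lemma const2_nonzero: "c \<noteq> 0 \<Longrightarrow> const2 c \<noteq> 0 \<and> degree (const2 c) = 0"
  by (simp add: const2_def)

lemma coeff_hform_top:
  fixes X Y :: "'a::field poly poly"
  assumes "degree X = D" "degree Y = D" "X \<noteq> 0" "Y \<noteq> 0"
  shows "coeff (hform const2 k \<phi> X Y) (k * D) = hform (\<lambda>c. [:c:]) k \<phi> (lead_coeff X) (lead_coeff Y)"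
  unfolding hform_def coeff_sum
proof (rule sum.cong)
  fix l assume "l \<in> {..k}"
  then have "degree (X ^ l * Y ^ (k - l)) = k * D"
    using assms by (simp add: degree_mult_eq degree_power_eq flip: distrib_right)
  then have "coeff (X ^ l * Y ^ (k - l)) (k * D) = lead_coeff (X ^ l * Y ^ (k - l))" by simp
  also have "\<dots> = lead_coeff X ^ l * lead_coeff Y ^ (k - l)"
    by (simp add: lead_coeff_mult lead_coeff_power)
  finally show "coeff (const2 (coeff \<phi> l) * X ^ l * Y ^ (k - l)) (k * D) =
      [:coeff \<phi> l:] * lead_coeff X ^ l * lead_coeff Y ^ (k - l)"
    by (simp add: const2_def mult.assoc)
qed simp

text \<open>If the degrees of \<open>X\<close> and \<open>Y\<close> differ, no terms cancel, and a
  value of degree 0 leaves a single term in \<open>\<phi>\<close>. If they agree, the leading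
  coefficients are a zero of the form, so their ratio is a constant \<open>a\<close> of the field;
  subtracting \<open>a\<close> times \<open>Y\<close> from \<open>X\<close> leads back to different
  degrees.\<close>

lemma hform_value_constant:
  fixes X Y :: "'a::field poly poly"
  assumes k: "k > 0" and \<phi>: "degree \<phi> \<le> k"
    and Z: "hform const2 k \<phi> X Y \<noteq> 0" "degree (hform const2 k \<phi> X Y) = 0"
    and nonconst: "degree X > 0 \<or> degree Y > 0"
  obtains (Y_power) c where "\<phi> = [:c:]" "degree Y = 0"
    | (X_power) c where "\<phi> = monom c k" "degree Y > 0" "degree X = 0"
    | (linear_power) a c where "a \<noteq> 0" "c \<noteq> 0" "\<phi> = smult c ([:- a, 1:] ^ k)"
        "degree (X - const2 a * Y) = 0" "degree Y > 0"
proof -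
  note \<kappa> = const2.coeff_hom_axioms const2_nonzero
  have unequal: "(\<exists>c. \<phi> = [:c:]) \<and> degree Y = 0 \<or> (\<exists>c. \<phi> = monom c k) \<and> degree Y > 0 \<and> degree X = 0"
    if \<phi>: "degree \<phi> \<le> k" and Z: "hform const2 k \<phi> X Y \<noteq> 0" "degree (hform const2 k \<phi> X Y) = 0"
      and d: "degree X \<noteq> degree Y" for \<phi> X and Y :: "'a poly poly"
  proof -
    have X: "X \<noteq> 0"
    proof
      assume "X = 0"
      have eq: "hform const2 k \<phi> X Y = const2 (coeff \<phi> 0) * Y ^ k"
      proof -
        have "hform const2 k \<phi> X Y = (\<Sum>l\<in>{0}. const2 (coeff \<phi> l) * X ^ l * Y ^ (k - l))"
          unfolding hform_def by (rule sum.mono_neutral_right) (auto simp: \<open>X = 0\<close>)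
        then show ?thesis by simp
      qed
      with Z(1) have "coeff \<phi> 0 \<noteq> 0" using k by (auto simp: const2_hom)
      have "Y \<noteq> 0" using d \<open>X = 0\<close> by auto
      then have "degree (hform const2 k \<phi> X Y) = k * degree Y"
        unfolding eq using const2_nonzero \<open>coeff \<phi> 0 \<noteq> 0\<close> by (subst degree_mult_eq) (auto simp: degree_power_eq)
      with Z(2) k d \<open>X = 0\<close> show False by simp
    qed
    have Y: "Y \<noteq> 0"
    proof
      assume "Y = 0"
      have eq: "hform const2 k \<phi> X Y = const2 (coeff \<phi> k) * X ^ k"
      proof -
        have "hform const2 k \<phi> X Y = (\<Sum>l\<in>{k}. const2 (coeff \<phi> l) * X ^ l * Y ^ (k - l))"
          unfolding hform_def by (rule sum.mono_neutral_right) (auto simp: \<open>Y = 0\<close>)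
        then show ?thesis by simp
      qed
      with Z(1) have "coeff \<phi> k \<noteq> 0" using k by (auto simp: const2_hom)
      then have "degree (hform const2 k \<phi> X Y) = k * degree X"
        unfolding eq using const2_nonzero X by (subst degree_mult_eq) (auto simp: degree_power_eq)
      with Z(2) k d \<open>Y = 0\<close> show False by simp
    qed
    have l: "l * degree X = 0 \<and> (k - l) * degree Y = 0" if "coeff \<phi> l \<noteq> 0" for l
    proof -
      have "l \<le> k" using that \<phi> le_degree by (meson le_trans)
      from degree_hform_ge[OF \<kappa> X Y d this that] Z(2) show ?thesis by simp
    qed
    show ?thesis
    proof (cases "degree X > 0")
      case True
      then have "coeff \<phi> l = 0" if "l \<noteq> 0" for l using l[of l] that by auto
      then have eq: "\<phi> = [:coeff \<phi> 0:]" by (intro poly_eqI) (auto simp: coeff_pCons split: nat.splits)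
      moreover have "degree Y = 0"
      proof -
        have "\<phi> \<noteq> 0" using Z(1) by (auto simp: hform_def)
        then have "coeff \<phi> 0 \<noteq> 0" using eq by (metis pCons_0_0)
        from l[OF this] k show ?thesis by simp
      qed
      ultimately show ?thesis by blast
    next
      case False
      then have "degree X = 0" "degree Y > 0" using d by auto
      then have "coeff \<phi> l = 0" if "l \<noteq> k" for l
      proof (cases "l < k")
        case True
        then show ?thesis using l[of l] \<open>degree Y > 0\<close> by auto
      next
        case False
        then show ?thesis using that \<phi> by (intro coeff_eq_0) auto
      qed
      then have "\<phi> = monom (coeff \<phi> k) k" by (intro poly_eqI) auto
      then show ?thesis using \<open>degree X = 0\<close> \<open>degree Y > 0\<close> by blast
    qed
  qed
  show ?thesis
  proof (cases "degree X = degree Y")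
    case False
    with unequal[OF \<phi> Z False] show ?thesis using that by blast
  next
    case True
    define D where "D = degree Y"
    have D: "D > 0" "degree X = D" "degree Y = D" using True nonconst by (auto simp: D_def)
    have nz: "X \<noteq> 0" "Y \<noteq> 0" using D by auto
    have "\<phi> \<noteq> 0" using Z(1) by (auto simp: hform_def)
    have "hform (\<lambda>c. [:c:]) k \<phi> (lead_coeff X) (lead_coeff Y) = 0"
      using Z(2) k D(1) unfolding coeff_hform_top[OF D(2,3) nz, symmetric] by (simp add: coeff_eq_0)
    then obtain a where a: "lead_coeff X = smult a (lead_coeff Y)"
      using rational_root_of_form[OF \<phi> \<open>\<phi> \<noteq> 0\<close>] nz by (metis leading_coeff_0_iff)
    then have "a \<noteq> 0" using nz by (metis leading_coeff_0_iff smult_0_left)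
    let ?X = "X - const2 a * Y" and ?\<phi> = "pcompose \<phi> [:a, 1:]"
    have \<phi>': "degree ?\<phi> \<le> k" using \<phi> by (simp add: degree_pcompose)
    have shift: "hform const2 k \<phi> X Y = hform const2 k ?\<phi> ?X Y"
      using const2.hform_shift[OF \<phi>, of ?X a Y] by simp
    have "degree ?X < D"
    proof (rule degree_lessI)
      show "\<forall>k\<ge>D. coeff ?X k = 0"
      proof (intro allI impI)
        fix n assume "n \<ge> D"
        then show "coeff ?X n = 0"
          using a D by (cases "n = D") (auto simp: const2_def coeff_eq_0)
      qed
    qed (use D in auto)
    then have "degree ?X \<noteq> degree Y" using D by simp
    from unequal[OF \<phi>' Z[unfolded shift] this] D obtain c where c: "?\<phi> = monom c k" "degree ?X = 0"
      by auto
    have "pcompose [:a, 1:] [:- a, 1:] = [:0, 1:]" by (simp add: pcompose_pCons pcompose_1)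
    then have "pcompose ?\<phi> [:- a, 1:] = \<phi>" by (metis pcompose_assoc pcompose_idR)
    then have "\<phi> = smult c ([:- a, 1:] ^ k)"
      unfolding c(1) by (simp add: monom_altdef pcompose_smult pcompose_power pcompose_pCons pcompose_1)
    moreover from this \<open>\<phi> \<noteq> 0\<close> have "c \<noteq> 0" by auto
    ultimately show ?thesis using linear_power[of a c] \<open>a \<noteq> 0\<close> c(2) D by auto
  qed
qed

section \<open>The equation \<open>u\<^sup>a - c v\<^sup>b = r\<close> in polynomials\<close>

text \<open>Only exponents divisible by the characteristic survive. In characteristic 0 the
  substituted polynomial is \<open>monom 1 0\<close>, which is 1, and the conclusion is that
  \<open>u\<close> is constant.\<close>

lemma pderiv_eq_0_imp_pcompose:
  fixes u :: "'b::idom poly"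
  assumes "pderiv u = 0"
  obtains w where "u = pcompose w (monom 1 (CHAR('b)))"
proof -
  let ?p = "CHAR('b)"
  define w where "w = (\<Sum>i\<le>degree u. monom (coeff u i) (i div ?p))"
  have "pcompose (monom c m) (monom 1 ?p) = monom c (?p * m)" for c :: 'b and m
    by (simp add: monom_altdef[of c m] pcompose_smult pcompose_power pcompose_pCons pcompose_1
        monom_power smult_monom mult.commute)
  moreover have "?p dvd i" if "coeff u i \<noteq> 0" for i
  proof (cases i)
    case (Suc m)
    have "coeff (pderiv u) m = 0" using assms by simp
    then have "of_nat i = (0::'b)" using that Suc by (simp add: coeff_pderiv)
    then show ?thesis by (simp add: of_nat_eq_0_iff_char_dvd)
  qed simp
  ultimately have "pcompose (monom (coeff u i) (i div ?p)) (monom 1 ?p) = monom (coeff u i) i" for i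
    by (cases "coeff u i = 0") auto
  then have "pcompose w (monom 1 ?p) = u"
    unfolding w_def pcompose_sum by (simp add: poly_as_sum_of_monoms)
  then show ?thesis using that by metis
qed

lemma degree_pderiv_less: "pderiv u \<noteq> 0 \<Longrightarrow> degree (pderiv u) < degree (u :: 'b::idom poly)"
  by (intro degree_lessI) (auto simp: coeff_pderiv coeff_eq_0 intro!: pderiv_singleton elim: degree_eq_zeroE)

text \<open>Mason's argument: the two degree estimates obtained from the derivative of the equation
  contradict each other.  Polynomials with vanishing derivative are \<open>p\<close>-th power substitutions.\<close>

lemma power_diff_power_constant:
  fixes u v :: "'b::idom poly"
  assumes ab: "a \<ge> 2" "b \<ge> 2" "of_nat a \<noteq> (0::'b)" "of_nat b \<noteq> (0::'b)" and cr: "c \<noteq> 0" "r \<noteq> 0"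
    and eq: "u ^ a - smult c (v ^ b) = [:r:]"
  shows "degree u = 0 \<and> degree v = 0"
  using eq
proof (induction "degree u + degree v" arbitrary: u v rule: less_induct)
  case less
  obtain a' b' where a': "a = Suc a'" "a' \<ge> 1" and b': "b = Suc b'" "b' \<ge> 1"
    using ab by (cases a; cases b) auto
  have ua: "u ^ a = [:r:] + smult c (v ^ b)" using less.prems by (simp add: algebra_simps)
  have "pderiv (u ^ a) = pderiv ([:r:] + smult c (v ^ b))" by (rule arg_cong[OF ua])
  then have D: "smult (of_nat a) (u ^ a' * pderiv u) = smult (c * of_nat b) (v ^ b' * pderiv v)"
    by (simp add: a' b' pderiv_add pderiv_smult pderiv_power_Suc del: power_Suc)
  \<comment> \<open>The Wronskian of \<open>u ^ a\<close> and \<open>v ^ b\<close> divided by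
    \<open>u ^ a' * v ^ b'\<close>. Eliminating \<open>u ^ a\<close> or \<open>c v ^ b\<close> by
    means of the equation shows that high powers of \<open>v\<close> and \<open>u\<close> divide u'
    and v'.\<close>
  define W where "W = smult (of_nat b) (u * pderiv v) - smult (of_nat a) (v * pderiv u)"
  have Du: "smult (of_nat a * r) (pderiv u) = v ^ b' * smult c W"
  proof -
    have "smult (of_nat a) (u ^ a * pderiv u) = u * smult (of_nat a) (u ^ a' * pderiv u)"
      by (simp add: a' mult.assoc)
    also have "\<dots> = v ^ b' * smult c (smult (of_nat b) (u * pderiv v))"
      unfolding D by (simp add: algebra_simps)
    finally show ?thesis unfolding ua W_def
      by (simp add: b' algebra_simps smult_diff_right smult_add_right)
  qed
  have Dv: "smult (of_nat b * r) (pderiv v) = u ^ a' * W"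
  proof -
    have "smult (c * of_nat b) (v ^ b * pderiv v) = v * smult (c * of_nat b) (v ^ b' * pderiv v)"
      by (simp add: b' mult.assoc)
    also have "\<dots> = u ^ a' * smult (of_nat a) (v * pderiv u)"
      unfolding D[symmetric] by (simp add: algebra_simps)
    finally have "smult (of_nat b) (smult c (v ^ b) * pderiv v) = u ^ a' * smult (of_nat a) (v * pderiv u)"
      by (simp add: mult.commute)
    moreover have "smult c (v ^ b) = u ^ a - [:r:]" using ua by simp
    ultimately have "smult (of_nat b) ((u ^ a - [:r:]) * pderiv v) = u ^ a' * smult (of_nat a) (v * pderiv u)"
      by simp
    then show ?thesis unfolding W_def
      by (simp add: a' algebra_simps smult_diff_right smult_add_right)
  qed
  show ?case
  proof (cases "pderiv u = 0 \<and> pderiv v = 0")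
    case True
    let ?M = "monom 1 (CHAR('b)) :: 'b poly"
    obtain u1 v1 where uv: "u = pcompose u1 ?M" "v = pcompose v1 ?M"
      using True pderiv_eq_0_imp_pcompose by metis
    have degs: "degree u = degree u1 * CHAR('b)" "degree v = degree v1 * CHAR('b)"
      unfolding uv by (simp_all add: degree_pcompose degree_monom_eq)
    show ?thesis
    proof (cases "CHAR('b) = 0 \<or> degree u1 + degree v1 = 0")
      case True
      then show ?thesis using degs by auto
    next
      case False
      have "CHAR('b) \<noteq> 1" by simp
      with False have p: "CHAR('b) \<ge> 2" by linarith
      \<comment> \<open>Substituting x^p is injective, so the equation descends to \<open>u1\<close>
        and \<open>v1\<close>, whose total degree is smaller by the factor p.\<close>
      have "pcompose (u1 ^ a - smult c (v1 ^ b) - [:r:]) ?M = 0"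
        using less.prems by (simp add: uv pcompose_diff pcompose_smult pcompose_power)
      then have "u1 ^ a - smult c (v1 ^ b) - [:r:] = 0"
        by (rule pcompose_eq_0) (use p in \<open>simp add: degree_monom_eq\<close>)
      then have eq1: "u1 ^ a - smult c (v1 ^ b) = [:r:]" by simp
      have "degree u1 + degree v1 < (degree u1 + degree v1) * CHAR('b)"
        using False p by simp
      then have "degree u1 = 0 \<and> degree v1 = 0"
        by (intro less.hyps eq1) (simp add: degs algebra_simps)
      then show ?thesis by (simp add: degs)
    qed
  next
    case False
    have "W \<noteq> 0" using False Du Dv ab cr by auto
    have u: "u \<noteq> 0" and v: "v \<noteq> 0"
      using False Du Dv ab cr a' b' by auto
    have nz: "pderiv u \<noteq> 0" "pderiv v \<noteq> 0"
      using Du Dv \<open>W \<noteq> 0\<close> u v cr by auto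
    have "degree (pderiv u) = b' * degree v + degree W"
      using arg_cong[OF Du, of degree] ab cr v \<open>W \<noteq> 0\<close> by (simp add: degree_mult_eq degree_power_eq)
    moreover have "degree (pderiv v) = a' * degree u + degree W"
      using arg_cong[OF Dv, of degree] ab cr u \<open>W \<noteq> 0\<close> by (simp add: degree_mult_eq degree_power_eq)
    \<comment> \<open>This closes the circle deg v \<le> deg u' < deg u \<le> deg v' < deg
      v.\<close>
    moreover have "degree v \<le> b' * degree v" "degree u \<le> a' * degree u" using a' b' by simp_all
    ultimately show ?thesis
      using degree_pderiv_less[OF nz(1)] degree_pderiv_less[OF nz(2)] by linarith
  qed
qed

text \<open>If the characteristic divides one of the exponents \<open>a\<close> and \<open>b\<close>, differentiating the
  coefficients removes the corresponding term and isolates the other one.\<close>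

definition inner_deriv :: "'b::idom poly poly \<Rightarrow> 'b poly poly" where
  "inner_deriv = map_poly pderiv"

lemma inner_deriv_pCons [simp]: "inner_deriv (pCons c P) = pCons (pderiv c) (inner_deriv P)"
  by (simp add: inner_deriv_def map_poly_pCons)

lemma inner_deriv_0 [simp]: "inner_deriv 0 = 0"
  by (simp add: inner_deriv_def)

lemma inner_deriv_add: "inner_deriv (P + Q) = inner_deriv P + inner_deriv Q"
  by (induction P Q rule: poly_induct2) (simp_all add: pderiv_add)

lemma inner_deriv_smult: "inner_deriv (smult c P) = smult (pderiv c) P + smult c (inner_deriv P)"
  by (induction P) (simp_all add: pderiv_mult algebra_simps)

lemma inner_deriv_mult: "inner_deriv (P * Q) = inner_deriv P * Q + P * inner_deriv Q"
  by (induction P) (simp_all add: inner_deriv_add inner_deriv_smult algebra_simps)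

lemma inner_deriv_power: "inner_deriv (P ^ Suc n) = of_nat (Suc n) * P ^ n * inner_deriv P"
proof (induction n)
  case (Suc n)
  have "inner_deriv (P ^ Suc (Suc n)) = inner_deriv P * P ^ Suc n + P * inner_deriv (P ^ Suc n)"
    unfolding power_Suc[of P "Suc n"] by (rule inner_deriv_mult)
  then show ?case unfolding Suc by (simp add: algebra_simps)
qed simp

lemma degree_eq_0_if_mult_const:
  fixes x y :: "'b::idom poly"
  assumes "x * y = [:c:]" "[:c:] \<noteq> 0"
  shows "degree x = 0"
proof -
  have "x \<noteq> 0" "y \<noteq> 0" using assms by auto
  from degree_mult_eq[OF this] assms(1) show ?thesis by simp
qed

text \<open>The right-hand side is x^a - c y^b at the point (t, t^M), the value of the flow at time
  0. If the characteristic divides \<open>a\<close>, differentiation by t leaves a power of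
  \<open>v\<close> dividing a multiple of t^(M b - 1), which is nonzero because \<open>M\<close> and
  \<open>b\<close> are invertible in the field; the case of \<open>b\<close> is symmetric.
  Coprimality keeps the characteristic from dividing both.\<close>

lemma weighted_binomial_constant:
  fixes u v :: "'a::field poly poly"
  assumes ab: "a \<ge> 2" "b \<ge> 2" "coprime a b" and M: "of_nat M \<noteq> (0::'a)" and c: "c \<noteq> 0"
    and eq: "u ^ a - const2 c * v ^ b = [:monom 1 a - smult c (monom 1 (M * b)):]"
    and nz: "monom 1 a - smult c (monom 1 (M * b)) \<noteq> 0"
  shows "degree u = 0 \<and> degree v = 0"
proof -
  obtain a' b' where a': "a = Suc a'" "a' \<ge> 1" and b': "b = Suc b'" "b' \<ge> 1"
    using ab by (cases a; cases b) auto
  let ?r = "monom 1 a - smult c (monom 1 (M * b))"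
  have of_nat_poly_eq_0: "(of_nat n :: 'a poly) = 0 \<longleftrightarrow> of_nat n = (0::'a)" for n
    by (simp add: of_nat_poly)
  have of_nat_poly2: "(of_nat n :: 'a poly poly) = [:of_nat n:]" for n
    by (simp add: of_nat_poly)
  have "inner_deriv (u ^ a) = inner_deriv (const2 c * v ^ b + [:?r:])"
    using eq by (simp add: algebra_simps)
  then have D: "of_nat a * u ^ a' * inner_deriv u =
      const2 c * (of_nat b * v ^ b' * inner_deriv v) + [:pderiv ?r:]"
    unfolding a' b' inner_deriv_add inner_deriv_mult inner_deriv_power
    by (simp add: const2_def pderiv_diff del: power_Suc)
  have deg_iff: "degree u = 0 \<longleftrightarrow> degree v = 0"
  proof -
    have "degree u = 0" if "degree v = 0"
    proof (cases "u = 0")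
      case False
      have "u ^ a = const2 c * v ^ b + [:?r:]" using eq by (simp add: algebra_simps)
      also obtain v0 where "v = [:v0:]" using \<open>degree v = 0\<close> by (rule degree_eq_zeroE)
      then have "const2 c * v ^ b + [:?r:] = [:[:c:] * v0 ^ b + ?r:]"
        by (simp add: const2_def poly_const_pow)
      finally have "degree (u ^ a) = 0" by simp
      then show ?thesis using False ab by (simp add: degree_power_eq)
    qed simp
    moreover have "degree v = 0" if "degree u = 0"
    proof (cases "v = 0")
      case False
      have "const2 c * v ^ b = u ^ a - [:?r:]" using eq by (simp add: algebra_simps)
      also obtain u0 where "u = [:u0:]" using \<open>degree u = 0\<close> by (rule degree_eq_zeroE)
      then have "u ^ a - [:?r:] = [:u0 ^ a - ?r:]"
        by (simp add: poly_const_pow)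
      finally have "degree (const2 c * v ^ b) = 0" by simp
      then show ?thesis using False ab c by (simp add: const2_def degree_power_eq)
    qed simp
    ultimately show ?thesis by blast
  qed
  have not_both: "of_nat a \<noteq> (0::'a) \<or> of_nat b \<noteq> (0::'a)"
  proof (rule ccontr)
    assume "\<not> ?thesis"
    then have "CHAR('a) dvd a" "CHAR('a) dvd b" by (auto simp: of_nat_eq_0_iff_char_dvd)
    then have "CHAR('a) dvd gcd a b" by (rule gcd_greatest)
    then show False using ab(3) by simp
  qed
  consider "of_nat a = (0::'a)" | "of_nat b = (0::'a)" | "of_nat a \<noteq> (0::'a)" "of_nat b \<noteq> (0::'a)"
    by blast
  then show ?thesis
  proof cases
    case 1
    then have b: "of_nat b \<noteq> (0::'a)" using not_both by blast
    let ?R = "[:smult c (monom (of_nat (M * b)) (M * b - 1)):]"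
    have "pderiv ?r = - smult c (monom (of_nat (M * b)) (M * b - 1))"
      using 1 by (simp add: pderiv_diff pderiv_smult pderiv_monom)
    then have *: "v ^ b' * ([:[:c:]:] * of_nat b * inner_deriv v) = ?R"
    proof -
      have "(of_nat a :: 'a poly poly) = 0" using 1 by (simp add: of_nat_poly2 of_nat_poly_eq_0)
      with D have "v ^ b' * (const2 c * of_nat b * inner_deriv v) + [:pderiv ?r:] = 0"
        by (simp add: algebra_simps)
      also have "[:pderiv ?r:] = - ?R" unfolding \<open>pderiv ?r = _\<close> by simp
      finally show ?thesis by (simp only: const2_def add_uminus_conv_diff right_minus_eq)
    qed
    have "of_nat (M * b) \<noteq> (0::'a)" using M b by simp
    then have "?R \<noteq> 0" using c by simp
    with * have "degree (v ^ b') = 0" by (rule degree_eq_0_if_mult_const)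
    then have "degree v = 0"
      using b' by (cases "v = 0") (auto simp: degree_power_eq)
    then show ?thesis using deg_iff by simp
  next
    case 2
    then have a: "of_nat a \<noteq> (0::'a)" using not_both by blast
    let ?R = "[:monom (of_nat a) (a - 1):] :: 'a poly poly"
    have "pderiv ?r = monom (of_nat a) (a - 1)"
      using 2 by (simp add: pderiv_diff pderiv_smult pderiv_monom)
    then have *: "u ^ a' * (of_nat a * inner_deriv u) = ?R"
      using D 2 by (simp add: of_nat_poly2 of_nat_poly_eq_0 algebra_simps)
    have "?R \<noteq> 0" using a by simp
    with * have "degree (u ^ a') = 0" by (rule degree_eq_0_if_mult_const)
    then have "degree u = 0"
      using a' by (cases "u = 0") (auto simp: degree_power_eq)
    then show ?thesis using deg_iff by simp
  next
    case 3
    show ?thesis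
      by (rule power_diff_power_constant[OF ab(1,2), where c = "[:c:]" and r = ?r])
         (use 3 c nz eq in \<open>auto simp: of_nat_poly_eq_0 const2_def\<close>)
  qed
qed

section \<open>Leading forms of a component of an automorphism\<close>

text \<open>The weights are crossed: x has weight \<open>b\<close> and y has weight
  \<open>a\<close>, so x^a and y^b are equally heavy. From b i + a j = a n and coprimality follow i
  = a l and j = n - b l; splitting off the power of y with exponent \<open>n mod b\<close> leaves a
  form in x^a and y^b.\<close>

lemma whom_eq_hform:
  fixes P :: "'a::field poly poly"
  assumes ab: "a > 0" "b > 0" "coprime a b" and P: "whom (int b) (int a) (int (a * n)) P"
  obtains \<phi> where "degree \<phi> \<le> n div b"
    "P = Y2 ^ (n mod b) * hform const2 (n div b) \<phi> (X2 ^ a) (Y2 ^ b)"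
    "\<And>l. l \<le> n div b \<Longrightarrow> coeff \<phi> l = coeff (coeff P (n - b * l)) (a * l)"
proof -
  let ?k = "n div b"
  define c where "c l = coeff (coeff P (n - b * l)) (a * l)" for l
  define \<phi> where "\<phi> = Abs_poly (\<lambda>l. if l \<le> ?k then c l else 0)"
  have coeff_\<phi>: "coeff \<phi> l = (if l \<le> ?k then c l else 0)" for l
    by (simp add: \<phi>_def coeff_Abs_poly_If_le)
  have exp: "n mod b + b * (?k - l) = n - b * l" if "l \<le> ?k" for l
  proof -
    have "b * l \<le> b * ?k" using that by simp
    then show ?thesis using mult_div_mod_eq[of b n] by (simp add: right_diff_distrib')
  qed
  have "Y2 ^ (n mod b) * (const2 (coeff \<phi> l) * (X2 ^ a) ^ l * (Y2 ^ b) ^ (?k - l)) =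
      monom (monom (c l) (a * l)) (n - b * l)" if "l \<le> ?k" for l
  proof -
    have "Y2 ^ (n mod b) * (const2 (coeff \<phi> l) * (X2 ^ a) ^ l * (Y2 ^ b) ^ (?k - l)) =
      const2 (c l) * X2 ^ (a * l) * Y2 ^ (n mod b + b * (?k - l))"
      using that by (simp add: coeff_\<phi> algebra_simps flip: power_mult power_add)
    then show ?thesis unfolding exp[OF that] monomial2 .
  qed
  then have rhs: "Y2 ^ (n mod b) * hform const2 ?k \<phi> (X2 ^ a) (Y2 ^ b) =
      (\<Sum>l\<le>?k. monom (monom (c l) (a * l)) (n - b * l))"
    unfolding hform_def sum_distrib_left by (intro sum.cong) auto
  have "P = (\<Sum>l\<le>?k. monom (monom (c l) (a * l)) (n - b * l))"
  proof (intro poly_eqI)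
    fix j i
    let ?t = "\<lambda>l. if n - b * l = j \<and> a * l = i then coeff (coeff P j) i else 0"
    have "coeff (coeff (\<Sum>l\<le>?k. monom (monom (c l) (a * l)) (n - b * l)) j) i = (\<Sum>l\<le>?k. ?t l)"
      by (auto simp: coeff_sum c_def intro!: sum.cong)
    also have "\<dots> = coeff (coeff P j) i"
    proof (cases "coeff (coeff P j) i = 0")
      case False
      then have "int (b * i + a * j) = int (a * n)" using supp_wtD[OF P] by simp
      then have eq: "b * i + a * j = a * n" by (simp only: of_nat_eq_iff)
      then have "a dvd b * i" by (metis dvd_add_left_iff dvd_triv_left)
      then have "a dvd i" using ab(3) by (simp add: coprime_dvd_mult_right_iff)
      then obtain l0 where l0: "i = a * l0" by blast
      with eq ab(1) have n: "n = b * l0 + j" by (simp add: algebra_simps flip: distrib_left)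
      then have "l0 \<le> ?k" using ab(2) by simp
      moreover have "?t l = (if l = l0 then coeff (coeff P j) i else 0)" for l
        using n l0 ab by auto
      ultimately show ?thesis by simp
    next
      case True
      then show ?thesis by (intro trans[OF sum.neutral]) auto
    qed
    finally show "coeff (coeff P j) i = coeff (coeff (\<Sum>l\<le>?k. monom (monom (c l) (a * l)) (n - b * l)) j) i"
      by simp
  qed
  moreover have "degree \<phi> \<le> ?k" by (intro degree_le) (simp add: coeff_\<phi>)
  ultimately show ?thesis using that[of \<phi>] rhs by (simp add: coeff_\<phi> c_def)
qed

lemma subst2_hform: "subst2 g (hform const2 k \<phi> X Y) = hform const2 k \<phi> (subst2 g X) (subst2 g Y)"
  by (simp add: hform_def subst2_sum subst2_mult subst2_power)

lemma subst2_const_snd: "subst2 ([:[:0, 1:]:], [:q:]) P = [:poly P q:]"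
  by (induction P rule: poly2_induct)
     (simp_all add: subst2_add subst2_mult, simp_all add: const2_def X2_def Y2_def)

text \<open>Of two consecutive numbers at least one is nonzero in the field, so infinitely many
  powers of t are candidates, whereas a polynomial over K[t] has finitely many roots. This holds
  over finite fields as well.\<close>

lemma exists_monom_nonroot:
  fixes P :: "'a::field poly poly"
  assumes "P \<noteq> 0"
  obtains M where "of_nat M \<noteq> (0::'a)" "poly P (monom 1 M) \<noteq> 0"
proof -
  define S where "S = {M. of_nat M \<noteq> (0::'a)}"
  have "infinite S"
    unfolding infinite_nat_iff_unbounded
  proof (intro allI)
    fix m
    show "\<exists>n>m. n \<in> S"
    proof (cases "of_nat (Suc m) = (0::'a)")
      case True
      then have "of_nat (Suc (Suc m)) = (1::'a)" by (metis of_nat_Suc add.right_neutral)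
      then have "Suc (Suc m) \<in> S" by (simp add: S_def del: of_nat_Suc)
      then show ?thesis by (intro exI[of _ "Suc (Suc m)"]) simp
    next
      case False
      then have "Suc m \<in> S" by (simp add: S_def del: of_nat_Suc)
      then show ?thesis by blast
    qed
  qed
  moreover have "inj_on (\<lambda>M. monom (1::'a) M) S" by (auto intro!: inj_onI simp: monom_eq_iff')
  ultimately have "infinite ((\<lambda>M. monom (1::'a) M) ` S)" by (simp add: finite_image_iff)
  then have "\<not> (\<lambda>M. monom (1::'a) M) ` S \<subseteq> {x. poly P x = 0}"
    using poly_roots_finite[OF assms] finite_subset by blast
  then show ?thesis using that by (auto simp: S_def)
qed

text \<open>The flow through (t, t^M) keeps the value of the leading form, a nonzero element of
  K[t]. Hence both the factor \<open>v ^ (n mod b)\<close> and the binary form at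
  \<open>u ^ a\<close> and \<open>v ^ b\<close> are free of s. If \<open>v\<close> depends on s, the
  first factor must be absent. In the last case \<open>u ^ a - e v ^ b\<close> is free of s too,
  which is impossible for exponents that are both at least 2.\<close>

theorem leading_form_cases:
  fixes g :: "'a::field plane_map"
  assumes g: "g \<in> carrier GA2" and ab: "a > 0" "b > 0" "coprime a b"
    and d: "wle (int b) (int a) (int (a * n)) (fst g)" and k: "n div b > 0"
    and Fbar: "wcomp (int b) (int a) (int (a * n)) (fst g) =
      Y2 ^ (n mod b) * hform const2 (n div b) \<phi> (X2 ^ a) (Y2 ^ b)"
    and \<phi>: "degree \<phi> \<le> n div b" "\<phi> \<noteq> 0"
  obtains (Y_power) c where "\<phi> = [:c:]"
    | (X_power) c where "\<phi> = monom c (n div b)" "n mod b = 0"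
    | (linear_power) e c where "e \<noteq> 0" "c \<noteq> 0" "\<phi> = smult c ([:- e, 1:] ^ (n div b))" "n mod b = 0"
        "a = 1 \<or> b = 1"
proof -
  let ?k = "n div b" and ?Fbar = "wcomp (int b) (int a) (int (a * n)) (fst g)"
  have "?Fbar \<noteq> 0"
  proof
    assume "?Fbar = 0"
    then have 0: "hform const2 ?k \<phi> (X2 ^ a) (Y2 ^ b) = 0"
      unfolding Fbar by (simp add: Y2_def)
    have deg: "degree (X2 ^ a :: 'a poly poly) = 0" "degree (Y2 ^ b :: 'a poly poly) = b"
      unfolding X2_power Y2_power by (simp_all add: degree_monom_eq)
    have "hform const2 ?k \<phi> (X2 ^ a) (Y2 ^ b) \<noteq> 0"
    proof (rule hform_nonzero[OF const2.coeff_hom_axioms const2_nonzero])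
      show "coeff \<phi> (degree \<phi>) \<noteq> 0" using \<phi>(2) by simp
      show "degree (X2 ^ a :: 'a poly poly) \<noteq> degree (Y2 ^ b :: 'a poly poly)"
        unfolding deg using ab(2) by simp
    qed (use \<phi>(1) in \<open>simp_all add: X2_def Y2_def\<close>)
    with 0 show False by simp
  qed
  then obtain M where M: "of_nat M \<noteq> (0::'a)" "poly ?Fbar (monom 1 M) \<noteq> 0"
    by (rule exists_monom_nonroot)
  obtain u v where uv: "coeff u 0 = [:0, 1:]" "coeff v 0 = monom 1 M" "degree u > 0 \<or> degree v > 0"
    "subst2 (u, v) ?Fbar = subst2 ([:[:0, 1:]:], [:monom 1 M:]) ?Fbar"
    using graded_flow[OF g d, of "[:0, 1:]" "monom 1 M"] by metis
  let ?Z = "hform const2 ?k \<phi> (u ^ a) (v ^ b)"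
  have eq: "v ^ (n mod b) * ?Z = [:poly ?Fbar (monom 1 M):]"
    using uv(4) unfolding subst2_const_snd
    by (subst (asm) (1) Fbar) (simp add: subst2_mult subst2_power subst2_hform)
  then have nz: "v ^ (n mod b) \<noteq> 0" "?Z \<noteq> 0" using M(2) by (metis mult_zero_left mult_zero_right pCons_eq_0_iff)+
  have "degree (v ^ (n mod b)) + degree ?Z = 0"
    unfolding degree_mult_eq[OF nz, symmetric] eq by simp
  then have degs: "degree (v ^ (n mod b)) = 0" "degree ?Z = 0" by auto
  have mod0: "n mod b = 0" if "degree (v ^ b) > 0"
  proof -
    have v: "degree v > 0"
    proof (rule ccontr)
      assume "\<not> degree v > 0"
      then have "degree v * b = 0" by simp
      with that degree_power_le[of v b] show False by linarith
    qed
    then have "v \<noteq> 0" by auto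
    then have "n mod b * degree v = 0" using degs(1) degree_power_eq by metis
    then show ?thesis using v by (metis mult_is_0 less_numeral_extra(3))
  qed
  have nonconst: "degree (u ^ a) > 0 \<or> degree (v ^ b) > 0"
  proof -
    have "degree (w ^ m) > 0" if "degree w > 0" "m > 0" for w :: "'a poly poly" and m
      using that by (subst degree_power_eq) auto
    from this[of u a] this[of v b] show ?thesis using uv(3) ab(1,2) by linarith
  qed
  from k \<phi>(1) nz(2) degs(2) nonconst show ?thesis
  proof (cases rule: hform_value_constant)
    case (linear_power e c)
    let ?w = "u ^ a - const2 e * v ^ b"
    have w: "?w = [:coeff ?w 0:]" using linear_power(4) by (metis degree_0_id)
    have coeff0: "coeff ?w 0 = monom 1 a - smult e (monom 1 (M * b))"
    proof -
      have "coeff (u ^ a) 0 = monom 1 a"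
        by (simp add: coeff_0_power uv(1) monom_altdef)
      moreover have "coeff (v ^ b) 0 = monom 1 (M * b)"
        by (simp add: coeff_0_power uv(2) monom_power mult.commute)
      ultimately show ?thesis by (simp add: const2_def)
    qed
    have "?w \<noteq> 0"
    proof
      assume "?w = 0"
      moreover have "?Z = const2 c * ?w ^ ?k"
        unfolding linear_power(3) const2.hform_linear_power ..
      ultimately have "?Z = 0" using k by simp
      with nz show False by simp
    qed
    then have nz0: "monom 1 a - smult e (monom 1 (M * b)) \<noteq> 0" using w coeff0 by auto
    have "a = 1 \<or> b = 1"
    proof (rule ccontr)
      assume "\<not> ?thesis"
      then have "a \<ge> 2" "b \<ge> 2" using ab by auto
      from weighted_binomial_constant[OF this ab(3) M(1) linear_power(1) w[unfolded coeff0] nz0] uv(3)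
      show False by auto
    qed
    then show ?thesis by (rule that(3)[OF linear_power(1,2,3) mod0[OF linear_power(5)]])
  next
    case (X_power c)
    show ?thesis by (rule that(2)[OF X_power(1) mod0[OF X_power(2)]])
  next
    case (Y_power c)
    show ?thesis by (rule that(1)[OF Y_power(1)])
  qed
qed

section \<open>Generation by affine and elementary maps\<close>

interpretation const2: weighted_coeff_hom "const2 :: 'a::field \<Rightarrow> 'a poly poly"
  by unfold_locales (simp add: const2_def)

interpretation GA2: group "GA2 :: 'a::field plane_map monoid"
  by (rule group_GA2)

definition affine_map :: "'a::field \<Rightarrow> 'a \<Rightarrow> 'a \<Rightarrow> 'a \<Rightarrow> 'a \<Rightarrow> 'a \<Rightarrow> 'a plane_map" where
  "affine_map a b u c d v =
     (const2 a * X2 + const2 b * Y2 + const2 u, const2 c * X2 + const2 d * Y2 + const2 v)"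

definition elementary_map :: "'a::field \<Rightarrow> 'a poly \<Rightarrow> 'a \<Rightarrow> 'a \<Rightarrow> 'a plane_map" where
  "elementary_map \<alpha> P \<beta> v = (const2 \<alpha> * X2 + poly_in_y P, const2 \<beta> * Y2 + const2 v)"

lemma affine_map_in: "a * d - b * c \<noteq> 0 \<Longrightarrow> affine_map a b u c d v \<in> affine_maps"
  unfolding affine_maps_def affine_map_def by blast

lemma elementary_map_in: "\<alpha> \<noteq> 0 \<Longrightarrow> \<beta> \<noteq> 0 \<Longrightarrow> elementary_map \<alpha> P \<beta> v \<in> elementary_maps"
  unfolding elementary_maps_def elementary_map_def by auto

lemma GA2_mult: "f \<otimes>\<^bsub>GA2\<^esub> g = (subst2 g (fst f), subst2 g (snd f))"
  by (simp add: GA2_def units_of_def poly_endo_def)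

lemma GA2_one: "\<one>\<^bsub>GA2\<^esub> = (X2, Y2)"
  by (simp add: GA2_def units_of_def poly_endo_def)

abbreviation tame :: "'a::field plane_map set" where
  "tame \<equiv> generate GA2 (affine_maps \<union> elementary_maps)"

lemma tame_in_GA2: "m \<in> tame \<Longrightarrow> m \<in> carrier GA2"
  using GA2.generate_incl affine_maps_subset elementary_maps_subset by blast

lemma tame_cancel:
  assumes "g \<in> carrier GA2" "m \<in> tame" "g \<otimes>\<^bsub>GA2\<^esub> m \<in> tame"
  shows "g \<in> tame"
proof -
  have "inv\<^bsub>GA2\<^esub> m \<in> tame"
    using assms(2) affine_maps_subset elementary_maps_subset
    by (intro GA2.generate_m_inv_closed) auto
  with assms(3) have "g \<otimes>\<^bsub>GA2\<^esub> m \<otimes>\<^bsub>GA2\<^esub> inv\<^bsub>GA2\<^esub> m \<in> tame"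
    by (rule generate.eng)
  then show ?thesis using assms(1) tame_in_GA2[OF assms(2)] by (simp add: GA2.m_assoc)
qed

abbreviation swap_map :: "'a::field plane_map" where
  "swap_map \<equiv> (Y2, X2)"

lemma swap_map_affine: "swap_map \<in> affine_maps"
  using affine_map_in[of 0 0 1 1 0 0] by (simp add: affine_map_def const2_hom)

lemma subst2_X2_eq_pcompose: "subst2 (X2, G) P = pcompose P G"
proof (induction P rule: poly2_induct)
  case (const c)
  show ?case unfolding subst2_const2 by (simp add: const2_def)
next
  case X
  show ?case unfolding subst2_X2 by (simp add: X2_def)
next
  case Y
  show ?case unfolding subst2_Y2 by (simp add: Y2_def pcompose_pCons pcompose_1)
qed (simp_all add: subst2_add subst2_mult pcompose_add pcompose_mult)

lemma subst2_poly_in_y_eq_pcompose: "subst2 (A, B) (poly_in_y P) = pcompose (poly_in_y P) B"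
  by (metis subst2_poly_in_y subst2_X2_eq_pcompose)

lemma subst2_swap_poly_in_y: "subst2 swap_map (poly_in_y P) = [:P:]"
proof (induction P)
  case (pCons a P)
  then show ?case by (simp add: poly_in_y_pCons subst2_add subst2_mult pCons_eq_X2_Y2(1))
qed simp

lemma pcompose_poly_in_y_const: "pcompose (poly_in_y P) [:q:] = [:pcompose P q:]"
  by (induction P)
     (simp_all add: poly_in_y_pCons pcompose_add pcompose_mult pcompose_pCons pcompose_1 const2_def Y2_def)

lemma degree_poly_in_y [simp]: "degree (poly_in_y P) = degree P"
  unfolding poly_in_y_def by (rule degree_map_poly) auto

lemma coeff_poly_in_y: "coeff (poly_in_y P) j = [:coeff P j:]"
  by (simp add: poly_in_y_def coeff_map_poly)

lemma degree_eq_1_imp: "degree p = 1 \<Longrightarrow> p = [:coeff p 0, coeff p 1:]"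
  by (intro poly_eqI) (auto simp: coeff_pCons coeff_eq_0 split: nat.splits)

text \<open>Over K[x] the map is a substitution for y, and the second component of its inverse is a
  left inverse under composition. So the degree in y is 1 and the leading coefficient is a unit of
  K[x], that is, a constant; conjugation by the swap makes the map elementary.\<close>

lemma tame_if_fst_X2:
  assumes g: "(X2, G) \<in> carrier GA2"
  shows "(X2, G) \<in> tame"
proof -
  obtain h :: "'a plane_map" where "subst2 (X2, G) (snd h) = Y2" using GA2_inverse_maps[OF g] by metis
  then have q: "pcompose (snd h) G = Y2" by (simp add: subst2_X2_eq_pcompose)
  then have "degree (snd h) * degree G = degree (Y2 :: 'a poly poly)" by (metis degree_pcompose)
  then have deg: "degree (snd h) = 1" "degree G = 1" by (simp_all add: Y2_def)
  then obtain C D A B where h: "snd h = [:C, D:]" and G: "G = [:A, B:]"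
    using degree_eq_1_imp by blast
  have "B * D = 1" using q by (simp add: h G pcompose_pCons Y2_def mult.commute)
  then have "is_unit B" by (metis dvdI)
  then obtain \<beta> where \<beta>: "B = [:\<beta>:]" "\<beta> \<noteq> 0"
    by (metis is_unit_poly_iff dvd_0_left_iff one_neq_zero)
  let ?e = "elementary_map \<beta> A 1 0"
  have "?e \<in> tame" "swap_map \<in> tame"
    using elementary_map_in[of \<beta> 1] \<beta> swap_map_affine by (auto intro: generate.incl)
  then have "swap_map \<otimes>\<^bsub>GA2\<^esub> (?e \<otimes>\<^bsub>GA2\<^esub> swap_map) \<in> tame"
    by (intro generate.eng)
  also have "swap_map \<otimes>\<^bsub>GA2\<^esub> (?e \<otimes>\<^bsub>GA2\<^esub> swap_map) = (X2, const2 \<beta> * Y2 + [:A:])"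
    by (simp add: GA2_mult elementary_map_def subst2_add subst2_mult subst2_swap_poly_in_y const2_hom)
  also have "const2 \<beta> * Y2 + [:A:] = G"
    by (simp add: G \<beta> const2_def Y2_def)
  finally show ?thesis .
qed

lemma GA2_fst_nonconstant:
  assumes "g \<in> carrier GA2"
  shows "fst g \<noteq> const2 c"
proof
  assume *: "fst g = const2 c"
  obtain h where "subst2 h (fst g) = X2" using GA2_inverse_maps[OF assms] by metis
  then have "const2 c = X2" unfolding * subst2_const2 .
  then show False by (simp add: const2_def X2_def)
qed

lemma wle_1_1_1_eq:
  assumes "wle 1 1 1 P"
  shows "P = const2 (coeff (coeff P 0) 1) * X2 + const2 (coeff (coeff P 1) 0) * Y2 + const2 (coeff (coeff P 0) 0)"
proof (intro poly_eqI)
  fix j i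
  have 0: "coeff (coeff P j) i = 0" if "i + j > 1" for i j
    using supp_wtD[OF assms, of j i] that by force
  show "coeff (coeff P j) i = coeff (coeff (const2 (coeff (coeff P 0) 1) * X2 +
      const2 (coeff (coeff P 1) 0) * Y2 + const2 (coeff (coeff P 0) 0)) j) i"
    using 0[of i j] by (auto simp: const2_def X2_def Y2_def coeff_pCons split: nat.splits)
qed

lemma tame_if_fst_linear:
  assumes g: "g \<in> carrier GA2" and "wle 1 1 1 (fst g)"
  shows "g \<in> tame"
proof -
  obtain \<alpha> \<beta> \<gamma> where F: "fst g = const2 \<alpha> * X2 + const2 \<beta> * Y2 + const2 \<gamma>"
    using wle_1_1_1_eq[OF assms(2)] by blast
  obtain m where m: "m \<in> affine_maps" "subst2 m (fst g) = X2"
  proof (cases "\<alpha> = 0")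
    case False
    let ?m = "affine_map (1 / \<alpha>) (- \<beta> / \<alpha>) (- \<gamma> / \<alpha>) 0 1 0"
    have "subst2 ?m (fst g) = X2"
      using False by (simp add: F affine_map_def subst2_add subst2_mult)
        (simp add: const2_def X2_def Y2_def)
    moreover have "?m \<in> affine_maps" using False by (intro affine_map_in) simp
    ultimately show ?thesis using that by blast
  next
    case True
    then have "\<beta> \<noteq> 0" using GA2_fst_nonconstant[OF g, of \<gamma>] by (auto simp: F const2_hom)
    let ?m = "affine_map 0 1 0 (1 / \<beta>) 0 (- \<gamma> / \<beta>)"
    have "subst2 ?m (fst g) = X2"
      using \<open>\<beta> \<noteq> 0\<close> by (simp add: F True affine_map_def subst2_add subst2_mult const2_hom)
        (simp add: const2_def X2_def Y2_def)
    moreover have "?m \<in> affine_maps" using \<open>\<beta> \<noteq> 0\<close> by (intro affine_map_in) simp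
    ultimately show ?thesis using that by blast
  qed
  have m_tame: "m \<in> tame" using m(1) by (auto intro: generate.incl)
  have "g \<otimes>\<^bsub>GA2\<^esub> m \<in> carrier GA2" using g tame_in_GA2[OF m_tame] by simp
  then have "g \<otimes>\<^bsub>GA2\<^esub> m \<in> tame"
    unfolding GA2_mult m(2) by (rule tame_if_fst_X2)
  with g m_tame show ?thesis by (rule tame_cancel)
qed

lemma wle_affine_map:
  "wle 1 1 1 (fst (affine_map a b u c d v))" "wle 1 1 1 (snd (affine_map a b u c d v))"
  by (auto simp: affine_map_def supp_wt_def const2_def X2_def Y2_def coeff_pCons split: nat.splits)

lemma wle_subst2:
  assumes "wle w1 w2 d P" "wle \<alpha> \<beta> w1 (fst m)" "wle \<alpha> \<beta> w2 (snd m)"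
  shows "wle \<alpha> \<beta> d (subst2 m P)"
  using const2.wle_ev2[OF assms(1), of 1 \<alpha> \<beta> "fst m" "snd m"] assms
  by (simp add: subst2_eq_ev2[of "fst m" "snd m", simplified])

section \<open>Lowering the degree of the first component\<close>

lemma normalize_leading_form:
  assumes g: "g \<in> carrier GA2" and n: "n > 0" "wle 1 1 (int n) (fst g)"
    and nz: "wcomp 1 1 (int n) (fst g) \<noteq> 0"
  obtains m c where "m \<in> affine_maps" "c \<noteq> 0"
    "wle 1 1 (int n - 1) (subst2 m (fst g) - const2 c * Y2 ^ n)"
proof -
  let ?Fbar = "wcomp 1 1 (int n) (fst g)"
  have "whom (int 1) (int 1) (int (1 * n)) ?Fbar" using whom_wcomp by simp
  from whom_eq_hform[OF _ _ _ this] obtain \<phi> where \<phi>: "degree \<phi> \<le> n"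
    and Fbar: "?Fbar = hform const2 n \<phi> X2 Y2" by auto
  have "\<phi> \<noteq> 0" using nz Fbar by (auto simp: hform_def)
  obtain a b c d e where m: "a * d - b * c \<noteq> 0" "e \<noteq> 0"
    "subst2 (affine_map a b 0 c d 0) ?Fbar = const2 e * Y2 ^ n"
  proof (rule leading_form_cases[of g 1 1 n \<phi>])
    fix c assume c: "\<phi> = [:c:]"
    show thesis
    proof (rule that[of 1 1 0 0 c])
      show "c \<noteq> 0" using c \<open>\<phi> \<noteq> 0\<close> by auto
      show "subst2 (affine_map 1 0 0 0 1 0) ?Fbar = const2 c * Y2 ^ n"
        unfolding Fbar c const2.hform_const by (simp add: subst2_mult subst2_power affine_map_def const2_hom)
    qed auto
  next
    fix c assume c: "\<phi> = monom c (n div 1)"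
    show thesis
    proof (rule that[of 0 0 1 1 c])
      show "c \<noteq> 0" using c \<open>\<phi> \<noteq> 0\<close> by auto
      show "subst2 (affine_map 0 1 0 1 0 0) ?Fbar = const2 c * Y2 ^ n"
        unfolding Fbar c div_by_1 const2.hform_monom
        by (simp add: subst2_mult subst2_power affine_map_def const2_hom)
    qed auto
  next
    fix e c assume c: "e \<noteq> 0" "c \<noteq> 0" "\<phi> = smult c ([:- e, 1:] ^ (n div 1))"
    show thesis
    proof (rule that[of e 0 1 1 c])
      show "c \<noteq> 0" by fact
      show "subst2 (affine_map e 1 0 1 0 0) ?Fbar = const2 c * Y2 ^ n"
        unfolding Fbar c div_by_1 const2.hform_linear_power
        by (simp add: subst2_mult subst2_power subst2_diff affine_map_def const2_hom)
    qed auto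
  qed (use g n \<phi> \<open>\<phi> \<noteq> 0\<close> Fbar in auto)
  let ?m = "affine_map a b 0 c d 0"
  have "wle 1 1 (int n - 1) (subst2 ?m (fst g - ?Fbar))"
    by (rule wle_subst2[OF wle_diff_wcomp[OF n(2)]]) (rule wle_affine_map)+
  then show ?thesis
    using that[of ?m e] m affine_map_in[OF m(1)] by (simp add: subst2_diff)
qed

text \<open>From P(h2) = x for the second component h2 of the inverse, the degree in y shows that h2
  depends on x only; then P composed with h2 has degree 1. This guarantees that the Newton polygon
  of a component of higher degree has a monomial involving x.\<close>

lemma GA2_fst_poly_in_y:
  assumes g: "g \<in> carrier GA2" and F: "fst g = poly_in_y P"
  shows "degree P = 1"
proof -
  obtain h where "subst2 h (fst g) = X2" using GA2_inverse_maps[OF g] by metis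
  then have X: "pcompose (poly_in_y P) (snd h) = X2"
    by (cases h) (simp add: F subst2_poly_in_y_eq_pcompose)
  then have "degree P * degree (snd h) = degree (X2 :: 'a poly poly)"
    by (metis degree_pcompose degree_poly_in_y)
  then have "degree P = 0 \<or> degree (snd h) = 0" by (simp add: X2_def)
  moreover have "degree P \<noteq> 0"
  proof
    assume "degree P = 0"
    then obtain c where "P = [:c:]" by (rule degree_eq_zeroE)
    then have "fst g = const2 c" by (simp add: F poly_in_y_pCons)
    with GA2_fst_nonconstant[OF g] show False by blast
  qed
  ultimately obtain q where "snd h = [:q:]" by (auto elim: degree_eq_zeroE)
  with X have "pcompose P q = [:0, 1:]" by (simp add: pcompose_poly_in_y_const X2_def)
  then have "degree P * degree q = 1" by (metis degree_pcompose degree_pCons_eq_if one_neq_zero pCons_eq_0_iff degree_0 One_nat_def)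
  then show ?thesis by simp
qed

text \<open>The edge of the Newton polygon starting at y^n contains another monomial, so the form
  along it is neither a constant times a power of y nor, since y^n occurs, a pure power of x^a. It
  is therefore a power of x^a - e y^b with a or b equal to 1, and the slope forces a = 1. The shear
  x -> x + e y^b turns it into a power of x.\<close>

lemma reduce_degree:
  assumes g: "g \<in> carrier GA2" and n: "n \<ge> 2" and c: "c \<noteq> 0"
    and R: "wle 1 1 (int n - 1) (fst g - const2 c * Y2 ^ n)"
  obtains m where "m \<in> elementary_maps" "wle 1 1 (int n - 1) (subst2 m (fst g))"
proof -
  let ?F = "fst g"
  have coeff_R: "coeff (coeff (?F - const2 c * Y2 ^ n) j) i =
      (if (i, j) = (0, n) then coeff (coeff ?F n) 0 - c else coeff (coeff ?F j) i)" for i j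
    by (auto simp: const2_def Y2_power coeff_pCons split: nat.splits)
  have c_eq: "coeff (coeff ?F n) 0 = c"
    using supp_wtD[OF R, of n 0] unfolding coeff_R by auto
  have less: "i + j < n" if "coeff (coeff ?F j) i \<noteq> 0" "(i, j) \<noteq> (0, n)" for i j
    using supp_wtD[OF R, of j i] that unfolding coeff_R by auto
  \<comment> \<open>The ratios (n - j) / i are the slopes from the vertex (0, n) to the monomials
    with i > 0; the least one belongs to the edge.\<close>
  define S where "S = (\<lambda>(i, j). (int n - int j, i)) ` {(i, j). coeff (coeff ?F j) i \<noteq> 0 \<and> i > 0}"
  have S_iff: "(z, i) \<in> S \<longleftrightarrow> (\<exists>j. z = int n - int j \<and> coeff (coeff ?F j) i \<noteq> 0 \<and> i > 0)" for z i
    by (auto simp: S_def)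
  have "S \<noteq> {}"
  proof
    assume "S = {}"
    then have 0: "coeff (coeff ?F j) i = 0" if "i > 0" for i j using that S_iff by blast
    define P where "P = map_poly (\<lambda>p. coeff p 0) ?F"
    have F: "?F = poly_in_y P"
      by (intro poly_eqI)
         (use 0 in \<open>auto simp: P_def coeff_poly_in_y coeff_map_poly coeff_pCons split: nat.splits\<close>)
    have "coeff P n \<noteq> 0" using c c_eq by (simp add: P_def coeff_map_poly)
    then have "n \<le> degree P" by (rule le_degree)
    then show False using GA2_fst_poly_in_y[OF g F] n by simp
  qed
  have "finite S"
    unfolding S_def by (intro finite_imageI finite_subset[OF _ finite_supp2[of ?F]]) auto
  obtain a' b' :: int where ab': "a' > 0" "coprime b' a'"
    and le': "\<And>z i. (z, i) \<in> S \<Longrightarrow> b' * int i \<le> a' * z"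
    and eq': "\<exists>z i. (z, i) \<in> S \<and> b' * int i = a' * z"
  proof (rule min_slope[OF \<open>finite S\<close> \<open>S \<noteq> {}\<close>])
    show "i > 0" if "(z, i) \<in> S" for z i using that by (auto simp: S_iff)
  qed auto
  obtain i0 j0 where ij0: "coeff (coeff ?F j0) i0 \<noteq> 0" "i0 > 0" "b' * int i0 = a' * (int n - int j0)"
  proof -
    obtain z i where zi: "(z, i) \<in> S" "b' * int i = a' * z" using eq' by blast
    then obtain j where "z = int n - int j" "coeff (coeff ?F j) i \<noteq> 0" "i > 0" unfolding S_iff by blast
    then show ?thesis using that zi(2) by blast
  qed
  \<comment> \<open>The monomials other than y^n have total degree below n, so the edge is steeper
    than the diagonal.\<close>
  have "a' * int i0 < b' * int i0"
    using less[OF ij0(1)] ij0(2) ab'(1) unfolding ij0(3) by (intro mult_strict_left_mono) auto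
  then have "a' < b'" using ij0(2) by simp
  define a b where "a = nat a'" and "b = nat b'"
  have ab_int: "a' = int a" "b' = int b" using ab' \<open>a' < b'\<close> by (auto simp: a_def b_def)
  have ab: "a > 0" "a < b" "coprime a b"
    using ab' \<open>a' < b'\<close> by (auto simp: ab_int coprime_commute)
  have le: "b * i + a * j \<le> a * n" if "coeff (coeff ?F j) i \<noteq> 0" for i j
  proof (cases "i > 0")
    case True
    then have "int b * int i \<le> int a * (int n - int j)"
      using le' S_iff that by (metis ab_int)
    then have "int (b * i + a * j) \<le> int (a * n)" by (simp add: algebra_simps)
    then show ?thesis by (simp only: of_nat_le_iff)
  next
    case False
    then show ?thesis using less[OF that] by (cases "j = n") auto
  qed
  have wle: "wle (int b) (int a) (int (a * n)) ?F"
    unfolding supp_wt_def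
  proof (intro allI impI)
    fix i j assume "coeff (coeff ?F j) i \<noteq> 0"
    then have "int (b * i + a * j) \<le> int (a * n)" using le by (simp only: of_nat_le_iff)
    then show "int b * int i + int a * int j \<in> {..int (a * n)}" by simp
  qed
  let ?Fbar = "wcomp (int b) (int a) (int (a * n)) ?F" and ?k = "n div b"
  obtain \<phi> where \<phi>: "degree \<phi> \<le> ?k" "?Fbar = Y2 ^ (n mod b) * hform const2 ?k \<phi> (X2 ^ a) (Y2 ^ b)"
    "\<And>l. l \<le> ?k \<Longrightarrow> coeff \<phi> l = coeff (coeff ?Fbar (n - b * l)) (a * l)"
    using whom_eq_hform[OF ab(1) order.strict_trans[OF ab(1,2)] ab(3) whom_wcomp[of "int b" "int a" "int (a * n)" ?F]] by blast
  have coeff_Fbar: "coeff (coeff ?Fbar j0) i0 \<noteq> 0" "coeff (coeff ?Fbar n) 0 = c"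
    using ij0 c_eq by (auto simp: coeff_wcomp ab_int algebra_simps)
  have "\<phi> \<noteq> 0" using coeff_Fbar(1) \<phi>(2) by auto
  have not_const: "\<phi> \<noteq> [:e:]" for e
  proof
    assume e: "\<phi> = [:e:]"
    have "?Fbar = Y2 ^ (n mod b) * (const2 e * (Y2 ^ b) ^ ?k)"
      unfolding \<phi>(2) by (simp only: e const2.hform_const)
    also have "\<dots> = const2 e * Y2 ^ (n mod b + b * ?k)"
      by (simp only: power_add power_mult mult.left_commute)
    finally have "?Fbar = const2 e * Y2 ^ n" by simp
    then have "coeff (coeff ?Fbar j0) i0 = 0"
      using ij0(2) by (auto simp: Y2_power const2_def coeff_pCons split: nat.splits)
    with coeff_Fbar show False by simp
  qed
  have k: "?k > 0"
  proof (rule ccontr)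
    assume "\<not> ?k > 0"
    then have "degree \<phi> = 0" using \<phi>(1) by simp
    then show False using not_const by (metis degree_eq_zeroE)
  qed
  obtain e d where ed: "\<phi> = smult d ([:- e, 1:] ^ ?k)" "n mod b = 0" "a = 1"
  proof (rule leading_form_cases[OF g ab(1) _ ab(3) wle k \<phi>(2,1) \<open>\<phi> \<noteq> 0\<close>])
    fix e assume "\<phi> = [:e:]"
    with not_const show thesis by blast
  next
    fix e assume "\<phi> = monom e ?k"
    moreover have "coeff \<phi> 0 = c" using \<phi>(3)[of 0] coeff_Fbar(2) by simp
    ultimately show thesis using k c by simp
  next
    fix e d assume "\<phi> = smult d ([:- e, 1:] ^ ?k)" "n mod b = 0" "a = 1 \<or> b = 1"
    then show thesis using that[of d e] ab by simp
  qed (use ab in auto)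
  have Fbar: "?Fbar = const2 d * (X2 - const2 e * Y2 ^ b) ^ ?k"
    unfolding \<phi>(2) unfolding ed const2.hform_linear_power by simp
  have bk: "n = b * ?k" using ed(2) by auto
  let ?m = "elementary_map 1 (monom e b) 1 0"
  have m: "?m = (X2 + const2 e * Y2 ^ b, Y2)"
  proof -
    have "poly_in_y (monom e b) = const2 e * Y2 ^ b"
      by (simp add: poly_in_y_def map_poly_monom const2_def Y2_power smult_monom)
    then show ?thesis by (simp add: elementary_map_def const2_hom)
  qed
  have wle_m: "wle (int b) 1 (int b) (fst ?m)" "wle (int b) 1 1 (snd ?m)"
  proof -
    have "const2 e * Y2 ^ b = monom [:e:] b" by (simp add: const2_def Y2_power smult_monom)
    then show "wle (int b) 1 (int b) (fst ?m)" "wle (int b) 1 1 (snd ?m)"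
      unfolding m by (auto simp: supp_wt_def X2_def Y2_def coeff_pCons split: nat.splits if_splits)
  qed
  have "subst2 ?m ?Fbar = const2 d * X2 ^ ?k"
    unfolding Fbar by (simp add: m subst2_mult subst2_power subst2_diff)
  moreover have "wle (int b) 1 (int n - 1) (subst2 ?m (?F - ?Fbar))"
    using wle_diff_wcomp[OF wle] wle_subst2[OF _ wle_m] by (simp add: ed)
  ultimately have "wle (int b) 1 (int n - 1) (subst2 ?m ?F - const2 d * X2 ^ ?k)"
    by (simp add: subst2_diff)
  \<comment> \<open>The weight with x counted \<open>b\<close> times dominates the total degree, so
    the bound carries over; the remaining power of x has exponent n / b \<le> n / 2.\<close>
  then have "wle 1 1 (int n - 1) (subst2 ?m ?F - const2 d * X2 ^ ?k)"
    unfolding supp_wt_def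
  proof (elim all_forward imp_forward)
    fix i j assume "int b * int i + 1 * int j \<in> {..int n - 1}"
    moreover have "int i \<le> int b * int i" using ab by (simp add: mult_le_cancel_right1)
    ultimately show "1 * int i + 1 * int j \<in> {..int n - 1}" by simp
  qed
  moreover have "wle 1 1 (int n - 1) (const2 d * X2 ^ ?k)"
  proof -
    have "?k + 1 \<le> 2 * ?k" "2 * ?k \<le> b * ?k" using k ab by auto
    then have "?k \<le> n - 1" using bk by linarith
    then show ?thesis
      using n by (auto simp: supp_wt_def const2_def X2_power coeff_pCons split: nat.splits if_splits)
  qed
  ultimately have "wle 1 1 (int n - 1) (subst2 ?m ?F - const2 d * X2 ^ ?k + const2 d * X2 ^ ?k)"
    by (rule supp_wt_add)
  then show ?thesis
    using that[of ?m] elementary_map_in[of 1 1 "monom e b" 0] by simp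
qed

text \<open>The induction follows a degree bound of the first component alone: once that is linear,
  the second component is determined up to tame maps. A bound that is not attained is lowered at
  once.\<close>

theorem GA2_subset_tame: "carrier GA2 \<subseteq> tame"
proof
  fix g :: "'a plane_map"
  assume "g \<in> carrier GA2"
  moreover have "\<exists>n. wle 1 1 (int n) (fst g)"
  proof -
    let ?S = "(\<lambda>(i, j). i + j) ` {(i, j). coeff (coeff (fst g) j) i \<noteq> 0}"
    have fin: "finite ?S" by (rule finite_imageI[OF finite_supp2])
    have "i + j \<le> Max ?S" if "coeff (coeff (fst g) j) i \<noteq> 0" for i j
      using that by (intro Max_ge[OF fin]) auto
    then have "wle 1 1 (int (Max ?S)) (fst g)" by (force simp: supp_wt_def)
    then show ?thesis by blast
  qed
  then obtain n where "wle 1 1 (int n) (fst g)" by blast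
  ultimately show "g \<in> tame"
  proof (induction n arbitrary: g)
    case 0
    then show ?case by (intro tame_if_fst_linear) (auto elim: supp_wt_mono)
  next
    case (Suc n)
    show ?case
    proof (cases "n = 0")
      case True
      then show ?thesis using Suc.prems by (intro tame_if_fst_linear) auto
    next
      case False
      show ?thesis
      proof (cases "wcomp 1 1 (int (Suc n)) (fst g) = 0")
        case True
        then show ?thesis
          using wle_diff_wcomp[OF Suc.prems(2)] by (intro Suc.IH Suc.prems(1)) simp
      next
        case nz: False
        obtain m1 c where m1: "m1 \<in> affine_maps" "c \<noteq> 0"
          "wle 1 1 (int (Suc n) - 1) (subst2 m1 (fst g) - const2 c * Y2 ^ Suc n)"
          using normalize_leading_form[OF Suc.prems(1) _ Suc.prems(2) nz] by blast
        let ?g1 = "g \<otimes>\<^bsub>GA2\<^esub> m1"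
        have m1_tame: "m1 \<in> tame" using m1(1) by (auto intro: generate.incl)
        then have g1: "?g1 \<in> carrier GA2" by (intro GA2.m_closed Suc.prems(1) tame_in_GA2)
        obtain m2 where m2: "m2 \<in> elementary_maps" "wle 1 1 (int (Suc n) - 1) (subst2 m2 (fst ?g1))"
          by (rule reduce_degree[OF g1 _ m1(2), of "Suc n"]) (use False m1(3) in \<open>auto simp: GA2_mult\<close>)
        have m2_tame: "m2 \<in> tame" using m2(1) by (auto intro: generate.incl)
        have "?g1 \<otimes>\<^bsub>GA2\<^esub> m2 \<in> tame"
        proof (rule Suc.IH)
          show "?g1 \<otimes>\<^bsub>GA2\<^esub> m2 \<in> carrier GA2"
            by (intro GA2.m_closed g1 tame_in_GA2 m2_tame)
          show "wle 1 1 (int n) (fst (?g1 \<otimes>\<^bsub>GA2\<^esub> m2))"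
            using m2(2) by (simp add: GA2_mult[of ?g1])
        qed
        then have "?g1 \<in> tame" by (rule tame_cancel[OF g1 m2_tame])
        then show ?thesis by (rule tame_cancel[OF Suc.prems(1) m1_tame])
      qed
    qed
  qed
qed

section \<open>Alternating words and axes\<close>

lemma (in group) inv_cancel_left [simp]:
  assumes "x \<in> carrier G" "y \<in> carrier G"
  shows "inv x \<otimes> (x \<otimes> y) = y" "x \<otimes> (inv x \<otimes> y) = y"
  using assms by (simp_all flip: m_assoc)

locale two_subgroups = group G for G (structure) +
  fixes A E :: "'a set"
  assumes A: "subgroup A G" and E: "subgroup E G"
begin

definition factor :: "int \<Rightarrow> 'a set" where
  "factor i = (if even i then A else E)"

definition letters :: "int \<Rightarrow> 'a set" where
  "letters i = factor i - A \<inter> E"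

text \<open>\<open>words n i\<close> consists of the products of \<open>n\<close> letters at the positions \<open>i, \<dots>, i + n - 1\<close>,
  multiplied on the right by the amalgamated subgroup; the type of a letter is the parity of
  its position.\<close>

primrec words :: "nat \<Rightarrow> int \<Rightarrow> 'a set" where
  "words 0 i = A \<inter> E"
| "words (Suc n) i = {x \<otimes> y | x y. x \<in> letters i \<and> y \<in> words n (i + 1)}"

lemma subgroup_factor: "subgroup (factor i) G"
  using A E by (simp add: factor_def)

lemma subgroup_Int: "subgroup (A \<inter> E) G"
  by (rule subgroups_Inter_pair[OF A E])

lemma Int_subset_factor: "x \<in> A \<inter> E \<Longrightarrow> x \<in> factor i"
  by (auto simp: factor_def)

lemma letters_carrier: "x \<in> letters i \<Longrightarrow> x \<in> carrier G"
  using subgroup.mem_carrier[OF subgroup_factor] by (auto simp: letters_def)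

lemma Int_carrier: "x \<in> A \<inter> E \<Longrightarrow> x \<in> carrier G"
  using subgroup.mem_carrier[OF subgroup_Int] by auto

lemma words_carrier: "x \<in> words n i \<Longrightarrow> x \<in> carrier G"
  by (induction n arbitrary: x i) (auto simp: letters_carrier intro: Int_carrier)

lemma letters_parity: "even (i - j) \<Longrightarrow> letters i = letters j"
  by (auto simp: letters_def factor_def)

lemma words_parity: "even (i - j) \<Longrightarrow> words n i = words n j"
proof (induction n arbitrary: i j)
  case (Suc n)
  have "words n (i + 1) = words n (j + 1)" using Suc.prems by (intro Suc.IH) simp
  then show ?case using letters_parity[OF Suc.prems] by simp
qed simp

lemma Int_mult_letters:
  assumes b: "b \<in> A \<inter> E" and x: "x \<in> letters i"
  shows "b \<otimes> x \<in> letters i" "x \<otimes> b \<in> letters i"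
proof -
  note c = Int_carrier[OF b] letters_carrier[OF x]
  have f: "b \<otimes> x \<in> factor i" "x \<otimes> b \<in> factor i"
    using x subgroup.m_closed[OF subgroup_factor] Int_subset_factor[OF b]
    by (auto simp: letters_def)
  have "x \<in> A \<inter> E" if "b \<otimes> x \<in> A \<inter> E"
    using subgroup.m_closed[OF subgroup_Int subgroup.m_inv_closed[OF subgroup_Int b] that] c by simp
  moreover have "x \<in> A \<inter> E" if "x \<otimes> b \<in> A \<inter> E"
    using subgroup.m_closed[OF subgroup_Int that subgroup.m_inv_closed[OF subgroup_Int b]] c
    by (simp add: m_assoc)
  ultimately show "b \<otimes> x \<in> letters i" "x \<otimes> b \<in> letters i"
    using f x unfolding letters_def by blast+
qed

lemma letters_inv: "x \<in> letters i \<Longrightarrow> inv x \<in> letters i"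
  using subgroup.m_inv_closed[OF subgroup_factor, of x i] subgroup.m_inv_closed[OF subgroup_Int, of "inv x"]
    letters_carrier[of x i]
  by (auto simp: letters_def)

lemma words_Int_mult: "b \<in> A \<inter> E \<Longrightarrow> x \<in> words n i \<Longrightarrow> b \<otimes> x \<in> words n i"
proof (cases n)
  case 0
  then show "b \<in> A \<inter> E \<Longrightarrow> x \<in> words n i \<Longrightarrow> ?thesis"
    using subgroup.m_closed[OF subgroup_Int] by simp
next
  case (Suc m)
  assume b: "b \<in> A \<inter> E" and "x \<in> words n i"
  then obtain u y where uy: "x = u \<otimes> y" "u \<in> letters i" "y \<in> words m (i + 1)" using Suc by auto
  have "b \<otimes> x = (b \<otimes> u) \<otimes> y"
    using uy Int_carrier[OF b] letters_carrier words_carrier by (simp add: m_assoc)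
  then show ?thesis using Suc uy Int_mult_letters(1)[OF b uy(2)] by auto
qed

lemma words_mult: "x \<in> words n i \<Longrightarrow> y \<in> words m (i + int n) \<Longrightarrow> x \<otimes> y \<in> words (n + m) i"
proof (induction n arbitrary: x i)
  case 0
  then show ?case using words_Int_mult by simp
next
  case (Suc n)
  then obtain u z where uz: "x = u \<otimes> z" "u \<in> letters i" "z \<in> words n (i + 1)" by auto
  have "x \<otimes> y = u \<otimes> (z \<otimes> y)"
    using uz letters_carrier words_carrier words_carrier[OF Suc.prems(2)] by (simp add: m_assoc)
  moreover have "z \<otimes> y \<in> words (n + m) (i + 1)"
    using Suc.IH[OF uz(3)] Suc.prems(2) by (simp add: algebra_simps)
  ultimately show ?case using uz(2) by auto
qed

lemma letters_subset_words: "x \<in> letters i \<Longrightarrow> x \<in> words 1 i"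
  using subgroup.one_closed[OF subgroup_Int] letters_carrier[of x i]
  by (simp, intro exI[of _ x] exI[of _ \<one>]) simp

lemma words_1: "words (Suc 0) i = letters i"
  using letters_subset_words[of _ i] Int_mult_letters(2)[of _ _ i] by auto

text \<open>Negating positions preserves parity, so the inverse of a letter at position p fits at
  position -p; the last position i + n - 1 becomes the first one.\<close>

lemma words_inv: "x \<in> words n i \<Longrightarrow> inv x \<in> words n (1 - i - int n)"
proof (induction n arbitrary: x i)
  case 0
  then show ?case using subgroup.m_inv_closed[OF subgroup_Int] by simp
next
  case (Suc n)
  then obtain u z where uz: "x = u \<otimes> z" "u \<in> letters i" "z \<in> words n (i + 1)" by auto
  have "inv x = inv z \<otimes> inv u"
    using uz letters_carrier words_carrier by (simp add: inv_mult_group)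
  have "words 1 i = words 1 (- i)" by (rule words_parity) simp
  then have "inv u \<in> words 1 (1 - (i + 1) - int n + int n)"
    using letters_subset_words[OF letters_inv[OF uz(2)]] by (simp del: words.simps)
  then have "inv z \<otimes> inv u \<in> words (n + 1) (1 - (i + 1) - int n)"
    by (rule words_mult[OF Suc.IH[OF uz(3)]])
  moreover have "1 - (i + 1) - int n = 1 - i - int (Suc n)" by simp
  ultimately show ?case using \<open>inv x = _\<close> by (simp del: words.simps)
qed

lemma words_last_mult:
  assumes "x \<in> words n i" "u \<in> letters (i + int n)"
  shows "x \<otimes> u \<in> words (Suc n) i"
  using words_mult[OF assms(1) letters_subset_words[OF assms(2)]] by simp

end

text \<open>By the normal form theorem the two conditions say that the group is the amalgamated
  product of \<open>A\<close> and \<open>E\<close> over their intersection.\<close>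

locale alternating_amalgam = two_subgroups +
  assumes words_disjoint: "n > 0 \<Longrightarrow> words n i \<inter> (A \<inter> E) = {}"
    and generated: "carrier G \<subseteq> generate G (A \<union> E)"
begin

text \<open>Two expressions are compared at their first letters. Letters of different type make the
  inverse of one expression followed by the other a reduced word for 1. For letters u, v of the same
  type, u^-1 v either lies in the intersection, so that both expressions shorten, or acts as a
  letter and again yields a reduced word for 1.\<close>

lemma words_unique: "x \<in> words n i \<Longrightarrow> x \<in> words m j \<Longrightarrow> n = m"
proof (induction "n + m" arbitrary: n m i j x rule: less_induct)
  case less
  note c = words_carrier[OF less.prems(1)]
  have one: "\<one> \<in> A \<inter> E" by (rule subgroup.one_closed[OF subgroup_Int])
  show ?case
  proof (cases "n = 0 \<or> m = 0")
    case True
    then have "x \<in> A \<inter> E" using less.prems by auto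
    then have "n = 0" "m = 0" using less.prems words_disjoint[of n i] words_disjoint[of m j] by blast+
    then show ?thesis by simp
  next
    case False
    then obtain n' m' where nm: "n = Suc n'" "m = Suc m'" by (metis not0_implies_Suc)
    obtain u y where uy: "x = u \<otimes> y" "u \<in> letters i" "y \<in> words n' (i + 1)"
      using less.prems(1) nm by auto
    obtain v z where vz: "x = v \<otimes> z" "v \<in> letters j" "z \<in> words m' (j + 1)"
      using less.prems(2) nm by auto
    note carr = letters_carrier[OF uy(2)] words_carrier[OF uy(3)] letters_carrier[OF vz(2)] words_carrier[OF vz(3)]
    show ?thesis
    proof (cases "even (i - j)")
      case True
      have y: "y = (inv u \<otimes> v) \<otimes> z"
        using carr uy(1) vz(1) by (metis inv_cancel_left(1) inv_closed m_assoc)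
      have fac: "inv u \<otimes> v \<in> factor i"
        using subgroup.m_closed[OF subgroup_factor] letters_inv[OF uy(2)] vz(2) letters_parity[OF True]
        by (auto simp: letters_def)
      show ?thesis
      proof (cases "inv u \<otimes> v \<in> A \<inter> E")
        case True
        then have "y \<in> words m' (j + 1)" using y words_Int_mult[OF _ vz(3)] by simp
        then have "n' = m'" using less.hyps[of n' m' y] uy(3) nm by simp
        then show ?thesis by (simp add: nm)
      next
        case False
        then have uv: "inv u \<otimes> v \<in> letters i" using fac by (simp add: letters_def)
        have "inv y \<in> words n' (- i - int n')" using words_inv[OF uy(3)] by simp
        moreover have "inv u \<otimes> v \<in> letters (- i - int n' + int n')"
          using uv letters_parity[of i "- i"] by simp
        ultimately have "inv y \<otimes> (inv u \<otimes> v) \<in> words (Suc n') (- i - int n')"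
          by (rule words_last_mult)
        moreover have "z \<in> words m' (- i - int n' + int (Suc n'))"
          using vz(3) words_parity[of "j + 1" "- i + 1" m'] True \<open>even (i - j)\<close> by simp
        ultimately have "inv y \<otimes> (inv u \<otimes> v) \<otimes> z \<in> words (Suc n' + m') (- i - int n')"
          by (rule words_mult)
        moreover have "inv y \<otimes> (inv u \<otimes> v) \<otimes> z = \<one>"
          using y carr by (metis inv_closed l_inv m_assoc m_closed)
        ultimately have "\<one> \<in> words (Suc n' + m') (- i - int n')" by metis
        then show ?thesis using words_disjoint[of "Suc n' + m'" "- i - int n'"] one by blast
      qed
    next
      case False
      have "x \<in> words m (1 - i - int n + int n)"
        using less.prems(2) words_parity[of j "1 - i" m] False by simp
      from words_mult[OF words_inv[OF less.prems(1)] this]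
      have "\<one> \<in> words (n + m) (1 - i - int n)" using c by simp
      moreover have "n + m > 0" using nm by simp
      ultimately show ?thesis using words_disjoint[of "n + m" "1 - i - int n"] one by blast
    qed
  qed
qed

lemma factor_mult_words:
  assumes "x \<in> A \<union> E" "y \<in> words n i"
  shows "\<exists>m j. x \<otimes> y \<in> words m j"
proof (cases "x \<in> A \<inter> E")
  case True
  then show ?thesis using words_Int_mult assms(2) by blast
next
  case False
  then obtain j where x: "x \<in> letters j"
    using assms(1) by (cases "x \<in> A") (auto simp: letters_def factor_def intro: that[of 0] that[of 1])
  show ?thesis
  proof (cases "n = 0 \<or> odd (i - j)")
    case True
    then have "y \<in> words n (j + 1)"
      using assms(2) words_parity[of i "j + 1" n] by auto
    with x have "x \<otimes> y \<in> words (Suc n) j" by auto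
    then show ?thesis by blast
  next
    case False
    then obtain n' u z where n': "n = Suc n'" "y = u \<otimes> z" "u \<in> letters i" "z \<in> words n' (i + 1)"
      using assms(2) by (cases n) auto
    have fac: "x \<otimes> u \<in> factor i"
      using subgroup.m_closed[OF subgroup_factor] x letters_parity[of i j] False n'(3)
      by (auto simp: letters_def)
    have eq: "x \<otimes> y = (x \<otimes> u) \<otimes> z"
      using n' letters_carrier words_carrier x by (simp add: m_assoc)
    show ?thesis
    proof (cases "x \<otimes> u \<in> A \<inter> E")
      case True
      then show ?thesis using eq words_Int_mult[OF _ n'(4)] by auto
    next
      case False
      then have "x \<otimes> u \<in> letters i" using fac by (simp add: letters_def)
      then have "x \<otimes> y \<in> words (Suc n') i" using eq n'(4) by auto
      then show ?thesis by blast
    qed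
  qed
qed

lemma exists_words:
  assumes "x \<in> carrier G"
  shows "\<exists>n i. x \<in> words n i"
proof -
  have mult: "\<exists>m j. x \<otimes> y \<in> words m j" if "x \<in> words n i" "y \<in> words k l" for x y n i k l
    using that
  proof (induction n arbitrary: x i)
    case 0
    then have "x \<in> A \<inter> E" by simp
    then show ?case using words_Int_mult 0 by blast
  next
    case (Suc n)
    then obtain u z where uz: "x = u \<otimes> z" "u \<in> letters i" "z \<in> words n (i + 1)" by auto
    obtain m j where "z \<otimes> y \<in> words m j" using Suc.IH[OF uz(3) Suc.prems(2)] by blast
    moreover have "u \<in> A \<union> E" using uz(2) by (auto simp: letters_def factor_def split: if_splits)
    ultimately have "\<exists>m j. u \<otimes> (z \<otimes> y) \<in> words m j" by (intro factor_mult_words)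
    then show ?case
      using uz letters_carrier words_carrier words_carrier[OF Suc.prems(2)] by (simp add: m_assoc)
  qed
  have gen: "\<exists>n i. x \<in> words n i" if "x \<in> A \<union> E" for x
  proof -
    have "\<one> \<in> words 0 0" using subgroup.one_closed[OF subgroup_Int] by simp
    moreover have "x \<otimes> \<one> = x"
      using subgroup.mem_carrier[OF A] subgroup.mem_carrier[OF E] that by auto
    ultimately show ?thesis using factor_mult_words[OF that] by metis
  qed
  have "x \<in> generate G (A \<union> E)" using assms generated by blast
  then show ?thesis
  proof (induction rule: generate.induct)
    case one
    have "\<one> \<in> words 0 0" using subgroup.one_closed[OF subgroup_Int] by simp
    then show ?case by blast
  next
    case (incl h)
    then show ?case by (rule gen)
  next
    case (inv h)
    then show ?case using gen words_inv by blast
  next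
    case (eng h1 h2)
    then show ?case using mult by blast
  qed
qed

text \<open>The prefixes of a reduced expression: the edges on the geodesic from the base edge to
  that of \<open>x\<close>.\<close>

lemma words_path:
  assumes "n > 0" "x \<in> words n i"
  obtains p where "p 0 = \<one>" "p n = x" "\<And>k. p k \<in> carrier G"
    "\<And>k. k < n \<Longrightarrow> inv (p k) \<otimes> p (Suc k) \<in> letters (i + int k)"
proof -
  have "\<exists>p. p 0 = \<one> \<and> p n = x \<and> (\<forall>k. p k \<in> carrier G) \<and>
      (\<forall>k<n. inv (p k) \<otimes> p (Suc k) \<in> letters (i + int k))"
    using assms
  proof (induction n arbitrary: x i)
    case (Suc n)
    show ?case
    proof (cases "n = 0")
      case True
      then have "x \<in> letters i" using Suc.prems(2) unfolding True words_1 by simp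
      then show ?thesis
        using letters_carrier[of x i] True
        by (intro exI[of _ "\<lambda>k. if k = 0 then \<one> else x"]) auto
    next
      case False
      obtain u y where uy: "x = u \<otimes> y" "u \<in> letters i" "y \<in> words n (i + 1)"
        using Suc.prems(2) by auto
      obtain q where q: "q 0 = \<one>" "q n = y" "\<And>k. q k \<in> carrier G"
        "\<And>k. k < n \<Longrightarrow> inv (q k) \<otimes> q (Suc k) \<in> letters (i + 1 + int k)"
        using Suc.IH[OF _ uy(3)] False by blast
      define p where "p k = (case k of 0 \<Rightarrow> \<one> | Suc k' \<Rightarrow> u \<otimes> q k')" for k
      have u: "u \<in> carrier G" using uy(2) letters_carrier by blast
      have "inv (p k) \<otimes> p (Suc k) \<in> letters (i + int k)" if "k < Suc n" for k
      proof (cases k)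
        case 0
        then show ?thesis using q(1) u uy(2) by (simp add: p_def)
      next
        case (Suc k')
        have "inv (p k) \<otimes> p (Suc k) = inv (q k') \<otimes> q (Suc k')"
          using q(3) u by (simp add: p_def Suc inv_mult_group m_assoc)
        then show ?thesis using q(4)[of k'] that Suc by (simp add: algebra_simps)
      qed
      moreover have "p 0 = \<one>" "p (Suc n) = x" "p k \<in> carrier G" for k
        using q u uy(1) by (auto simp: p_def split: nat.splits)
      ultimately show ?thesis by blast
    qed
  qed simp
  then show ?thesis using that by blast
qed

end

text \<open>The edges of the Bass--Serre tree of the amalgam are the left cosets of \<open>A \<inter> E\<close>; the cosets
  of the elements \<open>w i\<close> are the edges on the axis of the hyperbolic element \<open>f\<close>.\<close>

locale amalgam_axis = alternating_amalgam +
  fixes f :: 'a and w :: "int \<Rightarrow> 'a" and N :: nat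
  assumes N: "N > 0" "even N" and f_carrier: "f \<in> carrier G" and w_carrier: "w i \<in> carrier G"
    and step: "inv (w i) \<otimes> w (i + 1) \<in> letters i"
    and translation: "f \<otimes> w i = w (i + int N)"
begin

lemma words_axis: "inv (w i) \<otimes> w (i + int n) \<in> words n i"
proof (induction n)
  case 0
  then show ?case using w_carrier subgroup.one_closed[OF subgroup_Int] by simp
next
  case (Suc n)
  have "(inv (w i) \<otimes> w (i + int n)) \<otimes> (inv (w (i + int n)) \<otimes> w (i + int n + 1)) \<in> words (Suc n) i"
    by (rule words_last_mult[OF Suc step])
  then show ?case using w_carrier by (simp add: m_assoc algebra_simps)
qed

lemma inv_f_translation: "inv f \<otimes> w i = w (i - int N)"
  using translation[of "i - int N"] f_carrier w_carrier inv_cancel_left(1)[of f "w (i - int N)"] by simp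

text \<open>The axis is geodesic: the distance of two of its edges is the difference of their
  indices.\<close>

lemma words_axis_dist: "\<exists>a. inv (w i) \<otimes> w j \<in> words (nat \<bar>i - j\<bar>) a"
proof (cases "i \<le> j")
  case True
  then show ?thesis using words_axis[of i "nat (j - i)"] by auto
next
  case False
  then have "inv (w j) \<otimes> w i \<in> words (nat \<bar>i - j\<bar>) j" using words_axis[of j "nat (i - j)"] by auto
  from words_inv[OF this] show ?thesis using w_carrier by (auto simp: inv_mult_group)
qed

text \<open>The square of \<open>f\<close> translates the axis by 2 N > 0 edges.\<close>

lemma f_square_nontrivial: "f \<otimes> f \<noteq> \<one>"
proof
  assume ff: "f \<otimes> f = \<one>"
  have "f \<otimes> (f \<otimes> w 0) = w (int (N + N))" using translation by (simp add: algebra_simps)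
  moreover have "f \<otimes> (f \<otimes> w 0) = w 0" using ff f_carrier w_carrier by (simp flip: m_assoc)
  ultimately have "inv (w 0) \<otimes> w (int (N + N)) = \<one>" using w_carrier by simp
  then show False
    using words_axis[of 0 "N + N"] words_disjoint[of "N + N" 0] N subgroup.one_closed[OF subgroup_Int]
    by auto
qed

text \<open>If \<open>g\<close> is not on the axis, then a reduced expression of \<open>g\<^sup>-\<^sup>1 f g\<close> has odd length:
  it travels to the axis, along the axis, and back, and one letter is shared.\<close>

lemma on_axis:
  assumes g: "g \<in> carrier G" and len: "inv g \<otimes> f \<otimes> g \<in> words n j" "even n"
  obtains i where "inv (w i) \<otimes> g \<in> A \<inter> E"
proof -
  \<comment> \<open>\<open>P l\<close> says that some edge of the axis has distance \<open>l\<close>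
    from \<open>g\<close>; the least such \<open>l\<close> is the distance to the axis.\<close>
  define P where "P l \<longleftrightarrow> (\<exists>i a. inv (w i) \<otimes> g \<in> words l a)" for l
  have "\<exists>l. P l" using exists_words[of "inv (w 0) \<otimes> g"] g w_carrier by (auto simp: P_def)
  define l where "l = (LEAST l. P l)"
  have "P l" unfolding l_def using \<open>\<exists>l. P l\<close> by (rule LeastI_ex)
  then obtain i a where ia: "inv (w i) \<otimes> g \<in> words l a" by (auto simp: P_def)
  have minimal: "\<not> P k" if "k < l" for k using that not_less_Least unfolding l_def by blast
  show ?thesis
  proof (cases l)
    case 0
    then show ?thesis using ia that by simp
  next
    case (Suc k)
    define u where "u = inv (w i) \<otimes> g"
    have u: "u \<in> carrier G" using g w_carrier by (simp add: u_def)
    obtain x y where xy: "u = x \<otimes> y" "x \<in> letters a" "y \<in> words k (a + 1)"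
      using ia Suc by (auto simp: u_def)
    note carr = letters_carrier[OF xy(2)] words_carrier[OF xy(3)] u w_carrier f_carrier g
    have g_eq: "g = w i \<otimes> u" using carr by (simp add: u_def)
    have wN: "f \<otimes> (w i \<otimes> z) = w (i + int N) \<otimes> z" if "z \<in> carrier G" for z
      using translation[of i] that carr by (simp flip: m_assoc)
    have conj: "inv g \<otimes> f \<otimes> g = inv u \<otimes> (inv (w i) \<otimes> (w (i + int N) \<otimes> u))"
      using carr by (simp add: g_eq inv_mult_group m_assoc wN)
    \<comment> \<open>The path to \<open>g\<close> leaves the edge \<open>w i\<close> through the
      vertex shared with \<open>w (i + 1)\<close> or through the one shared with
      \<open>w (i - 1)\<close>, according to the parity of \<open>a - i\<close>. Its first letter
      merges with the first or with the last of the \<open>N\<close> letters along the axis, so two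
      trips of length k + 1 and N letters lose one letter.\<close>
    have "\<exists>b. inv g \<otimes> f \<otimes> g \<in> words (2 * k + N + 1) b"
    proof (cases "even (a - i)")
      case True
      define c where "c = inv (w i) \<otimes> w (i + 1)"
      have c: "c \<in> letters a" "c \<in> carrier G"
        using step[of i] letters_parity[OF True] letters_carrier by (auto simp: c_def)
      have u_in: "u \<in> words (Suc k) (i + int N)"
        using ia Suc words_parity[of a "i + int N" "Suc k"] True N by (simp add: u_def del: words.simps)
      have fac: "inv c \<otimes> x \<in> factor a"
        using subgroup.m_closed[OF subgroup_factor] letters_inv[OF c(1)] xy(2) by (auto simp: letters_def)
      \<comment> \<open>Otherwise \<open>w (i + 1)\<close> would be closer to \<open>g\<close> than
        \<open>w i\<close>.\<close>
      have not: "inv c \<otimes> x \<notin> A \<inter> E"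
      proof
        assume "inv c \<otimes> x \<in> A \<inter> E"
        then have "(inv c \<otimes> x) \<otimes> y \<in> words k (a + 1)" using words_Int_mult xy(3) by blast
        moreover have "(inv c \<otimes> x) \<otimes> y = inv (w (i + 1)) \<otimes> g"
          using carr by (simp add: c_def m_assoc inv_mult_group g_eq flip: xy(1))
        ultimately have "P k" unfolding P_def by metis
        with minimal Suc show False by simp
      qed
      then have "inv (inv c \<otimes> x) \<in> letters a" using fac by (intro letters_inv) (simp add: letters_def)
      then have "inv x \<otimes> c \<in> letters a" using c carr by (simp add: inv_mult_group)
      then have xc: "inv x \<otimes> c \<in> letters (- a - int k + int k)"
        using letters_parity[of a "- a"] by simp
      have "inv y \<in> words k (- a - int k)" using words_inv[OF xy(3)] by simp
      then have 1: "inv y \<otimes> (inv x \<otimes> c) \<in> words (Suc k) (- a - int k)"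
        using xc by (rule words_last_mult)
      have "inv (w (i + 1)) \<otimes> w (i + 1 + int (N - 1)) \<in> words (N - 1) (i + 1)"
        by (rule words_axis)
      then have "inv (w (i + 1)) \<otimes> w (i + int N) \<in> words (N - 1) (i + 1)"
        using N by (simp add: of_nat_diff)
      from words_mult[OF this, of u "Suc k"] u_in
      have "(inv (w (i + 1)) \<otimes> w (i + int N)) \<otimes> u \<in> words (N - 1 + Suc k) (i + 1)"
        using N by (simp add: of_nat_diff)
      then have "(inv (w (i + 1)) \<otimes> w (i + int N)) \<otimes> u \<in> words (N - 1 + Suc k) (- a - int k + int (Suc k))"
        using words_parity[of "i + 1" "1 - a"] True by (simp del: words.simps add_Suc_right)
      from words_mult[OF 1 this]
      have "inv y \<otimes> (inv x \<otimes> c) \<otimes> ((inv (w (i + 1)) \<otimes> w (i + int N)) \<otimes> u)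
        \<in> words (Suc k + (N - 1 + Suc k)) (- a - int k)" .
      moreover have "inv y \<otimes> (inv x \<otimes> c) \<otimes> ((inv (w (i + 1)) \<otimes> w (i + int N)) \<otimes> u) = inv g \<otimes> f \<otimes> g"
        unfolding conj using carr c by (simp add: xy(1) inv_mult_group m_assoc) (simp add: c_def m_assoc)
      moreover have "Suc k + (N - 1 + Suc k) = 2 * k + N + 1" using N by simp
      ultimately show ?thesis by metis
    next
      case False
      define c where "c = inv (w (i - 1)) \<otimes> w i"
      have "c \<in> letters (i - 1)" using step[of "i - 1"] by (simp add: c_def)
      then have c: "c \<in> letters a" "c \<in> carrier G"
        using letters_parity[of a "i - 1"] False letters_carrier by auto
      have c_eq: "c = inv (w (i + int N - 1)) \<otimes> w (i + int N)"
      proof -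
        have "w (i + int N - 1) = f \<otimes> w (i - 1)" "w (i + int N) = f \<otimes> w i"
          using translation[of "i - 1"] translation[of i] by (simp_all add: algebra_simps)
        then show ?thesis using carr by (simp add: c_def inv_mult_group m_assoc)
      qed
      have fac: "c \<otimes> x \<in> factor a"
        using subgroup.m_closed[OF subgroup_factor] c(1) xy(2) by (auto simp: letters_def)
      have not: "c \<otimes> x \<notin> A \<inter> E"
      proof
        assume "c \<otimes> x \<in> A \<inter> E"
        then have "(c \<otimes> x) \<otimes> y \<in> words k (a + 1)" using words_Int_mult xy(3) by blast
        moreover have "(c \<otimes> x) \<otimes> y = inv (w (i - 1)) \<otimes> g"
          using carr by (simp add: c_def m_assoc g_eq flip: xy(1))
        ultimately have "P k" unfolding P_def by metis
        with minimal Suc show False by simp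
      qed
      then have cx: "c \<otimes> x \<in> letters a" using fac by (simp add: letters_def)
      have u_inv: "inv u \<in> words (Suc k) (- a - int k)"
        using words_inv[OF ia] by (simp add: u_def Suc algebra_simps)
      have "inv (w i) \<otimes> w (i + int (N - 1)) \<in> words (N - 1) i" by (rule words_axis)
      then have "inv (w i) \<otimes> w (i + int N - 1) \<in> words (N - 1) (- a - int k + int (Suc k))"
        using N words_parity[of i "1 - a"] False by (simp add: of_nat_diff algebra_simps)
      from words_mult[OF u_inv this]
      have 1: "inv u \<otimes> (inv (w i) \<otimes> w (i + int N - 1)) \<in> words (Suc k + (N - 1)) (- a - int k)" .
      have "c \<otimes> x \<in> letters (- a - int k + int (Suc k + (N - 1)))"
        using cx letters_parity[of a "- a - int k + int (Suc k + (N - 1))"] N by (simp add: of_nat_diff)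
      from words_last_mult[OF 1 this]
      have "inv u \<otimes> (inv (w i) \<otimes> w (i + int N - 1)) \<otimes> (c \<otimes> x) \<in> words (Suc (Suc k + (N - 1))) (- a - int k)" .
      moreover have "y \<in> words k (- a - int k + int (Suc (Suc k + (N - 1))))"
        using xy(3) words_parity[of "a + 1" "- a - int k + int (Suc (Suc k + (N - 1)))" k] N
        by (simp add: of_nat_diff)
      ultimately have "inv u \<otimes> (inv (w i) \<otimes> w (i + int N - 1)) \<otimes> (c \<otimes> x) \<otimes> y
          \<in> words (Suc (Suc k + (N - 1)) + k) (- a - int k)"
        by (rule words_mult)
      moreover have "inv u \<otimes> (inv (w i) \<otimes> w (i + int N - 1)) \<otimes> (c \<otimes> x) \<otimes> y = inv g \<otimes> f \<otimes> g"
        unfolding conj c_eq using carr by (simp add: xy(1) m_assoc)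
      moreover have "Suc (Suc k + (N - 1)) + k = 2 * k + N + 1" using N by simp
      ultimately show ?thesis by metis
    qed
    then obtain b where "inv g \<otimes> f \<otimes> g \<in> words (2 * k + N + 1) b" by blast
    from words_unique[OF len(1) this] len(2) N show ?thesis by simp
  qed
qed

text \<open>The inverse of \<open>r\<close> maps axis edges to axis edges, acting on the indices as
  an isometry \<open>\<sigma>\<close> of the integers that reverses the translation by
  \<open>N\<close>. Such a map is a reflection, so its square fixes every index.\<close>

theorem reversor_square_fixes_axis:
  assumes r: "r \<in> carrier G" and rev: "r \<otimes> f \<otimes> inv r = inv f"
  shows "inv (w i) \<otimes> (r \<otimes> r) \<otimes> w i \<in> A \<inter> E"
proof -
  note carr = r f_carrier w_carrier
  \<comment> \<open>For s = r^-1 the conjugate of \<open>f\<close> at the edge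
    \<open>s \<otimes> w j\<close> contains r f r^-1, the expression in the hypothesis.\<close>
  define s where "s = inv r"
  have s: "s \<in> carrier G" using r by (simp add: s_def)
  have inv_s: "inv s = r" using r by (simp add: s_def)
  have sf: "s \<otimes> (f \<otimes> z) = inv f \<otimes> (s \<otimes> z)" if "z \<in> carrier G" for z
  proof -
    have "r \<otimes> (f \<otimes> s) = inv f" using rev carr by (simp add: s_def m_assoc)
    then have "f \<otimes> s = s \<otimes> inv f" using carr s by (metis inv_cancel_left(1) inv_s inv_cancel_left(2) m_closed s_def)
    then have "s = inv f \<otimes> (s \<otimes> inv f)" using carr s by (metis inv_cancel_left(1))
    then have "s \<otimes> f = inv f \<otimes> s" using carr s by (metis inv_closed inv_inv inv_cancel_left(2) m_assoc m_closed r_inv r_one l_inv)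
    then show ?thesis using carr s that by (simp flip: m_assoc)
  qed
  have "\<exists>k. inv (w k) \<otimes> (s \<otimes> w j) \<in> A \<inter> E" for j
  proof -
    have "inv (s \<otimes> w j) \<otimes> f \<otimes> (s \<otimes> w j) = inv (inv (w j) \<otimes> w (j + int N))"
    proof -
      have "inv (s \<otimes> w j) \<otimes> f \<otimes> (s \<otimes> w j) = inv (w j) \<otimes> (r \<otimes> f \<otimes> inv r) \<otimes> w j"
        using carr s by (simp add: inv_mult_group inv_s m_assoc) (simp add: s_def)
      also have "\<dots> = inv (inv (w j) \<otimes> (f \<otimes> w j))"
        unfolding rev using carr by (simp add: inv_mult_group m_assoc)
      finally show ?thesis by (simp add: translation)
    qed
    then have "inv (s \<otimes> w j) \<otimes> f \<otimes> (s \<otimes> w j) \<in> words N (1 - j - int N)"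
      using words_inv[OF words_axis[of j N]] by simp
    from on_axis[OF _ this N(2)] carr s show ?thesis by blast
  qed
  then obtain \<sigma> where \<sigma>: "\<And>j. inv (w (\<sigma> j)) \<otimes> (s \<otimes> w j) \<in> A \<inter> E" by metis
  define b where "b j = inv (w (\<sigma> j)) \<otimes> (s \<otimes> w j)" for j
  have b: "b j \<in> A \<inter> E" "b j \<in> carrier G" for j
    using \<sigma>[of j] carr s by (auto simp: b_def)
  have sw: "s \<otimes> w j = w (\<sigma> j) \<otimes> b j" for j using carr s by (simp add: b_def)
  have dist: "\<bar>\<sigma> j - \<sigma> k\<bar> = \<bar>j - k\<bar>" for j k
  proof -
    obtain a where a: "inv (w j) \<otimes> w k \<in> words (nat \<bar>j - k\<bar>) a" using words_axis_dist by blast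
    obtain a' where a': "inv (w (\<sigma> j)) \<otimes> w (\<sigma> k) \<in> words (nat \<bar>\<sigma> j - \<sigma> k\<bar>) a'"
      using words_axis_dist by blast
    have "inv (w j) \<otimes> w k = inv (s \<otimes> w j) \<otimes> (s \<otimes> w k)"
      using carr s by (simp add: inv_mult_group m_assoc)
    also have "\<dots> = inv (b j) \<otimes> ((inv (w (\<sigma> j)) \<otimes> w (\<sigma> k)) \<otimes> b k)"
      unfolding sw using carr b(2) by (simp add: inv_mult_group m_assoc)
    also have "\<dots> \<in> words (nat \<bar>\<sigma> j - \<sigma> k\<bar>) a'"
    proof (rule words_Int_mult)
      show "inv (b j) \<in> A \<inter> E" by (rule subgroup.m_inv_closed[OF subgroup_Int b(1)])
      show "inv (w (\<sigma> j)) \<otimes> w (\<sigma> k) \<otimes> b k \<in> words (nat \<bar>\<sigma> j - \<sigma> k\<bar>) a'"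
        using words_mult[OF a', of "b k" 0] b(1) by simp
    qed
    finally have "nat \<bar>j - k\<bar> = nat \<bar>\<sigma> j - \<sigma> k\<bar>" by (rule words_unique[OF a])
    then show ?thesis by simp
  qed
  have shift: "\<sigma> (j + int N) = \<sigma> j - int N" for j
  proof -
    have "w (\<sigma> (j + int N)) \<otimes> b (j + int N) = s \<otimes> (f \<otimes> w j)" by (simp add: translation sw)
    also have "\<dots> = inv f \<otimes> (w (\<sigma> j) \<otimes> b j)" using carr by (simp add: sf sw)
    also have "\<dots> = w (\<sigma> j - int N) \<otimes> b j"
      using carr b(2) by (simp flip: inv_f_translation add: m_assoc)
    finally have "inv (w (\<sigma> j - int N)) \<otimes> (w (\<sigma> (j + int N)) \<otimes> b (j + int N)) \<otimes> inv (b (j + int N)) =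
        b j \<otimes> inv (b (j + int N))"
      using carr b(2) by (simp add: m_assoc)
    then have "inv (w (\<sigma> j - int N)) \<otimes> w (\<sigma> (j + int N)) = b j \<otimes> inv (b (j + int N))"
      using carr b(2) by (simp add: m_assoc)
    also have "\<dots> \<in> words 0 0"
      using b(1) subgroup.m_closed[OF subgroup_Int] subgroup.m_inv_closed[OF subgroup_Int] by simp
    finally have "inv (w (\<sigma> j - int N)) \<otimes> w (\<sigma> (j + int N)) \<in> words 0 0" .
    moreover obtain a where "inv (w (\<sigma> j - int N)) \<otimes> w (\<sigma> (j + int N)) \<in>
        words (nat \<bar>\<sigma> j - int N - \<sigma> (j + int N)\<bar>) a"
      using words_axis_dist by blast
    ultimately have "nat \<bar>\<sigma> j - int N - \<sigma> (j + int N)\<bar> = 0" using words_unique by metis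
    then show ?thesis by simp
  qed
  \<comment> \<open>The distance to \<open>\<sigma> 0\<close> leaves the values \<sigma> 0 + j and
    \<sigma> 0 - j; the distance to \<sigma> N = \<sigma> 0 - N excludes the former unless j =
    0.\<close>
  have reflect: "\<sigma> j = \<sigma> 0 - j" for j
    using dist[of j 0] dist[of j "int N"] shift[of 0] N(1) by auto
  have "s \<otimes> (s \<otimes> w i) = w i \<otimes> (b (\<sigma> i) \<otimes> b i)"
  proof -
    have "\<sigma> (\<sigma> i) = i" using reflect[of i] reflect[of "\<sigma> i"] by simp
    have "s \<otimes> (s \<otimes> w i) = s \<otimes> (w (\<sigma> i) \<otimes> b i)" by (simp add: sw)
    also have "\<dots> = (s \<otimes> w (\<sigma> i)) \<otimes> b i" using carr s b(2) by (simp add: m_assoc)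
    also have "\<dots> = w i \<otimes> (b (\<sigma> i) \<otimes> b i)"
      using carr b(2) \<open>\<sigma> (\<sigma> i) = i\<close> by (simp add: sw m_assoc)
    finally show ?thesis .
  qed
  then have "inv (w i) \<otimes> (s \<otimes> (s \<otimes> w i)) = b (\<sigma> i) \<otimes> b i" using carr b(2) by simp
  then have "inv (w i) \<otimes> (s \<otimes> (s \<otimes> w i)) \<in> A \<inter> E"
    using b(1) subgroup.m_closed[OF subgroup_Int] by simp
  from subgroup.m_inv_closed[OF subgroup_Int this]
  show ?thesis using carr s by (simp add: inv_mult_group inv_s m_assoc)
qed

end

section \<open>Existence of the axis\<close>

context alternating_amalgam
begin

text \<open>The geodesic from 1 to \<open>g\<close> is continued periodically by powers of
  \<open>g\<close> and translated by \<open>h\<close>: with i = a + q N + k and 0 \<le> k < N, the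
  edge \<open>w i\<close> is h g^q p(k). As \<open>N\<close> is even, the types of the letters match
  where the pieces meet.\<close>

lemma exists_axis:
  assumes g: "g \<in> words N a" and N: "N > 0" "even N" and h: "h \<in> carrier G"
  obtains w where "amalgam_axis G A E (h \<otimes> g \<otimes> inv h) w N"
proof -
  obtain p where p: "p 0 = \<one>" "p N = g" "\<And>k. p k \<in> carrier G"
    "\<And>k. k < N \<Longrightarrow> inv (p k) \<otimes> p (Suc k) \<in> letters (a + int k)"
    using words_path[OF N(1) g] by blast
  define q where "q i = (i - a) div int N" for i
  define k where "k i = nat ((i - a) mod int N)" for i
  have k: "k i < N" "int (k i) = (i - a) mod int N" for i using N by (simp_all add: k_def nat_less_iff)
  have i_eq: "i = a + q i * int N + int (k i)" for i unfolding k(2) q_def by simp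
  note gc = words_carrier[OF g]
  define w where "w i = h \<otimes> (g [^] q i \<otimes> p (k i))" for i
  have wc: "w i \<in> carrier G" for i using h gc p(3) by (simp add: w_def)
  have "amalgam_axis G A E (h \<otimes> g \<otimes> inv h) w N"
  proof unfold_locales
    show "0 < N" "even N" "h \<otimes> g \<otimes> inv h \<in> carrier G" "w i \<in> carrier G" for i
      using N h gc wc by auto
    show "h \<otimes> g \<otimes> inv h \<otimes> w i = w (i + int N)" for i
    proof -
      have *: "i + int N - a = (i - a) + int N" by simp
      have "q (i + int N) = q i + 1"
        unfolding q_def * using N by simp
      moreover have "k (i + int N) = k i"
        unfolding k_def * by simp
      moreover have "g [^] (q i + 1) = g \<otimes> g [^] q i"
        using gc int_pow_mult[of g 1 "q i"] by (simp add: add.commute int_pow_1)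
      ultimately show ?thesis using h gc p(3) by (simp add: w_def m_assoc)
    qed
    show "inv (w i) \<otimes> w (i + 1) \<in> letters i" for i
    proof -
      have par: "letters (a + int (k i)) = letters i"
      proof (rule letters_parity)
        have "a + int (k i) - i = - (q i * int N)" using i_eq[of i] by linarith
        then show "even (a + int (k i) - i)" using N by simp
      qed
      have "inv (w i) \<otimes> w (i + 1) = inv (p (k i)) \<otimes> p (Suc (k i))"
      proof (cases "Suc (k i) = N")
        case False
        then have lt: "int (k i) + 1 < int N" using k(1)[of i] by simp
        have eq: "i + 1 - a = int N * q i + (int (k i) + 1)"
          using i_eq[of i] by (simp add: mult.commute)
        have "(i + 1 - a) div int N = q i" by (rule int_div_pos_eq[OF eq _ lt]) simp
        moreover have "(i + 1 - a) mod int N = int (k i) + 1" by (rule int_mod_pos_eq[OF eq _ lt]) simp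
        ultimately have "q (i + 1) = q i" "k (i + 1) = Suc (k i)"
          unfolding q_def[of "i + 1"] k_def[of "i + 1"] by simp_all
        then show ?thesis using h gc p(3) by (simp add: w_def inv_mult_group m_assoc)
      next
        case True
        have "i + 1 - a = (q i + 1) * int N" using i_eq[of i] True by (simp add: algebra_simps)
        then have "(i + 1 - a) div int N = q i + 1" "(i + 1 - a) mod int N = 0" using N by simp_all
        then have "q (i + 1) = q i + 1" "k (i + 1) = 0"
          unfolding q_def[of "i + 1"] k_def[of "i + 1"] by simp_all
        then have "inv (w i) \<otimes> w (i + 1) = inv (p (k i)) \<otimes> (inv (g [^] q i) \<otimes> g [^] (q i + 1))"
          using h gc p(1,3) by (simp add: w_def inv_mult_group m_assoc)
        also have "inv (g [^] q i) \<otimes> g [^] (q i + 1) = g"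
          using gc int_pow_mult[of g "q i" 1] by (simp add: int_pow_1)
        finally show ?thesis using p(2) True by simp
      qed
      then show ?thesis using p(4)[OF k(1)[of i]] par by simp
    qed
  qed
  then show ?thesis by (rule that)
qed

end

section \<open>The amalgam structure of \<open>GA2\<close>\<close>

lemma affine_map_mult:
  "affine_map a b u c d v \<otimes>\<^bsub>GA2\<^esub> affine_map a' b' u' c' d' v' =
    affine_map (a * a' + b * c') (a * b' + b * d') (a * u' + b * v' + u)
      (c * a' + d * c') (c * b' + d * d') (c * u' + d * v' + v)"
  by (simp add: GA2_mult affine_map_def subst2_add subst2_mult const2_hom algebra_simps)

lemma poly_in_y_linear: "poly_in_y [:u, g:] = const2 u + const2 g * Y2"
  by (simp add: poly_in_y_pCons mult.commute)

lemma elementary_map_mult: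
  "elementary_map \<alpha> P \<beta> v \<otimes>\<^bsub>GA2\<^esub> elementary_map \<alpha>' P' \<beta>' v' =
    elementary_map (\<alpha> * \<alpha>') (smult \<alpha> P' + pcompose P [:v', \<beta>':]) (\<beta> * \<beta>') (\<beta> * v' + v)"
proof -
  have "subst2 (A, const2 \<beta>' * Y2 + const2 v') (poly_in_y P) = poly_in_y (pcompose P [:v', \<beta>':])" for A
    by (simp add: poly_in_y_pcompose[of P _ A] poly_in_y_linear add.commute)
  then show ?thesis
    by (simp add: GA2_mult elementary_map_def subst2_add subst2_mult const2_hom
        poly_in_y_add poly_in_y_smult algebra_simps)
qed

lemma affine_map_one: "affine_map 1 0 0 0 1 0 = \<one>\<^bsub>GA2\<^esub>"
  by (simp add: affine_map_def GA2_one const2_hom)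

lemma elementary_map_one: "elementary_map 1 0 1 0 = \<one>\<^bsub>GA2\<^esub>"
  by (simp add: elementary_map_def GA2_one const2_hom)

lemma affine_mapsE:
  assumes "m \<in> affine_maps"
  obtains a b u c d v where "m = affine_map a b u c d v" "a * d - b * c \<noteq> 0"
  using assms unfolding affine_maps_def affine_map_def by blast

lemma elementary_mapsE:
  assumes "m \<in> elementary_maps"
  obtains \<alpha> P \<beta> v where "m = elementary_map \<alpha> P \<beta> v" "\<alpha> \<noteq> 0" "\<beta> \<noteq> 0"
  using assms unfolding elementary_maps_def elementary_map_def by auto

lemma affine_map_eq_iff:
  "affine_map a b u c d v = affine_map a' b' u' c' d' v' \<longleftrightarrow>
    a = a' \<and> b = b' \<and> u = u' \<and> c = c' \<and> d = d' \<and> v = v'"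
  by (auto simp: affine_map_def const2_def X2_def Y2_def)

lemma elementary_map_eq_iff:
  "elementary_map \<alpha> P \<beta> v = elementary_map \<alpha>' P' \<beta>' v' \<longleftrightarrow> \<alpha> = \<alpha>' \<and> P = P' \<and> \<beta> = \<beta>' \<and> v = v'"
proof
  assume eq: "elementary_map \<alpha> P \<beta> v = elementary_map \<alpha>' P' \<beta>' v'"
  have coeff: "coeff (coeff (fst (elementary_map \<alpha> P \<beta> v)) j) i =
      (if i = 0 then coeff P j else if i = 1 \<and> j = 0 then \<alpha> else 0)" for i j \<alpha> P \<beta> v
    by (auto simp: elementary_map_def const2_def X2_def coeff_poly_in_y coeff_pCons split: nat.splits)
  have "coeff P j = coeff P' j" for j
    using coeff[of \<alpha> P \<beta> v j 0] coeff[of \<alpha>' P' \<beta>' v' j 0] eq by simp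
  then have "P = P'" by (rule poly_eqI)
  moreover have "\<alpha> = \<alpha>'"
    using coeff[of \<alpha> P \<beta> v 0 1] coeff[of \<alpha>' P' \<beta>' v' 0 1] eq by simp
  moreover have "\<beta> = \<beta>' \<and> v = v'"
    using eq by (simp add: elementary_map_def const2_def Y2_def)
  ultimately show "\<alpha> = \<alpha>' \<and> P = P' \<and> \<beta> = \<beta>' \<and> v = v'" by blast
qed auto

lemma subgroup_affine_maps: "subgroup affine_maps (GA2 :: 'a::field plane_map monoid)"
proof (rule GA2.subgroupI)
  show "affine_maps \<noteq> ({} :: 'a plane_map set)" using affine_map_in[of 1 1 0 0] by force
  fix m n :: "'a plane_map"
  assume m: "m \<in> affine_maps"
  then obtain a b u c d v where m_eq: "m = affine_map a b u c d v" "a * d - b * c \<noteq> 0"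
    by (rule affine_mapsE)
  define e where "e = 1 / (a * d - b * c)"
  have e: "e \<noteq> 0" "a * d * e = 1 + b * c * e" using m_eq(2) by (simp_all add: e_def field_simps)
  let ?n = "affine_map (d * e) (- b * e) (e * (b * v - d * u)) (- c * e) (a * e) (e * (c * u - a * v))"
  have "(d * e) * (a * e) - (- b * e) * (- c * e) = e * ((a * d - b * c) * e)"
    by (simp add: algebra_simps)
  also have "\<dots> = e" using m_eq(2) by (simp add: e_def)
  finally have n: "?n \<in> affine_maps" using e(1) by (intro affine_map_in) simp
  have "?n \<otimes>\<^bsub>GA2\<^esub> m = \<one>\<^bsub>GA2\<^esub>"
    unfolding m_eq affine_map_mult affine_map_one[symmetric] affine_map_eq_iff
    using e(2) by (simp add: algebra_simps)
  then have "inv\<^bsub>GA2\<^esub> m = ?n"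
    using m n affine_maps_subset by (intro GA2.inv_equality) auto
  then show "inv\<^bsub>GA2\<^esub> m \<in> affine_maps" using n by simp
  assume "n \<in> affine_maps"
  then obtain a' b' u' c' d' v' where n_eq: "n = affine_map a' b' u' c' d' v'" "a' * d' - b' * c' \<noteq> 0"
    by (rule affine_mapsE)
  have "(a * a' + b * c') * (c * b' + d * d') - (a * b' + b * d') * (c * a' + d * c') =
      (a * d - b * c) * (a' * d' - b' * c')"
    by (simp add: algebra_simps)
  then show "m \<otimes>\<^bsub>GA2\<^esub> n \<in> affine_maps"
    unfolding m_eq n_eq affine_map_mult using m_eq(2) n_eq(2) by (intro affine_map_in) simp
qed (rule affine_maps_subset)

lemma subgroup_elementary_maps: "subgroup elementary_maps (GA2 :: 'a::field plane_map monoid)"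
proof (rule GA2.subgroupI)
  show "elementary_maps \<noteq> ({} :: 'a plane_map set)" using elementary_map_in[of 1 1] by force
  fix m n :: "'a plane_map"
  assume m: "m \<in> elementary_maps"
  then obtain \<alpha> P \<beta> v where m_eq: "m = elementary_map \<alpha> P \<beta> v" "\<alpha> \<noteq> 0" "\<beta> \<noteq> 0"
    by (rule elementary_mapsE)
  define L where "L = [:- v / \<beta>, 1 / \<beta>:]"
  let ?n = "elementary_map (1 / \<alpha>) (- smult (1 / \<alpha>) (pcompose P L)) (1 / \<beta>) (- v / \<beta>)"
  have n: "?n \<in> elementary_maps" using m_eq by (intro elementary_map_in) auto
  have "pcompose L [:v, \<beta>:] = [:0, 1:]" using m_eq(3) by (simp add: L_def pcompose_pCons)
  then have "pcompose (pcompose P L) [:v, \<beta>:] = P" by (metis pcompose_assoc pcompose_idR)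
  then have "?n \<otimes>\<^bsub>GA2\<^esub> m = \<one>\<^bsub>GA2\<^esub>"
    unfolding m_eq(1) elementary_map_mult elementary_map_one[symmetric] elementary_map_eq_iff
    using m_eq by (simp add: pcompose_uminus pcompose_smult)
  then have "inv\<^bsub>GA2\<^esub> m = ?n"
    using m n elementary_maps_subset by (intro GA2.inv_equality) auto
  then show "inv\<^bsub>GA2\<^esub> m \<in> elementary_maps" using n by simp
  assume "n \<in> elementary_maps"
  then obtain \<alpha>' P' \<beta>' v' where "n = elementary_map \<alpha>' P' \<beta>' v'" "\<alpha>' \<noteq> 0" "\<beta>' \<noteq> 0"
    by (rule elementary_mapsE)
  then show "m \<otimes>\<^bsub>GA2\<^esub> n \<in> elementary_maps"
    using m_eq by (simp add: elementary_map_mult elementary_map_in)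
qed (rule elementary_maps_subset)

lemma affine_map_eq_elementary_map:
  "affine_map \<alpha> g u 0 \<beta> v = elementary_map \<alpha> [:u, g:] \<beta> v"
  by (simp add: affine_map_def elementary_map_def poly_in_y_linear const2_hom)

lemma affine_map_in_basic_maps:
  "\<alpha> \<noteq> 0 \<Longrightarrow> \<beta> \<noteq> 0 \<Longrightarrow> affine_map \<alpha> g u 0 \<beta> v \<in> basic_maps"
  unfolding basic_maps_def using affine_map_in[of \<alpha> \<beta> g 0] elementary_map_in[of \<alpha> \<beta>]
  by (simp add: affine_map_eq_elementary_map)

lemma basic_mapsE:
  assumes "m \<in> basic_maps"
  obtains \<alpha> g u \<beta> v where "m = affine_map \<alpha> g u 0 \<beta> v" "\<alpha> \<noteq> 0" "\<beta> \<noteq> 0"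
proof -
  have in_both: "m \<in> affine_maps" "m \<in> elementary_maps" using assms by (auto simp: basic_maps_def)
  obtain a b u c d v where m: "m = affine_map a b u c d v" "a * d - b * c \<noteq> 0"
    by (rule affine_mapsE[OF in_both(1)])
  obtain \<alpha> P \<beta> v' where m': "m = elementary_map \<alpha> P \<beta> v'"
    by (rule elementary_mapsE[OF in_both(2)])
  have "snd (affine_map a b u c d v) = snd (elementary_map \<alpha> P \<beta> v')" using m(1) m' by simp
  then have "c = 0"
    by (simp add: affine_map_def elementary_map_def const2_def X2_def Y2_def)
  then show ?thesis using m that[of a b u d v] by simp
qed

lemma (in two_subgroups) words_SucI:
  "x \<in> letters i \<Longrightarrow> y \<in> words n (i + 1) \<Longrightarrow> x \<otimes> y \<in> words (Suc n) i"
  by auto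

lemma (in two_subgroups) words_SucE:
  assumes "z \<in> words (Suc n) i"
  obtains x y where "z = x \<otimes> y" "x \<in> letters i" "y \<in> words n (i + 1)"
  using assms by auto

declare (in two_subgroups) words.simps(2) [simp del]

interpretation GA2: two_subgroups "GA2 :: 'a::field plane_map monoid" affine_maps elementary_maps
  by (intro two_subgroups.intro two_subgroups_axioms.intro group_GA2
      subgroup_affine_maps subgroup_elementary_maps)

lemma letters_evenE:
  assumes "m \<in> GA2.letters i" "even i"
  obtains a b u c d v where "m = affine_map a b u c d v" "a * d - b * c \<noteq> 0" "c \<noteq> 0"
proof -
  have m: "m \<in> affine_maps" "m \<notin> basic_maps"
    using assms by (auto simp: GA2.letters_def GA2.factor_def basic_maps_def)
  from m(1) obtain a b u c d v where eq: "m = affine_map a b u c d v" "a * d - b * c \<noteq> 0"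
    by (rule affine_mapsE)
  then have "c \<noteq> 0" using m(2) affine_map_in_basic_maps[of a d b u v] by auto
  with eq that show ?thesis by blast
qed

lemma letters_oddE:
  assumes "m \<in> GA2.letters i" "odd i"
  obtains \<alpha> P \<beta> v where "m = elementary_map \<alpha> P \<beta> v" "\<alpha> \<noteq> 0" "\<beta> \<noteq> 0" "degree P \<ge> 2"
proof -
  have m: "m \<in> elementary_maps" "m \<notin> basic_maps"
    using assms by (auto simp: GA2.letters_def GA2.factor_def basic_maps_def)
  from m(1) obtain \<alpha> P \<beta> v where eq: "m = elementary_map \<alpha> P \<beta> v" "\<alpha> \<noteq> 0" "\<beta> \<noteq> 0"
    by (rule elementary_mapsE)
  have "degree P \<ge> 2"
  proof (rule ccontr)
    assume "\<not> ?thesis"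
    then have "P = [:coeff P 0, coeff P 1:]"
      by (intro poly_eqI) (auto simp: coeff_pCons coeff_eq_0 split: nat.splits)
    then have "m = affine_map \<alpha> (coeff P 1) (coeff P 0) 0 \<beta> v"
      using eq by (simp add: affine_map_eq_elementary_map)
    then show False using m(2) affine_map_in_basic_maps[OF eq(2,3)] by metis
  qed
  with eq that show ?thesis by blast
qed

text \<open>Along the curve \<open>(t\<^sup>3, t\<^sup>2)\<close> the degrees of the two components tell apart the basic maps
  and the alternating words beginning with an affine or with an elementary letter.\<close>

definition curve_subst :: "'a::field poly poly \<Rightarrow> 'a poly poly" where
  "curve_subst = subst2 (Y2 ^ 3, Y2 ^ 2)"

lemma curve_subst_mult:
  "curve_subst (fst (f \<otimes>\<^bsub>GA2\<^esub> g)) = subst2 (curve_subst (fst g), curve_subst (snd g)) (fst f)"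
  "curve_subst (snd (f \<otimes>\<^bsub>GA2\<^esub> g)) = subst2 (curve_subst (fst g), curve_subst (snd g)) (snd f)"
  by (simp_all add: GA2_mult curve_subst_def subst2_subst2)

lemma degree_const2_mult_add:
  assumes "a \<noteq> 0" "degree q < degree p" "degree p > 0"
  shows "degree (const2 a * p + const2 b * q + const2 c) = degree p"
proof -
  have "degree (const2 a * p) = degree p" using assms(1) by (simp add: const2_def)
  moreover have "degree (const2 b * q + const2 c) < degree p"
    using assms by (intro degree_add_less) (simp_all add: const2_def order.strict_trans1[OF degree_smult_le])
  ultimately show ?thesis by (simp add: degree_add_eq_left add.assoc)
qed

lemma degree_const2_mult_add_le:
  "degree (const2 a * p + const2 b * q + const2 c) \<le> max (degree p) (degree q)"
  by (intro degree_add_le) (simp_all add: const2_def le_max_iff_disj)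

text \<open>An affine letter has a nonzero entry c, so for q < p the new second degree is p. An
  elementary letter has deg P \<ge> 2, so for p < 2 q the new first degree is deg P times q. Each
  outcome supplies the inequality that the next letter of the other type requires, and the start (3,
  2) satisfies both.\<close>

lemma degree_curve_words:
  assumes "x \<in> GA2.words n i"
  defines "p \<equiv> degree (curve_subst (fst x))" and "q \<equiv> degree (curve_subst (snd x))"
  shows "q \<ge> 2 \<and> (if n = 0 then p = 3 \<and> q = 2 else if even i then p \<le> q \<and> 3 \<le> q else 2 * q \<le> p)"
  using assms(1) unfolding p_def q_def
proof (induction n arbitrary: x i)
  case 0
  then have "x \<in> basic_maps" by (simp add: basic_maps_def)
  then obtain \<alpha> g u \<beta> v where x: "x = affine_map \<alpha> g u 0 \<beta> v" "\<alpha> \<noteq> 0" "\<beta> \<noteq> 0"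
    by (rule basic_mapsE)
  have "degree (const2 \<alpha> * Y2 ^ 3 + const2 g * Y2 ^ 2 + const2 u) = 3"
    using x by (subst degree_const2_mult_add) (simp_all add: Y2_power degree_monom_eq)
  moreover have "degree (const2 \<beta> * Y2 ^ 2 + const2 0 * 0 + const2 v) = 2"
    using x by (subst degree_const2_mult_add) (simp_all add: Y2_power degree_monom_eq)
  ultimately show ?case
    by (simp add: x curve_subst_def affine_map_def subst2_add subst2_mult const2_hom)
next
  case (Suc n)
  obtain l y where ly: "x = l \<otimes>\<^bsub>GA2\<^esub> y" "l \<in> GA2.letters i" "y \<in> GA2.words n (i + 1)"
    by (rule GA2.words_SucE[OF Suc.prems])
  let ?p = "curve_subst (fst y)" and ?q = "curve_subst (snd y)"
  note IH = Suc.IH[OF ly(3)]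
  show ?case
  proof (cases "even i")
    case True
    obtain a b u c d v where l: "l = affine_map a b u c d v" "c \<noteq> 0"
      using letters_evenE[OF ly(2) True] by metis
    have y: "degree ?q < degree ?p" "degree ?q \<ge> 2" using IH True by (auto split: if_splits)
    have "curve_subst (fst x) = const2 a * ?p + const2 b * ?q + const2 u"
      "curve_subst (snd x) = const2 c * ?p + const2 d * ?q + const2 v"
      by (simp_all add: ly(1) curve_subst_mult l affine_map_def subst2_add subst2_mult)
    moreover have "degree (const2 c * ?p + const2 d * ?q + const2 v) = degree ?p"
      using l y by (intro degree_const2_mult_add) auto
    moreover have "degree (const2 a * ?p + const2 b * ?q + const2 u) \<le> degree ?p"
      using degree_const2_mult_add_le[of a ?p b ?q u] y by simp
    ultimately show ?thesis using y True by simp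
  next
    case False
    obtain \<alpha> P \<beta> v where l: "l = elementary_map \<alpha> P \<beta> v" "\<alpha> \<noteq> 0" "\<beta> \<noteq> 0" "degree P \<ge> 2"
      using letters_oddE[OF ly(2) False] by metis
    have y: "degree ?p < 2 * degree ?q" "degree ?q \<ge> 2" using IH False by (auto split: if_splits)
    have eq: "curve_subst (fst x) = const2 \<alpha> * ?p + pcompose (poly_in_y P) ?q"
      "curve_subst (snd x) = const2 \<beta> * ?q + const2 0 * 0 + const2 v"
      by (simp_all add: ly(1) curve_subst_mult l elementary_map_def subst2_add subst2_mult
          subst2_poly_in_y_eq_pcompose const2_hom)
    have "degree (const2 \<beta> * ?q + const2 0 * 0 + const2 v) = degree ?q"
      using l y by (intro degree_const2_mult_add) auto
    moreover have dP: "degree (pcompose (poly_in_y P) ?q) = degree P * degree ?q"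
      by (simp add: degree_pcompose)
    moreover have two: "2 * degree ?q \<le> degree P * degree ?q" using l(4) by simp
    moreover have "degree (const2 \<alpha> * ?p) \<le> degree ?p" by (simp add: const2_def degree_smult_le)
    then have "degree (const2 \<alpha> * ?p) < degree (pcompose (poly_in_y P) ?q)"
      using y two dP by linarith
    ultimately have "degree (curve_subst (fst x)) = degree P * degree ?q"
      "degree (curve_subst (snd x)) = degree ?q"
      using y unfolding eq by (simp_all add: degree_add_eq_right)
    then show ?thesis using y False two by simp
  qed
qed

interpretation GA2: alternating_amalgam "GA2 :: 'a::field plane_map monoid" affine_maps elementary_maps
proof unfold_locales
  show "GA2.words n i \<inter> (affine_maps \<inter> elementary_maps) = ({} :: 'a plane_map set)" if "n > 0" for n i
  proof -
    have False if x: "x \<in> GA2.words n i" "x \<in> affine_maps \<inter> elementary_maps" for x :: "'a plane_map"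
    proof -
      have "x \<in> GA2.words 0 0" using x(2) by simp
      from degree_curve_words[OF this] degree_curve_words[OF x(1)] \<open>n > 0\<close> show False
        by (auto split: if_splits)
    qed
    then show ?thesis by blast
  qed
qed (rule GA2_subset_tame)

section \<open>The length\<close>

lemma letters_iff:
  "m \<in> GA2.letters i \<longleftrightarrow> (if even i then m \<in> affine_maps - basic_maps else m \<in> elementary_maps - basic_maps)"
  by (auto simp: GA2.letters_def GA2.factor_def basic_maps_def)

lemma alternating_words:
  assumes "alternating gs" "gs \<noteq> []" "hd gs \<in> GA2.letters i"
  shows "foldr (monoid.mult GA2) gs \<one>\<^bsub>GA2\<^esub> \<in> GA2.words (length gs) i"
  using assms
proof (induction gs arbitrary: i)
  case (Cons x gs)
  show ?case
  proof (cases gs)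
    case Nil
    then show ?thesis using Cons.prems GA2.letters_carrier[of x i] GA2.r_one[of x] by (simp add: GA2.words_1)
  next
    case (Cons y ys)
    have "alternating gs" using \<open>alternating (x # gs)\<close> by (auto simp: alternating_def Cons)
    moreover have "y \<in> GA2.letters (i + 1)"
      using \<open>alternating (x # gs)\<close> Cons.prems(3) unfolding letters_iff
      by (auto simp: alternating_def Cons basic_maps_def split: if_splits)
    ultimately have "foldr (monoid.mult GA2) gs \<one>\<^bsub>GA2\<^esub> \<in> GA2.words (length gs) (i + 1)"
      using Cons.IH Cons by simp
    then show ?thesis using GA2.words_SucI[of x i] Cons.prems(3) by simp
  qed
qed simp

text \<open>The trailing factor from the intersection is absorbed into the last letter, so at least
  one letter has to be present.\<close>

lemma words_alternating:
  assumes "x \<in> GA2.words (Suc n) i"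
  shows "\<exists>gs. length gs = Suc n \<and> alternating gs \<and> hd gs \<in> GA2.letters i \<and>
    foldr (monoid.mult GA2) gs \<one>\<^bsub>GA2\<^esub> = x"
  using assms
proof (induction n arbitrary: x i)
  case 0
  then have "x \<in> GA2.letters i" by (simp only: GA2.words_1)
  moreover from this have "alternating [x]"
    unfolding letters_iff alternating_def by (auto split: if_splits)
  ultimately show ?case using GA2.letters_carrier[of x i] GA2.r_one[of x] by (intro exI[of _ "[x]"]) simp
next
  case (Suc n)
  obtain l y where ly: "x = l \<otimes>\<^bsub>GA2\<^esub> y" "l \<in> GA2.letters i" "y \<in> GA2.words (Suc n) (i + 1)"
    by (rule GA2.words_SucE[OF Suc.prems])
  obtain gs where gs: "length gs = Suc n" "alternating gs" "hd gs \<in> GA2.letters (i + 1)"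
    "foldr (monoid.mult GA2) gs \<one>\<^bsub>GA2\<^esub> = y"
    using Suc.IH[OF ly(3)] by blast
  then have "alternating (l # gs)"
    using ly(2) unfolding letters_iff
    by (cases gs) (auto simp: alternating_def split: if_splits)
  then show ?case using gs ly by (intro exI[of _ "l # gs"]) simp
qed

lemma ga2_length_words:
  assumes "g \<in> GA2.words n i"
  shows "ga2_length g = n"
proof (cases n)
  case 0
  then show ?thesis using assms by (simp add: ga2_length_def basic_maps_def)
next
  case (Suc m)
  have "g \<notin> basic_maps"
    using GA2.words_disjoint[of n i] assms Suc by (auto simp: basic_maps_def)
  moreover have "(THE n. \<exists>gs. length gs = n \<and> n \<ge> 1 \<and> alternating gs \<and>
                       foldr (monoid.mult GA2) gs \<one>\<^bsub>GA2\<^esub> = g) = n"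
  proof (rule the_equality)
    show "\<exists>gs. length gs = n \<and> n \<ge> 1 \<and> alternating gs \<and> foldr (monoid.mult GA2) gs \<one>\<^bsub>GA2\<^esub> = g"
      using words_alternating[of g m i] assms Suc by auto
  next
    fix k
    assume "\<exists>gs. length gs = k \<and> k \<ge> 1 \<and> alternating gs \<and> foldr (monoid.mult GA2) gs \<one>\<^bsub>GA2\<^esub> = g"
    then obtain gs where gs: "length gs = k" "k \<ge> 1" "alternating gs"
      "foldr (monoid.mult GA2) gs \<one>\<^bsub>GA2\<^esub> = g" by blast
    then have "gs \<noteq> []" by auto
    then have "hd gs \<in> GA2.letters 0 \<or> hd gs \<in> GA2.letters 1"
      using gs(3) unfolding letters_iff alternating_def by (cases gs) auto
    then obtain j where "hd gs \<in> GA2.letters j" by blast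
    from alternating_words[OF gs(3) \<open>gs \<noteq> []\<close> this] gs have "g \<in> GA2.words k j" by simp
    then show "k = n" using GA2.words_unique[OF _ assms] by blast
  qed
  ultimately show ?thesis by (simp add: ga2_length_def)
qed

section \<open>Elements fixing the axis\<close>

text \<open>On linear parts: the first basis vector is an eigenvector of the right-hand triangular
  matrix, so its image under \<open>c\<close> is one of the left-hand matrix. As the lower left
  entry of \<open>c\<close> is nonzero, this image spans a second eigenline, with eigenvalue
  \<open>\<beta>\<close>; for equal eigenvalues the matrix is scalar. If both linear parts are 1,
  the translation vectors correspond under \<open>c\<close>, and those along the first axis must
  vanish.\<close>

lemma affine_step:
  fixes \<alpha> \<beta> :: "'a::field"
  assumes c: "c \<in> GA2.letters i" "even i"
    and eq: "affine_map \<alpha> g u 0 \<beta> v \<otimes>\<^bsub>GA2\<^esub> c = c \<otimes>\<^bsub>GA2\<^esub> affine_map \<alpha>' g' u' 0 \<beta>' v'"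
  shows "\<alpha>' = \<beta>" "\<beta>' = \<alpha>" "\<alpha> = \<beta> \<Longrightarrow> g = 0 \<and> g' = 0"
    "\<alpha> = 1 \<Longrightarrow> \<beta> = 1 \<Longrightarrow> v = 0 \<Longrightarrow> v' = 0 \<Longrightarrow> u = 0"
proof -
  obtain p q m r t k where ceq: "c = affine_map p q m r t k" "p * t - q * r \<noteq> 0" "r \<noteq> 0"
    using letters_evenE[OF c] by metis
  have e: "\<alpha> * p + g * r = p * \<alpha>'" "\<alpha> * q + g * t = p * g' + q * \<beta>'"
    "\<alpha> * m + g * k + u = p * u' + q * v' + m"
    "\<beta> * r = r * \<alpha>'" "\<beta> * t = r * g' + t * \<beta>'" "\<beta> * k + v = r * u' + t * v' + k"
    using eq unfolding ceq affine_map_mult affine_map_eq_iff by simp_all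
  show \<alpha>': "\<alpha>' = \<beta>" using e(4) ceq(3) by simp
  have g: "g * r = (\<beta> - \<alpha>) * p" using e(1) by (simp add: \<alpha>' algebra_simps)
  have g': "r * g' = (\<beta> - \<beta>') * t" using e(5) by (simp add: algebra_simps)
  have "r * (\<alpha> * q + g * t) = r * (p * g' + q * \<beta>')" using e(2) by simp
  then have "\<alpha> * q * r + (g * r) * t = p * (r * g') + q * \<beta>' * r" by (simp add: algebra_simps)
  then have "(\<beta>' - \<alpha>) * (p * t - q * r) = 0" unfolding g g' by (simp add: algebra_simps)
  with ceq(2) show \<beta>': "\<beta>' = \<alpha>" by simp
  show gg: "g = 0 \<and> g' = 0" if "\<alpha> = \<beta>" using g g' that ceq(3) by (simp add: \<beta>')
  show "u = 0" if "\<alpha> = 1" "\<beta> = 1" "v = 0" "v' = 0"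
  proof -
    have "u' = 0" using e(6) that ceq(3) by simp
    then show ?thesis using e(3) that gg by simp
  qed
qed

text \<open>\<open>P\<close> agrees with a linear polynomial at all n v, which are infinitely many
  points in characteristic 0.\<close>

lemma constant_difference_imp_degree_le:
  fixes P :: "'a::field poly"
  assumes char: "CHAR('a) = 0" and v: "v \<noteq> 0" and diff: "\<And>x. poly P (x + v) = poly P x + c"
  shows "degree P \<le> 1"
proof -
  have val: "poly P (of_nat n * v) = poly P 0 + of_nat n * c" for n
  proof (induction n)
    case (Suc n)
    have "of_nat (Suc n) * v = of_nat n * v + v" by (simp add: algebra_simps)
    then show ?case using diff[of "of_nat n * v"] Suc by (simp add: algebra_simps)
  qed simp
  let ?Q = "P - [:poly P 0, c / v:]"
  have "inj (\<lambda>n. of_nat n * v)"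
  proof (rule injI)
    fix m n assume "of_nat m * v = of_nat n * v"
    then have "of_nat m = (of_nat n :: 'a)" using v by simp
    then show "m = n"
      using char of_nat_eq_iff_char_dvd[of m n, where 'a = 'a] of_nat_eq_iff_char_dvd[of n m, where 'a = 'a]
      by (cases m n rule: linorder_cases) auto
  qed
  then have "infinite (range (\<lambda>n. of_nat n * v))" by (rule range_inj_infinite)
  moreover have "range (\<lambda>n. of_nat n * v) \<subseteq> {x. poly ?Q x = 0}" using v by (auto simp: val)
  ultimately have "?Q = 0" using poly_roots_finite[of ?Q] finite_subset by blast
  then have "P = [:poly P 0, c / v:]" by simp
  then show ?thesis by (metis degree_pCons_le degree_pCons_0 le_trans Suc_le_mono One_nat_def le_refl)
qed

text \<open>The relation reads P(\<beta> y + v') = \<alpha> P(y) + terms of degree at most 1. Since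
  deg P \<ge> 2, the leading coefficients give \<alpha> = \<beta>^(deg P). With trivial linear part,
  P(y + v') - P(y) is constant, which forces v' = 0 in characteristic 0.\<close>

lemma elementary_step:
  fixes \<alpha> \<beta> :: "'a::field"
  assumes c: "c \<in> GA2.letters i" "odd i" and nz: "\<alpha> \<noteq> 0" "\<beta> \<noteq> 0"
    and eq: "affine_map \<alpha> g u 0 \<beta> v \<otimes>\<^bsub>GA2\<^esub> c = c \<otimes>\<^bsub>GA2\<^esub> affine_map \<alpha>' g' u' 0 \<beta>' v'"
  shows "\<alpha>' = \<alpha>" "\<beta>' = \<beta>" "\<exists>d\<ge>2. \<alpha> = \<beta> ^ d"
    "CHAR('a) = 0 \<Longrightarrow> \<alpha> = 1 \<Longrightarrow> \<beta> = 1 \<Longrightarrow> g = 0 \<Longrightarrow> g' = 0 \<Longrightarrow> v = 0 \<and> v' = 0"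
proof -
  obtain \<epsilon> P \<delta> \<kappa> where ceq: "c = elementary_map \<epsilon> P \<delta> \<kappa>" "\<epsilon> \<noteq> 0" "\<delta> \<noteq> 0" "degree P \<ge> 2"
    using letters_oddE[OF c] by metis
  have e: "\<alpha> * \<epsilon> = \<epsilon> * \<alpha>'" "\<beta> * \<delta> = \<delta> * \<beta>'" "\<beta> * \<kappa> + v = \<delta> * v' + \<kappa>"
    "smult \<alpha> P + pcompose [:u, g:] [:\<kappa>, \<delta>:] = smult \<epsilon> [:u', g':] + pcompose P [:v', \<beta>':]"
    using eq unfolding ceq affine_map_eq_elementary_map elementary_map_mult elementary_map_eq_iff
    by simp_all
  show \<alpha>': "\<alpha>' = \<alpha>" and \<beta>': "\<beta>' = \<beta>" using e(1,2) ceq by simp_all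
  have "pcompose P [:v', \<beta>:] = smult \<alpha> P + (pcompose [:u, g:] [:\<kappa>, \<delta>:] - smult \<epsilon> [:u', g':])"
    using e(4) by (simp add: \<beta>' algebra_simps)
  moreover have "coeff (pcompose [:u, g:] [:\<kappa>, \<delta>:] - smult \<epsilon> [:u', g':]) (degree P) = 0"
    using ceq(4) by (intro coeff_eq_0 order.strict_trans1[OF degree_diff_le_max])
      (auto simp: pcompose_pCons degree_pCons_eq_if)
  ultimately have "coeff (pcompose P [:v', \<beta>:]) (degree P) = \<alpha> * lead_coeff P" by simp
  moreover have "degree (pcompose P [:v', \<beta>:]) = degree P" using nz by (simp add: degree_pcompose)
  moreover have "lead_coeff (pcompose P [:v', \<beta>:]) = lead_coeff P * \<beta> ^ degree P"
    using nz by (subst lead_coeff_comp) auto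
  ultimately have "\<alpha> * lead_coeff P = lead_coeff P * \<beta> ^ degree P" by simp
  moreover have "lead_coeff P \<noteq> 0" using ceq(4) by auto
  ultimately have "\<alpha> = \<beta> ^ degree P" by simp
  then show "\<exists>d\<ge>2. \<alpha> = \<beta> ^ d" using ceq(4) by blast
  show "v = 0 \<and> v' = 0" if H: "CHAR('a) = 0" "\<alpha> = 1" "\<beta> = 1" "g = 0" "g' = 0"
  proof -
    have "P + [:u:] = [:\<epsilon> * u':] + pcompose P [:v', 1:]"
      using e(4) H by (simp add: \<beta>')
    then have "poly (P + [:u:]) x = poly ([:\<epsilon> * u':] + pcompose P [:v', 1:]) x" for x by simp
    then have "poly P (x + v') = poly P x + (u - \<epsilon> * u')" for x
      by (simp add: poly_pcompose algebra_simps)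
    from constant_difference_imp_degree_le[OF H(1) _ this] have "v' = 0" using ceq(4) by force
    then show ?thesis using e(3) H by simp
  qed
qed

text \<open>An element fixing the axis, written at each edge: for s with axis edges
  \<open>w i\<close>, \<open>b i\<close> is the conjugate of s by \<open>w i\<close>, and
  \<open>c i\<close> is the step from \<open>w i\<close> to \<open>w (i + 1)\<close>.\<close>

locale axis_stabilizer =
  fixes b c :: "int \<Rightarrow> 'a::field plane_map"
  assumes basic: "b i \<in> basic_maps" and letter: "c i \<in> GA2.letters i"
    and conj: "b i \<otimes>\<^bsub>GA2\<^esub> c i = c i \<otimes>\<^bsub>GA2\<^esub> b (i + 1)"
begin

lemma parameters:
  "\<exists>\<alpha> g u \<beta> v. \<forall>i. b i = affine_map (\<alpha> i) (g i) (u i) 0 (\<beta> i) (v i) \<and> \<alpha> i \<noteq> 0 \<and> \<beta> i \<noteq> 0"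
proof -
  have "\<forall>i. \<exists>\<alpha> g u \<beta> v. b i = affine_map \<alpha> g u 0 \<beta> v \<and> \<alpha> \<noteq> 0 \<and> \<beta> \<noteq> 0"
    using basic_mapsE[OF basic] by metis
  then show ?thesis by metis
qed

text \<open>Positions 1 and 3 are elementary and position 2 interchanges the entries between them,
  so \<alpha> = \<beta>^d and \<beta> = \<alpha>^d'. Hence \<open>\<beta>\<close> is a root of unity
  of order dividing d d' - 1 > 0.\<close>

lemma linear_part_torsion:
  assumes "b 1 = affine_map \<alpha> g u 0 \<beta> v"
  shows "\<exists>n>0. \<alpha> ^ n = 1 \<and> \<beta> ^ n = 1"
proof -
  obtain al ga uu be vv where b: "\<And>i. b i = affine_map (al i) (ga i) (uu i) 0 (be i) (vv i)"
    and nz: "\<And>i. al i \<noteq> 0" "\<And>i. be i \<noteq> 0"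
    using parameters by blast
  have eq: "affine_map (al i) (ga i) (uu i) 0 (be i) (vv i) \<otimes>\<^bsub>GA2\<^esub> c i =
      c i \<otimes>\<^bsub>GA2\<^esub> affine_map (al (i + 1)) (ga (i + 1)) (uu (i + 1)) 0 (be (i + 1)) (vv (i + 1))" for i
    using conj[of i] by (simp add: b)
  note E1 = elementary_step[OF letter _ nz eq, of 1, simplified]
  note A2 = affine_step[OF letter _ eq, of 2, simplified]
  note E3 = elementary_step[OF letter _ nz eq, of 3, simplified]
  obtain d d' where d: "d \<ge> 2" "al 1 = be 1 ^ d" and d': "d' \<ge> 2" "al 3 = be 3 ^ d'"
    using E1(3) E3(3) by blast
  have "be 1 = al 1 ^ d'" using d' A2(1,2) E1(1,2) by simp
  then have "be 1 ^ (d * d') = be 1" using d(2) by (simp add: power_mult)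
  moreover have "2 * 2 \<le> d * d'" using d(1) d'(1) by (rule mult_le_mono)
  then obtain n where n: "d * d' = Suc n" "n > 0" by (cases "d * d'") auto
  ultimately have "be 1 ^ n = 1" using nz(2)[of 1] by simp
  moreover have "al 1 ^ n = 1"
    using \<open>be 1 ^ n = 1\<close> by (simp add: d(2) flip: power_mult) (simp add: power_mult mult.commute[of d])
  moreover have "al 1 = \<alpha>" "be 1 = \<beta>" using b[of 1] assms by (simp_all add: affine_map_eq_iff)
  ultimately show ?thesis using n(2) by blast
qed

text \<open>The affine positions 0, 2, 4 remove the shears at the edges 1 to 4, the elementary
  positions 1 and 3 then remove the second translation entry at the edges 2 and 3, and position 2
  finally removes the first one at edge 2.\<close>

lemma unipotent_trivial:
  assumes char: "CHAR('a) = 0" and b1: "b 1 = affine_map 1 g u 0 1 v"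
  shows "b 2 = \<one>\<^bsub>GA2\<^esub>"
proof -
  obtain al ga uu be vv where b: "\<And>i. b i = affine_map (al i) (ga i) (uu i) 0 (be i) (vv i)"
    and nz: "\<And>i. al i \<noteq> 0" "\<And>i. be i \<noteq> 0"
    using parameters by blast
  have eq: "affine_map (al i) (ga i) (uu i) 0 (be i) (vv i) \<otimes>\<^bsub>GA2\<^esub> c i =
      c i \<otimes>\<^bsub>GA2\<^esub> affine_map (al (i + 1)) (ga (i + 1)) (uu (i + 1)) 0 (be (i + 1)) (vv (i + 1))" for i
    using conj[of i] by (simp add: b)
  note A0 = affine_step[OF letter _ eq, of 0, simplified]
  note E1 = elementary_step[OF letter _ nz eq, of 1, simplified]
  note A2 = affine_step[OF letter _ eq, of 2, simplified]
  note E3 = elementary_step[OF letter _ nz eq, of 3, simplified]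
  note A4 = affine_step[OF letter _ eq, of 4, simplified]
  have 1: "al 1 = 1" "be 1 = 1" using b[of 1] b1 by (simp_all add: affine_map_eq_iff)
  have 0: "al 0 = 1" "be 0 = 1" using A0(1,2) 1 by simp_all
  have 2: "al 2 = 1" "be 2 = 1" using E1(1,2) 1 by simp_all
  have 3: "al 3 = 1" "be 3 = 1" using A2(1,2) 2 by simp_all
  have 4: "al 4 = 1" "be 4 = 1" using E3(1,2) 3 by simp_all
  have g: "ga 1 = 0" "ga 2 = 0" "ga 3 = 0" "ga 4 = 0"
    using A0(3) A2(3) A4(3) 0 2 4 by simp_all
  have v: "vv 2 = 0" "vv 3 = 0"
    using E1(4) E3(4) char 1 3 g by simp_all
  have "uu 2 = 0" using A2(4) 2 v by simp
  then show ?thesis using b[of 2] 2 g v by (simp add: affine_map_one)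
qed

end

section \<open>Finite order of reversors\<close>

lemma subgroup_basic_maps: "subgroup basic_maps (GA2 :: 'a::field plane_map monoid)"
  using GA2.subgroup_Int by (simp add: basic_maps_def)

lemma affine_map_pow:
  "\<exists>g' u' v'. affine_map \<alpha> g u 0 \<beta> v [^]\<^bsub>GA2\<^esub> n = affine_map (\<alpha> ^ n) g' u' 0 (\<beta> ^ n) v'"
proof (induction n)
  case 0
  then show ?case by (auto simp: affine_map_one[symmetric])
next
  case (Suc n)
  then show ?case by (auto simp: affine_map_mult affine_map_eq_iff mult.commute)
qed

lemma (in group) conj_pow:
  assumes "x \<in> carrier G" "w \<in> carrier G"
  shows "(inv w \<otimes> x \<otimes> w) [^] (n::nat) = inv w \<otimes> x [^] n \<otimes> w"
proof (induction n)
  case (Suc n)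
  then show ?case using assms by (simp add: m_assoc)
qed (use assms in simp)

lemma (in group) conj_eq_one:
  assumes "x \<in> carrier G" "w \<in> carrier G" "inv w \<otimes> x \<otimes> w = \<one>"
  shows "x = \<one>"
proof -
  have "x = w \<otimes> (inv w \<otimes> x \<otimes> w) \<otimes> inv w" using assms(1,2) by (simp add: m_assoc)
  then show ?thesis using assms by simp
qed

lemma (in group) finite_subgroup_pow:
  assumes "subgroup H G" "finite H" "x \<in> H"
  shows "\<exists>n>0. x [^] (n::nat) = \<one>"
proof -
  interpret H: group "G\<lparr>carrier := H\<rparr>" by (rule subgroup.subgroup_is_group[OF assms(1) group_axioms])
  have "x [^]\<^bsub>G\<lparr>carrier := H\<rparr>\<^esub> Coset.order (G\<lparr>carrier := H\<rparr>) = \<one>"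
    using H.pow_order_eq_1[of x] assms by simp
  then have "x [^] card H = \<one>" by (simp add: Coset.order_def flip: nat_pow_consistent)
  moreover have "card H > 0" using assms by (auto simp: card_gt_0_iff)
  ultimately show ?thesis by blast
qed

lemma finite_basic_maps:
  assumes "finite (UNIV :: 'a::field set)"
  shows "finite (basic_maps :: 'a plane_map set)"
proof -
  have "basic_maps \<subseteq> (\<lambda>(\<alpha>, g, u, \<beta>, v). affine_map \<alpha> g u 0 \<beta> v :: 'a plane_map) ` UNIV"
  proof
    fix m :: "'a plane_map" assume "m \<in> basic_maps"
    then obtain \<alpha> g u \<beta> v where "m = affine_map \<alpha> g u 0 \<beta> v" by (rule basic_mapsE)
    then show "m \<in> (\<lambda>(\<alpha>, g, u, \<beta>, v). affine_map \<alpha> g u 0 \<beta> v) ` UNIV"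
      by (intro image_eqI[of _ _ "(\<alpha>, g, u, \<beta>, v)"]) auto
  qed
  moreover have "finite (UNIV :: ('a \<times> 'a \<times> 'a \<times> 'a \<times> 'a) set)"
    using assms by (simp add: finite_prod)
  ultimately show ?thesis by (meson finite_imageI finite_subset)
qed

lemma CR_element_axis:
  assumes "CR_element f"
  obtains w N where "amalgam_axis GA2 affine_maps elementary_maps f w N"
proof -
  obtain g h where gh: "cyclically_reduced g" "h \<in> carrier GA2" "f = h \<otimes>\<^bsub>GA2\<^esub> g \<otimes>\<^bsub>GA2\<^esub> inv\<^bsub>GA2\<^esub> h"
    using assms unfolding CR_element_def by blast
  then obtain N a where words: "g \<in> GA2.words N a"
    using GA2.exists_words unfolding cyclically_reduced_def by blast
  then have "N > 0" "even N"
    using gh(1) ga2_length_words[OF words] unfolding cyclically_reduced_def by auto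
  with words show ?thesis using GA2.exists_axis[OF _ _ _ gh(2)] that gh(3) by metis
qed

lemma reversor_square_torsion:
  fixes f r :: "'a::field plane_map"
  assumes K: "CHAR('a) = 0 \<or> finite (UNIV :: 'a set)"
    and axis: "amalgam_axis GA2 affine_maps elementary_maps f w N"
    and r: "r \<in> carrier GA2" "r \<otimes>\<^bsub>GA2\<^esub> f \<otimes>\<^bsub>GA2\<^esub> inv\<^bsub>GA2\<^esub> r = inv\<^bsub>GA2\<^esub> f"
  shows "\<exists>n>0. (r \<otimes>\<^bsub>GA2\<^esub> r) [^]\<^bsub>GA2\<^esub> (n::nat) = \<one>\<^bsub>GA2\<^esub>"
    and "CHAR('a) = 0 \<Longrightarrow> {u :: 'a. \<exists>n>0. u ^ n = 1} = {1, -1} \<Longrightarrow>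
      (r \<otimes>\<^bsub>GA2\<^esub> r) [^]\<^bsub>GA2\<^esub> (2::nat) = \<one>\<^bsub>GA2\<^esub>"
proof -
  interpret axis: amalgam_axis GA2 affine_maps elementary_maps f w N by (rule axis)
  let ?s = "r \<otimes>\<^bsub>GA2\<^esub> r"
  have s: "?s \<in> carrier GA2" using r by simp
  define b where "b i = inv\<^bsub>GA2\<^esub> w i \<otimes>\<^bsub>GA2\<^esub> ?s \<otimes>\<^bsub>GA2\<^esub> w i" for i
  define c where "c i = inv\<^bsub>GA2\<^esub> w i \<otimes>\<^bsub>GA2\<^esub> w (i + 1)" for i
  have b_basic: "b i \<in> basic_maps" for i
    using axis.reversor_square_fixes_axis[OF r] by (simp add: b_def basic_maps_def)
  have b_pow: "b i [^]\<^bsub>GA2\<^esub> n = inv\<^bsub>GA2\<^esub> w i \<otimes>\<^bsub>GA2\<^esub> (?s [^]\<^bsub>GA2\<^esub> n) \<otimes>\<^bsub>GA2\<^esub> w i" for i and n :: nat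
    unfolding b_def by (rule GA2.conj_pow[OF s axis.w_carrier])
  have s_pow: "?s [^]\<^bsub>GA2\<^esub> n = \<one>\<^bsub>GA2\<^esub>" if "b i [^]\<^bsub>GA2\<^esub> n = \<one>\<^bsub>GA2\<^esub>" for i and n :: nat
    using GA2.conj_eq_one[OF GA2.nat_pow_closed[OF s] axis.w_carrier] that unfolding b_pow by blast
  \<comment> \<open>Powers are included because a suitable power, whose diagonal entries are 1, will
    be shown to be trivial.\<close>
  have stab: "axis_stabilizer (\<lambda>i. b i [^]\<^bsub>GA2\<^esub> n) c" for n :: nat
  proof
    show "b i [^]\<^bsub>GA2\<^esub> n \<in> basic_maps" for i
      by (induction n) (simp_all add: subgroup.one_closed[OF subgroup_basic_maps]
          subgroup.m_closed[OF subgroup_basic_maps] b_basic)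
    show "c i \<in> GA2.letters i" for i unfolding c_def by (rule axis.step)
    show "b i [^]\<^bsub>GA2\<^esub> n \<otimes>\<^bsub>GA2\<^esub> c i = c i \<otimes>\<^bsub>GA2\<^esub> b (i + 1) [^]\<^bsub>GA2\<^esub> n" for i
      unfolding b_pow c_def using GA2.nat_pow_closed[OF s] axis.w_carrier by (simp add: GA2.m_assoc)
  qed
  obtain \<alpha> g u \<beta> v where b1: "b 1 = affine_map \<alpha> g u 0 \<beta> v"
    using basic_mapsE[OF b_basic[of 1]] by metis
  obtain n where n: "n > 0" "\<alpha> ^ n = 1" "\<beta> ^ n = 1"
  proof -
    have "b 1 \<in> carrier GA2" using s axis.w_carrier by (simp add: b_def)
    then have "b 1 [^]\<^bsub>GA2\<^esub> (1::nat) = affine_map \<alpha> g u 0 \<beta> v" by (simp add: b1)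
    from axis_stabilizer.linear_part_torsion[OF stab this] show ?thesis using that by blast
  qed
  have char0: "?s [^]\<^bsub>GA2\<^esub> n = \<one>\<^bsub>GA2\<^esub>" if n: "CHAR('a) = 0" "\<alpha> ^ n = 1" "\<beta> ^ n = 1" for n
  proof -
    obtain g' u' v' where "b 1 [^]\<^bsub>GA2\<^esub> n = affine_map 1 g' u' 0 1 v'"
      using affine_map_pow[of \<alpha> g u \<beta> v n] n by (auto simp: b1)
    from axis_stabilizer.unipotent_trivial[OF stab n(1) this] show ?thesis by (rule s_pow)
  qed
  show "\<exists>n>0. ?s [^]\<^bsub>GA2\<^esub> (n::nat) = \<one>\<^bsub>GA2\<^esub>"
  proof (cases "CHAR('a) = 0")
    case True
    then show ?thesis using char0 n by blast
  next
    case False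
    with K have "finite (basic_maps :: 'a plane_map set)" by (intro finite_basic_maps) simp
    from GA2.finite_subgroup_pow[OF subgroup_basic_maps this b_basic[of 0]] show ?thesis
      using s_pow by blast
  qed
  show "?s [^]\<^bsub>GA2\<^esub> (2::nat) = \<one>\<^bsub>GA2\<^esub>"
    if char: "CHAR('a) = 0" and U: "{u :: 'a. \<exists>n>0. u ^ n = 1} = {1, -1}"
  proof -
    \<comment> \<open>Both diagonal entries are roots of unity, hence 1 or -1, so exponent 2 already
      makes them 1.\<close>
    have "\<alpha> \<in> {u. \<exists>n>0. u ^ n = 1}" "\<beta> \<in> {u. \<exists>n>0. u ^ n = 1}" using n by blast+
    then have "\<alpha> \<in> {1, -1}" "\<beta> \<in> {1, -1}" unfolding U by blast+
    then show ?thesis using char by (intro char0) auto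
  qed
qed

theorem theorem4:
  fixes f r :: "'a::field plane_map"
  assumes "CHAR('a) = 0 \<or> finite (UNIV :: 'a set)"
    and "CR_element f"
    and "reversor GA2 f r"
  shows "(group.ord GA2 r > 0 \<and> even (group.ord GA2 r)) \<and>
         (CHAR('a) = 0 \<and> {u :: 'a. \<exists>n>0. u ^ n = 1} = {1, -1} \<longrightarrow>
            involution GA2 r \<or> group.ord GA2 r = 4)"
proof -
  obtain w N where axis: "amalgam_axis GA2 affine_maps elementary_maps f w N"
    by (rule CR_element_axis[OF assms(2)])
  interpret axis: amalgam_axis GA2 affine_maps elementary_maps f w N by (rule axis)
  note f = axis.f_carrier
  have r: "r \<in> carrier GA2" "r \<otimes>\<^bsub>GA2\<^esub> f \<otimes>\<^bsub>GA2\<^esub> inv\<^bsub>GA2\<^esub> r = inv\<^bsub>GA2\<^esub> f"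
    using assms(3) by (auto simp: reversor_def)
  let ?s = "r \<otimes>\<^bsub>GA2\<^esub> r"
  have s: "?s \<in> carrier GA2" using r by simp
  have s_pow: "?s [^]\<^bsub>GA2\<^esub> n = r [^]\<^bsub>GA2\<^esub> (2 * n)" for n :: nat
    using r GA2.nat_pow_pow[of r 2 n] by (simp add: numeral_2_eq_2)
  obtain n :: nat where "n > 0" "r [^]\<^bsub>GA2\<^esub> (2 * n) = \<one>\<^bsub>GA2\<^esub>"
    using reversor_square_torsion(1)[OF assms(1) axis r] unfolding s_pow by blast
  \<comment> \<open>\<open>ord\<close> is 0 for elements of infinite order, so positivity expresses
    finite order.\<close>
  then have pos: "group.ord GA2 r > 0"
    using r GA2.pow_eq_id[of r "2 * n"] by (metis dvd_0_left_iff gr0I mult_is_0 not_gr0 zero_neq_numeral)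
  have even: "even (group.ord GA2 r)"
  proof (rule ccontr)
    assume "odd (group.ord GA2 r)"
    then obtain k where k: "group.ord GA2 r = 2 * k + 1" by (elim oddE)
    have rf: "r \<otimes>\<^bsub>GA2\<^esub> f = inv\<^bsub>GA2\<^esub> f \<otimes>\<^bsub>GA2\<^esub> r"
      using r f by (metis GA2.inv_closed GA2.inv_solve_right GA2.m_closed)
    have rf': "r \<otimes>\<^bsub>GA2\<^esub> inv\<^bsub>GA2\<^esub> f = f \<otimes>\<^bsub>GA2\<^esub> r"
    proof -
      have "f \<otimes>\<^bsub>GA2\<^esub> r = f \<otimes>\<^bsub>GA2\<^esub> (r \<otimes>\<^bsub>GA2\<^esub> f) \<otimes>\<^bsub>GA2\<^esub> inv\<^bsub>GA2\<^esub> f"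
        using r(1) f by (simp add: GA2.m_assoc)
      then show ?thesis unfolding rf using r(1) f by simp
    qed
    have "?s \<otimes>\<^bsub>GA2\<^esub> f = f \<otimes>\<^bsub>GA2\<^esub> ?s"
    proof -
      have "?s \<otimes>\<^bsub>GA2\<^esub> f = r \<otimes>\<^bsub>GA2\<^esub> (inv\<^bsub>GA2\<^esub> f \<otimes>\<^bsub>GA2\<^esub> r)"
        using r(1) f by (simp add: GA2.m_assoc rf)
      also have "\<dots> = (f \<otimes>\<^bsub>GA2\<^esub> r) \<otimes>\<^bsub>GA2\<^esub> r"
        using r(1) f by (simp flip: GA2.m_assoc rf')
      finally show ?thesis using r(1) f by (simp add: GA2.m_assoc)
    qed
    then have "?s [^]\<^bsub>GA2\<^esub> (k + 1) \<otimes>\<^bsub>GA2\<^esub> f = f \<otimes>\<^bsub>GA2\<^esub> ?s [^]\<^bsub>GA2\<^esub> (k + 1)"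
      using s f by (intro GA2.group_commutes_pow)
    \<comment> \<open>The exponent 2 (k + 1) exceeds the odd order 2 k + 1 by one.\<close>
    moreover have "?s [^]\<^bsub>GA2\<^esub> (k + 1) = r"
    proof -
      have "r [^]\<^bsub>GA2\<^esub> (2 * (k + 1)) = r [^]\<^bsub>GA2\<^esub> group.ord GA2 r \<otimes>\<^bsub>GA2\<^esub> r"
        unfolding k using r(1) by (simp add: GA2.m_assoc)
      then show ?thesis unfolding s_pow using r(1) by simp
    qed
    ultimately have "inv\<^bsub>GA2\<^esub> f \<otimes>\<^bsub>GA2\<^esub> r = f \<otimes>\<^bsub>GA2\<^esub> r" using rf by simp
    then have "inv\<^bsub>GA2\<^esub> f = f" using r(1) f by simp
    then have "f \<otimes>\<^bsub>GA2\<^esub> f = \<one>\<^bsub>GA2\<^esub>" using f GA2.r_inv[of f] by simp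
    then show False using axis.f_square_nontrivial by blast
  qed
  have "involution GA2 r \<or> group.ord GA2 r = 4"
    if "CHAR('a) = 0" "{u :: 'a. \<exists>n>0. u ^ n = 1} = {1, -1}"
  proof -
    have "r [^]\<^bsub>GA2\<^esub> (2 * 2 :: nat) = \<one>\<^bsub>GA2\<^esub>"
      using reversor_square_torsion(2)[OF assms(1) axis r that] unfolding s_pow .
    then have dvd: "group.ord GA2 r dvd 4" using GA2.pow_eq_id[OF r(1)] by simp
    then have "group.ord GA2 r \<le> 4" by (rule dvd_imp_le) simp
    then consider "group.ord GA2 r = 2" | "group.ord GA2 r = 4"
      using pos even by (cases "group.ord GA2 r = 3") (force elim: evenE)+
    then show ?thesis
    proof cases
      case 1
      have "?s = \<one>\<^bsub>GA2\<^esub>" using GA2.pow_ord_eq_1[OF r(1)] r(1) by (simp add: 1 numeral_2_eq_2)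
      moreover have "r \<noteq> \<one>\<^bsub>GA2\<^esub>" using 1 by auto
      ultimately show ?thesis using r(1) by (simp add: involution_def)
    qed simp
  qed
  then show ?thesis using pos even by blast
qed

end
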